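(* Let $k$ be an algebraically closed field of characteristic zero. Let $A$ be a connected radical square zero $k$-algebra and let $B\subseteq A$ be a radical square zero subalgebra such that $Q_B$ is a subquiver of $Q_A$. Then there is an isomorphism of Lie algebras $$\mathrm{HH}^1(A|B)\cong \prod_{[\alpha]\in S}\mathfrak{sl}_{|\alpha|}(k)\rtimes\left(\left(\prod_{[\alpha]\in\overline{E}}\mathfrak{I}_\alpha\rtimes kI_\alpha\right)\times\mathfrak a\right),$$ where $\mathfrak a=\left(\prod_{[\alpha]\in\overline{D}}kI_\alpha\right)/\mathrm{Im}(\delta^0_{A|B})$ is an abelian Lie subalgebra.
   Context: A radical square zero algebra is $A=kQ_A/I_A$ with $Q_A$ a finite quiver and $I_A$ generated by all paths of length two. $Q_B$ is a subquiver of $Q_A$ with the same vertices, compatibly with the inclusion $B\subseteq A$ (arrows of $Q_B$ are arrows of $Q_A$ as elements of $A$). $Q_C$ is the quiver with the vertices of $Q_A$ and the arrows of $Q_A$ not in $Q_B$. $\mathrm{HH}^1(A|B)=\mathrm{Der}_{B^e}(A)/\mathrm{Inn}_{B^e}(A)$, the derivations of $A$ that are $B$-bimodule homomorphisms (equivalently, vanish on $B$) modulo the inner ones with this property, with commutator bracket. Notation. Arrows are composed right to left. For an arrow $a$ and a nonzero path $p$ of $A$ parallel to $a$ (same source and target), $a/\!/p$ denotes a formal basis element, corresponding to the assignment $a\mapsto p$ and all other arrows to $0$. Let $\mathrm{Ker}(\delta^1_A)$ be the set of linear combinations of such symbols that define a derivation of $A$ vanishing on the vertices. The bracket is $[a/\!/p,b/\!/q]=b/\!/q^{a/\!/p}-a/\!/p^{b/\!/q}$,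 where $q^{a/\!/p}$ is the sum of all paths, nonzero in $A$, obtained from $q$ by replacing one occurrence of $a$ by $p$. $\mathrm{Im}(\delta^0_A)$ is the span of the elements $$\delta^0(e/\!/p)=\sum_{s(a)=e,\ ap\neq0}a/\!/ap-\sum_{t(a)=e,\ pa\ne0}a/\!/pa$$ for vertices $e$ and nonzero paths $p$ from $e$ to $e$. $\mathrm{Ker}(\delta^1_{A|B})$ is the set of elements of $\mathrm{Ker}(\delta^1_A)$ involving only $a/\!/p$ with $a\notin (Q_B)_1$, and $\mathrm{Im}(\delta^0_{A|B})=\mathrm{Im}(\delta^0_A)\cap\mathrm{Ker}(\delta^1_{A|B})$. For a quiver $Q$, $\overline{Q}_1$ is the set of equivalence classes of parallel arrows of $Q$, and $|\alpha|$ is the cardinality of the class $[\alpha]$. For $[\alpha]\in(\overline{Q_C})_1$: - $\mathfrak I_\alpha$ is the span of all $a/\!/b$ with $a\in[\alpha]$ (an arrow of $Q_C$) and $b$ an arrow of $Q_B$ parallel to $a$ ($\mathfrak I_\alpha=0$ if there is no such $b$); - $I_\alpha=\sum_{a\in[\alpha]}a/\!/a$ and $kI_\alpha$ is its span. $S=\{[\alpha]\in(\overline{Q_C})_1 : |\alpha|>1\}$. $\overline D$ is the set of classes $[\alpha]\in(\overline{Q_C})_1$ such that no arrow of $Q_B$ is parallel to $\alpha$; $\overline E$ is the set of the remaining classes, for which at least one arrow of $Q_B$ is parallel to $\alpha$. In $\mathfrak I_\alpha\rtimes kI_\alpha$ the ideal is $\mathfrak I_\alpha$. In the displayed decomposition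 the ideal is the right-hand factor $\left(\prod_{\overline E}\mathfrak I_\alpha\rtimes kI_\alpha\right)\times\mathfrak a$ (the radical), and the subalgebra is $\prod_S\mathfrak{sl}_{|\alpha|}(k)$. *)

theory Defs
  imports
    "HOL-Algebra.QuotRing"
    "HOL-Algebra.Module"
    "HOL-Library.Poly_Mapping"
    "HOL-Computational_Algebra.Polynomial"
    "Graph_Theory.Graph_Theory"
    "Jordan_Normal_Form.Matrix"
begin

hide_const (open) Multiset.mult

section \<open>Free vector spaces\<close>

text \<open>The vector space with basis a set \<open>X\<close> is \<open>{f. keys f \<subseteq> X}\<close>, a space of finitely
  supported functions.\<close>

definition pscale :: "'k::field \<Rightarrow> ('x \<Rightarrow>\<^sub>0 'k) \<Rightarrow> ('x \<Rightarrow>\<^sub>0 'k)" where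
  "pscale c f = Poly_Mapping.map ((*) c) f"

lemma lookup_pscale [simp]:
  "Poly_Mapping.lookup (pscale c f) x = c * Poly_Mapping.lookup f x"
  by (simp add: pscale_def Poly_Mapping.map.rep_eq when_def)

global_interpretation free: vector_space "pscale :: 'k::field \<Rightarrow> ('x \<Rightarrow>\<^sub>0 'k) \<Rightarrow> ('x \<Rightarrow>\<^sub>0 'k)"
  by unfold_locales
    (rule poly_mapping_eqI; simp add: lookup_add algebra_simps)+


section \<open>Path algebras and radical square zero algebras\<close>

text \<open>A quiver is a directed multigraph. A path is stored as (source, arrows, target), the arrows
  being listed in the order in which they are traversed; the triple \<open>(e, [], e)\<close> is the trivial
  path at \<open>e\<close>. Composition is from right to left: \<open>x y\<close> is first \<open>y\<close>, then \<open>x\<close>.\<close>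

type_synonym ('v, 'b) path = "'v \<times> 'b list \<times> 'v"

definition psource :: "('v, 'b) path \<Rightarrow> 'v" where "psource x = fst x"
definition parrows :: "('v, 'b) path \<Rightarrow> 'b list" where "parrows x = fst (snd x)"
definition ptarget :: "('v, 'b) path \<Rightarrow> 'v" where "ptarget x = snd (snd x)"

definition paths :: "('v, 'b) pre_digraph \<Rightarrow> ('v, 'b) path set" where
  "paths Q = {(u, p, v). pre_digraph.awalk Q u p v}"

definition vertex_path :: "'v \<Rightarrow> ('v, 'b) path" where
  "vertex_path e = (e, [], e)"

definition arrow_path :: "('v, 'b) pre_digraph \<Rightarrow> 'b \<Rightarrow> ('v, 'b) path" where
  "arrow_path Q a = (tail Q a, [a], head Q a)"

definition path_comp :: "('v, 'b) path \<Rightarrow> ('v, 'b) path \<Rightarrow> ('v, 'b) path" where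
  "path_comp x y = (psource y, parrows y @ parrows x, ptarget x)"

definition path_algebra ::
    "('v, 'b) pre_digraph \<Rightarrow> ('k::field, ('v, 'b) path \<Rightarrow>\<^sub>0 'k) module" where
  "path_algebra Q =
    \<lparr> carrier = {f. Poly_Mapping.keys f \<subseteq> paths Q},
      mult = (\<lambda>f g. \<Sum>x\<in>Poly_Mapping.keys f. \<Sum>y\<in>Poly_Mapping.keys g.
                if psource x = ptarget y
                then Poly_Mapping.single (path_comp x y)
                       (Poly_Mapping.lookup f x * Poly_Mapping.lookup g y)
                else 0),
      one = (\<Sum>e\<in>verts Q. Poly_Mapping.single (vertex_path e) 1),
      zero = 0,
      add = (+),
      smult = pscale \<rparr>"

definition quotient_algebra :: "('k, 'x) module \<Rightarrow> 'x set \<Rightarrow> ('k, 'x set) module" where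
  "quotient_algebra R I =
    ring.extend (R Quot I) (module.fields (\<lambda>c X. \<Union>x\<in>X. I +>\<^bsub>R\<^esub> (c \<odot>\<^bsub>R\<^esub> x)))"

definition rsz_ideal :: "('v, 'b) pre_digraph \<Rightarrow> (('v, 'b) path \<Rightarrow>\<^sub>0 'k::field) set" where
  "rsz_ideal Q = genideal (path_algebra Q)
     {Poly_Mapping.single x 1 | x. x \<in> paths Q \<and> length (parrows x) = 2}"

definition rsz_algebra ::
    "('v, 'b) pre_digraph \<Rightarrow> ('k::field, (('v, 'b) path \<Rightarrow>\<^sub>0 'k) set) module" where
  "rsz_algebra Q = quotient_algebra (path_algebra Q) (rsz_ideal Q)"

definition rsz_class ::
    "('v, 'b) pre_digraph \<Rightarrow> (('v, 'b) path \<Rightarrow>\<^sub>0 'k::field) \<Rightarrow> (('v, 'b) path \<Rightarrow>\<^sub>0 'k) set" where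
  "rsz_class Q f = rsz_ideal Q +>\<^bsub>path_algebra Q\<^esub> f"

text \<open>For a subquiver \<open>QB\<close> of \<open>QA\<close> with the same vertices, the inclusion of path algebras induces
  an embedding of the radical square zero algebra of \<open>QB\<close> into that of \<open>QA\<close>; the subalgebra is its
  image, in which every vertex and every arrow of \<open>QB\<close> is the same vertex or arrow of \<open>QA\<close>.\<close>

definition rsz_subalgebra ::
    "('v, 'b) pre_digraph \<Rightarrow> ('v, 'b) pre_digraph \<Rightarrow> (('v, 'b) path \<Rightarrow>\<^sub>0 'k::field) set set" where
  "rsz_subalgebra QA QB = rsz_class QA ` carrier (path_algebra QB)"

text \<open>An algebra is connected if it is nonzero and not a direct product of two nonzero algebras.
  (In a unital algebra ring ideals are automatically subspaces.)\<close>

definition connected_algebra :: "('k, 'x) module \<Rightarrow> bool" where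
  "connected_algebra A \<longleftrightarrow> carrier A \<noteq> {\<zero>\<^bsub>A\<^esub>} \<and>
    (\<forall>I J. ideal I A \<and> ideal J A \<and> I <+>\<^bsub>A\<^esub> J = carrier A \<and> I \<inter> J = {\<zero>\<^bsub>A\<^esub>}
       \<longrightarrow> I = {\<zero>\<^bsub>A\<^esub>} \<or> J = {\<zero>\<^bsub>A\<^esub>})"


section \<open>Lie algebras\<close>

record ('k, 'x) lie =
  lcarrier :: "'x set"
  lplus :: "'x \<Rightarrow> 'x \<Rightarrow> 'x"
  lzero :: "'x"
  lscale :: "'k \<Rightarrow> 'x \<Rightarrow> 'x"
  lbracket :: "'x \<Rightarrow> 'x \<Rightarrow> 'x"

locale lie_algebra =
  fixes L :: "('k::field, 'x) lie"
  assumes zero_closed: "lzero L \<in> lcarrier L"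
    and plus_closed: "\<lbrakk>x \<in> lcarrier L; y \<in> lcarrier L\<rbrakk> \<Longrightarrow> lplus L x y \<in> lcarrier L"
    and scale_closed: "x \<in> lcarrier L \<Longrightarrow> lscale L c x \<in> lcarrier L"
    and bracket_closed: "\<lbrakk>x \<in> lcarrier L; y \<in> lcarrier L\<rbrakk> \<Longrightarrow> lbracket L x y \<in> lcarrier L"
    and plus_assoc: "\<lbrakk>x \<in> lcarrier L; y \<in> lcarrier L; z \<in> lcarrier L\<rbrakk>
          \<Longrightarrow> lplus L (lplus L x y) z = lplus L x (lplus L y z)"
    and plus_commute: "\<lbrakk>x \<in> lcarrier L; y \<in> lcarrier L\<rbrakk> \<Longrightarrow> lplus L x y = lplus L y x"
    and plus_zero: "x \<in> lcarrier L \<Longrightarrow> lplus L x (lzero L) = x"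
    and plus_inverse: "x \<in> lcarrier L \<Longrightarrow> lplus L x (lscale L (-1) x) = lzero L"
    and scale_plus: "\<lbrakk>x \<in> lcarrier L; y \<in> lcarrier L\<rbrakk>
          \<Longrightarrow> lscale L c (lplus L x y) = lplus L (lscale L c x) (lscale L c y)"
    and plus_scale: "x \<in> lcarrier L \<Longrightarrow> lscale L (c + d) x = lplus L (lscale L c x) (lscale L d x)"
    and scale_scale: "x \<in> lcarrier L \<Longrightarrow> lscale L c (lscale L d x) = lscale L (c * d) x"
    and scale_one: "x \<in> lcarrier L \<Longrightarrow> lscale L 1 x = x"
    and bracket_plus_left: "\<lbrakk>x \<in> lcarrier L; y \<in> lcarrier L; z \<in> lcarrier L\<rbrakk>
          \<Longrightarrow> lbracket L (lplus L x y) z = lplus L (lbracket L x z) (lbracket L y z)"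
    and bracket_plus_right: "\<lbrakk>x \<in> lcarrier L; y \<in> lcarrier L; z \<in> lcarrier L\<rbrakk>
          \<Longrightarrow> lbracket L x (lplus L y z) = lplus L (lbracket L x y) (lbracket L x z)"
    and bracket_scale_left: "\<lbrakk>x \<in> lcarrier L; y \<in> lcarrier L\<rbrakk>
          \<Longrightarrow> lbracket L (lscale L c x) y = lscale L c (lbracket L x y)"
    and bracket_scale_right: "\<lbrakk>x \<in> lcarrier L; y \<in> lcarrier L\<rbrakk>
          \<Longrightarrow> lbracket L x (lscale L c y) = lscale L c (lbracket L x y)"
    and bracket_alternating: "x \<in> lcarrier L \<Longrightarrow> lbracket L x x = lzero L"
    and jacobi: "\<lbrakk>x \<in> lcarrier L; y \<in> lcarrier L; z \<in> lcarrier L\<rbrakk>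
          \<Longrightarrow> lplus L (lbracket L x (lbracket L y z))
                (lplus L (lbracket L y (lbracket L z x)) (lbracket L z (lbracket L x y))) = lzero L"

definition lie_abelian :: "('k, 'x) lie \<Rightarrow> bool" where
  "lie_abelian L \<longleftrightarrow> (\<forall>x\<in>lcarrier L. \<forall>y\<in>lcarrier L. lbracket L x y = lzero L)"

definition lie_subspace :: "'x set \<Rightarrow> ('k, 'x) lie \<Rightarrow> bool" where
  "lie_subspace N L \<longleftrightarrow> N \<subseteq> lcarrier L \<and> lzero L \<in> N \<and>
     (\<forall>x\<in>N. \<forall>y\<in>N. lplus L x y \<in> N) \<and> (\<forall>c. \<forall>x\<in>N. lscale L c x \<in> N)"

definition lie_subalgebra :: "'x set \<Rightarrow> ('k, 'x) lie \<Rightarrow> bool" where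
  "lie_subalgebra N L \<longleftrightarrow> lie_subspace N L \<and> (\<forall>x\<in>N. \<forall>y\<in>N. lbracket L x y \<in> N)"

definition lie_ideal :: "'x set \<Rightarrow> ('k, 'x) lie \<Rightarrow> bool" where
  "lie_ideal N L \<longleftrightarrow> lie_subspace N L \<and> (\<forall>x\<in>lcarrier L. \<forall>y\<in>N. lbracket L x y \<in> N)"

definition lie_hom :: "('k, 'x) lie \<Rightarrow> ('k, 'y) lie \<Rightarrow> ('x \<Rightarrow> 'y) set" where
  "lie_hom L M = {\<phi> \<in> lcarrier L \<rightarrow> lcarrier M.
     (\<forall>x\<in>lcarrier L. \<forall>y\<in>lcarrier L. \<phi> (lplus L x y) = lplus M (\<phi> x) (\<phi> y)) \<and>
     (\<forall>c. \<forall>x\<in>lcarrier L. \<phi> (lscale L c x) = lscale M c (\<phi> x)) \<and>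
     (\<forall>x\<in>lcarrier L. \<forall>y\<in>lcarrier L. \<phi> (lbracket L x y) = lbracket M (\<phi> x) (\<phi> y))}"

definition lie_isomorphic :: "('k::field, 'x) lie \<Rightarrow> ('k, 'y) lie \<Rightarrow> bool"
    (infix \<open>\<cong>\<^sub>L\<close> 50) where
  "L \<cong>\<^sub>L M \<longleftrightarrow> lie_algebra L \<and> lie_algebra M \<and>
     (\<exists>\<phi>\<in>lie_hom L M. bij_betw \<phi> (lcarrier L) (lcarrier M))"

definition lie_coset :: "('k, 'x) lie \<Rightarrow> 'x set \<Rightarrow> 'x \<Rightarrow> 'x set" where
  "lie_coset L N x = lplus L x ` N"

definition lie_quotient :: "('k, 'x) lie \<Rightarrow> 'x set \<Rightarrow> ('k, 'x set) lie" where
  "lie_quotient L N =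
    \<lparr> lcarrier = lie_coset L N ` lcarrier L,
      lplus = (\<lambda>X Y. \<Union>x\<in>X. \<Union>y\<in>Y. lie_coset L N (lplus L x y)),
      lzero = lie_coset L N (lzero L),
      lscale = (\<lambda>c X. \<Union>x\<in>X. lie_coset L N (lscale L c x)),
      lbracket = (\<lambda>X Y. \<Union>x\<in>X. \<Union>y\<in>Y. lie_coset L N (lbracket L x y)) \<rparr>"

definition lie_prod :: "('k, 'x) lie \<Rightarrow> ('k, 'y) lie \<Rightarrow> ('k, 'x \<times> 'y) lie" where
  "lie_prod L M =
    \<lparr> lcarrier = lcarrier L \<times> lcarrier M,
      lplus = (\<lambda>(x, y) (x', y'). (lplus L x x', lplus M y y')),
      lzero = (lzero L, lzero M),
      lscale = (\<lambda>c (x, y). (lscale L c x, lscale M c y)),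
      lbracket = (\<lambda>(x, y) (x', y'). (lbracket L x x', lbracket M y y')) \<rparr>"

definition lie_PiE :: "'i set \<Rightarrow> ('i \<Rightarrow> ('k, 'x) lie) \<Rightarrow> ('k, 'i \<Rightarrow> 'x) lie" where
  "lie_PiE J L =
    \<lparr> lcarrier = (\<Pi>\<^sub>E i\<in>J. lcarrier (L i)),
      lplus = (\<lambda>f g. \<lambda>i\<in>J. lplus (L i) (f i) (g i)),
      lzero = (\<lambda>i\<in>J. lzero (L i)),
      lscale = (\<lambda>c f. \<lambda>i\<in>J. lscale (L i) c (f i)),
      lbracket = (\<lambda>f g. \<lambda>i\<in>J. lbracket (L i) (f i) (g i)) \<rparr>"

text \<open>The first component is the subalgebra \<open>L\<close>, the second the ideal \<open>M\<close>; \<open>act x\<close> is the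
  derivation \<open>[x, _]\<close> of \<open>M\<close>, so \<open>[x, y'] = act x y'\<close> and \<open>[y, x'] = - act x' y\<close>.\<close>

definition lie_semidirect ::
    "('k::field, 'x) lie \<Rightarrow> ('k, 'y) lie \<Rightarrow> ('x \<Rightarrow> 'y \<Rightarrow> 'y) \<Rightarrow> ('k, 'x \<times> 'y) lie" where
  "lie_semidirect L M act =
    \<lparr> lcarrier = lcarrier L \<times> lcarrier M,
      lplus = (\<lambda>(x, y) (x', y'). (lplus L x x', lplus M y y')),
      lzero = (lzero L, lzero M),
      lscale = (\<lambda>c (x, y). (lscale L c x, lscale M c y)),
      lbracket = (\<lambda>(x, y) (x', y').
        (lbracket L x x',
         lplus M (lbracket M y y') (lplus M (act x y') (lscale M (-1) (act x' y))))) \<rparr>"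

definition sl :: "nat \<Rightarrow> ('k::field, 'k mat) lie" where
  "sl n =
    \<lparr> lcarrier = {X \<in> carrier_mat n n. (\<Sum>i<n. X $$ (i, i)) = 0},
      lplus = (+),
      lzero = 0\<^sub>m n n,
      lscale = smult_mat,
      lbracket = (\<lambda>X Y. X * Y - Y * X) \<rparr>"


section \<open>The first relative Hochschild cohomology\<close>

text \<open>Maps on \<open>A\<close> are taken to be \<open>undefined\<close> outside the carrier, so that equal maps are equal
  functions.\<close>

definition Der :: "('k, 'x) module \<Rightarrow> ('x \<Rightarrow> 'x) set" where
  "Der A = {D \<in> carrier A \<rightarrow>\<^sub>E carrier A.
     (\<forall>x\<in>carrier A. \<forall>y\<in>carrier A. D (x \<oplus>\<^bsub>A\<^esub> y) = D x \<oplus>\<^bsub>A\<^esub> D y) \<and>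
     (\<forall>c. \<forall>x\<in>carrier A. D (c \<odot>\<^bsub>A\<^esub> x) = c \<odot>\<^bsub>A\<^esub> D x) \<and>
     (\<forall>x\<in>carrier A. \<forall>y\<in>carrier A.
        D (x \<otimes>\<^bsub>A\<^esub> y) = (D x \<otimes>\<^bsub>A\<^esub> y) \<oplus>\<^bsub>A\<^esub> (x \<otimes>\<^bsub>A\<^esub> D y))}"

definition rel_Der :: "('k, 'x) module \<Rightarrow> 'x set \<Rightarrow> ('x \<Rightarrow> 'x) set" where
  "rel_Der A B = {D \<in> Der A. \<forall>b\<in>B. \<forall>x\<in>carrier A.
     D (b \<otimes>\<^bsub>A\<^esub> x) = b \<otimes>\<^bsub>A\<^esub> D x \<and> D (x \<otimes>\<^bsub>A\<^esub> b) = D x \<otimes>\<^bsub>A\<^esub> b}"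

definition inner_der :: "('k, 'x) module \<Rightarrow> 'x \<Rightarrow> ('x \<Rightarrow> 'x)" where
  "inner_der A x = (\<lambda>y\<in>carrier A. (x \<otimes>\<^bsub>A\<^esub> y) \<ominus>\<^bsub>A\<^esub> (y \<otimes>\<^bsub>A\<^esub> x))"

definition rel_Inn :: "('k, 'x) module \<Rightarrow> 'x set \<Rightarrow> ('x \<Rightarrow> 'x) set" where
  "rel_Inn A B = rel_Der A B \<inter> inner_der A ` carrier A"

definition rel_Der_lie :: "('k, 'x) module \<Rightarrow> 'x set \<Rightarrow> ('k, 'x \<Rightarrow> 'x) lie" where
  "rel_Der_lie A B =
    \<lparr> lcarrier = rel_Der A B,
      lplus = (\<lambda>D E. \<lambda>x\<in>carrier A. D x \<oplus>\<^bsub>A\<^esub> E x),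
      lzero = (\<lambda>x\<in>carrier A. \<zero>\<^bsub>A\<^esub>),
      lscale = (\<lambda>c D. \<lambda>x\<in>carrier A. c \<odot>\<^bsub>A\<^esub> D x),
      lbracket = (\<lambda>D E. \<lambda>x\<in>carrier A. D (E x) \<ominus>\<^bsub>A\<^esub> E (D x)) \<rparr>"

definition HH1 :: "('k, 'x) module \<Rightarrow> 'x set \<Rightarrow> ('k, ('x \<Rightarrow> 'x) set) lie" where
  "HH1 A B = lie_quotient (rel_Der_lie A B) (rel_Inn A B)"


section \<open>Parallel pairs\<close>

text \<open>The nonzero paths of \<open>kQ\<close> modulo the paths of length two are the paths of length at most
  one. The symbol \<open>a//p\<close> is the basis vector \<open>single (a, p) 1\<close>.\<close>

definition nz_paths :: "('v, 'b) pre_digraph \<Rightarrow> ('v, 'b) path set" where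
  "nz_paths Q = {p \<in> paths Q. length (parrows p) \<le> 1}"

definition pair :: "'b \<Rightarrow> ('v, 'b) path \<Rightarrow> (('b \<times> ('v, 'b) path) \<Rightarrow>\<^sub>0 'k::field)" where
  "pair a p = Poly_Mapping.single (a, p) 1"

definition parallel_pairs :: "('v, 'b) pre_digraph \<Rightarrow> ('b \<times> ('v, 'b) path) set" where
  "parallel_pairs Q = {(a, p). a \<in> arcs Q \<and> p \<in> nz_paths Q \<and>
     psource p = tail Q a \<and> ptarget p = head Q a}"

definition pair_value ::
    "(('b \<times> ('v, 'b) path) \<Rightarrow>\<^sub>0 'k::field) \<Rightarrow> 'b \<Rightarrow> (('v, 'b) path \<Rightarrow>\<^sub>0 'k)" where
  "pair_value x a = (\<Sum>(b, p)\<in>Poly_Mapping.keys x.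
     if b = a then Poly_Mapping.single p (Poly_Mapping.lookup x (b, p)) else 0)"

definition ker_delta1 ::
    "('v, 'b) pre_digraph \<Rightarrow> (('b \<times> ('v, 'b) path) \<Rightarrow>\<^sub>0 'k::field) set" where
  "ker_delta1 Q = {x. Poly_Mapping.keys x \<subseteq> parallel_pairs Q \<and>
     (\<exists>D\<in>Der (rsz_algebra Q).
        (\<forall>e\<in>verts Q. D (rsz_class Q (Poly_Mapping.single (vertex_path e) 1))
                        = \<zero>\<^bsub>rsz_algebra Q :: ('k, _) module\<^esub>) \<and>
        (\<forall>a\<in>arcs Q. D (rsz_class Q (Poly_Mapping.single (arrow_path Q a) 1))
                        = rsz_class Q (pair_value x a)))}"

definition ker_delta1_rel ::
    "('v, 'b) pre_digraph \<Rightarrow> ('v, 'b) pre_digraph \<Rightarrow>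
       (('b \<times> ('v, 'b) path) \<Rightarrow>\<^sub>0 'k::field) set" where
  "ker_delta1_rel QA QB =
     {x \<in> ker_delta1 QA. \<forall>(a, p)\<in>Poly_Mapping.keys x. a \<notin> arcs QB}"

text \<open>\<open>delta0 Q e p\<close> is meant for \<open>p\<close> from \<open>e\<close> to \<open>e\<close>, when \<open>a p\<close> and \<open>p a\<close> below are
  composable; they are nonzero in the algebra iff they lie in \<open>nz_paths\<close>.\<close>

definition delta0 ::
    "('v, 'b) pre_digraph \<Rightarrow> 'v \<Rightarrow> ('v, 'b) path \<Rightarrow> (('b \<times> ('v, 'b) path) \<Rightarrow>\<^sub>0 'k::field)" where
  "delta0 Q e p =
     (\<Sum>a\<in>{a \<in> arcs Q. tail Q a = e \<and> path_comp (arrow_path Q a) p \<in> nz_paths Q}.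
        pair a (path_comp (arrow_path Q a) p)) -
     (\<Sum>a\<in>{a \<in> arcs Q. head Q a = e \<and> path_comp p (arrow_path Q a) \<in> nz_paths Q}.
        pair a (path_comp p (arrow_path Q a)))"

definition im_delta0 ::
    "('v, 'b) pre_digraph \<Rightarrow> (('b \<times> ('v, 'b) path) \<Rightarrow>\<^sub>0 'k::field) set" where
  "im_delta0 Q = free.span
     {delta0 Q e p | e p. e \<in> verts Q \<and> p \<in> nz_paths Q \<and> psource p = e \<and> ptarget p = e}"

definition im_delta0_rel ::
    "('v, 'b) pre_digraph \<Rightarrow> ('v, 'b) pre_digraph \<Rightarrow>
       (('b \<times> ('v, 'b) path) \<Rightarrow>\<^sub>0 'k::field) set" where
  "im_delta0_rel QA QB = im_delta0 QA \<inter> ker_delta1_rel QA QB"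

text \<open>\<open>path_replace a p q\<close> is \<open>q\<close> to the power \<open>a//p\<close>; \<open>pair_lin b f\<close> extends \<open>b//q\<close> linearly in \<open>q\<close>,
  and \<open>pair_bracket\<close> is the bilinear extension of
  \<open>[a//p, b//q] = b//path_replace a p q - a//path_replace b q p\<close>.\<close>

definition path_replace ::
    "'b \<Rightarrow> ('v, 'b) path \<Rightarrow> ('v, 'b) path \<Rightarrow> (('v, 'b) path \<Rightarrow>\<^sub>0 'k::field)" where
  "path_replace a p q =
     (\<Sum>i\<in>{i. i < length (parrows q) \<and> parrows q ! i = a}.
        let r = take i (parrows q) @ parrows p @ drop (Suc i) (parrows q)
        in if length r \<le> 1 then Poly_Mapping.single (psource q, r, ptarget q) 1 else 0)"

definition pair_lin ::
    "'b \<Rightarrow> (('v, 'b) path \<Rightarrow>\<^sub>0 'k::field) \<Rightarrow> (('b \<times> ('v, 'b) path) \<Rightarrow>\<^sub>0 'k)" where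
  "pair_lin b f = (\<Sum>q\<in>Poly_Mapping.keys f. pscale (Poly_Mapping.lookup f q) (pair b q))"

definition pair_bracket ::
    "(('b \<times> ('v, 'b) path) \<Rightarrow>\<^sub>0 'k::field) \<Rightarrow> (('b \<times> ('v, 'b) path) \<Rightarrow>\<^sub>0 'k) \<Rightarrow>
       (('b \<times> ('v, 'b) path) \<Rightarrow>\<^sub>0 'k)" where
  "pair_bracket x y =
     (\<Sum>(a, p)\<in>Poly_Mapping.keys x. \<Sum>(b, q)\<in>Poly_Mapping.keys y.
        pscale (Poly_Mapping.lookup x (a, p) * Poly_Mapping.lookup y (b, q))
          (pair_lin b (path_replace a p q) - pair_lin a (path_replace b q p)))"

definition pair_lie ::
    "(('b \<times> ('v, 'b) path) \<Rightarrow>\<^sub>0 'k::field) set \<Rightarrow> ('k, ('b \<times> ('v, 'b) path) \<Rightarrow>\<^sub>0 'k) lie" where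
  "pair_lie V = \<lparr> lcarrier = V, lplus = (+), lzero = 0, lscale = pscale, lbracket = pair_bracket \<rparr>"


section \<open>The pieces of the decomposition\<close>

definition complement_quiver ::
    "('v, 'b) pre_digraph \<Rightarrow> ('v, 'b) pre_digraph \<Rightarrow> ('v, 'b) pre_digraph" where
  "complement_quiver QA QB = QA\<lparr>arcs := arcs QA - arcs QB\<rparr>"

definition parallel_classes :: "('v, 'b) pre_digraph \<Rightarrow> 'b set set" where
  "parallel_classes Q =
     arcs Q // {(a, b). a \<in> arcs Q \<and> b \<in> arcs Q \<and> arc_to_ends Q a = arc_to_ends Q b}"

definition classes_S :: "('v, 'b) pre_digraph \<Rightarrow> ('v, 'b) pre_digraph \<Rightarrow> 'b set set" where
  "classes_S QA QB = {\<alpha> \<in> parallel_classes (complement_quiver QA QB). card \<alpha> > 1}"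

definition classes_D :: "('v, 'b) pre_digraph \<Rightarrow> ('v, 'b) pre_digraph \<Rightarrow> 'b set set" where
  "classes_D QA QB = {\<alpha> \<in> parallel_classes (complement_quiver QA QB).
     \<forall>a\<in>\<alpha>. \<forall>b\<in>arcs QB. arc_to_ends QA a \<noteq> arc_to_ends QA b}"

definition classes_E :: "('v, 'b) pre_digraph \<Rightarrow> ('v, 'b) pre_digraph \<Rightarrow> 'b set set" where
  "classes_E QA QB = parallel_classes (complement_quiver QA QB) - classes_D QA QB"

definition frakI ::
    "('v, 'b) pre_digraph \<Rightarrow> ('v, 'b) pre_digraph \<Rightarrow> 'b set \<Rightarrow>
       (('b \<times> ('v, 'b) path) \<Rightarrow>\<^sub>0 'k::field) set" where
  "frakI QA QB \<alpha> = free.span {pair a (arrow_path QA b) | a b.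
     a \<in> \<alpha> \<and> b \<in> arcs QB \<and> arc_to_ends QA a = arc_to_ends QA b}"

definition I_elt ::
    "('v, 'b) pre_digraph \<Rightarrow> 'b set \<Rightarrow> (('b \<times> ('v, 'b) path) \<Rightarrow>\<^sub>0 'k::field)" where
  "I_elt Q \<alpha> = (\<Sum>a\<in>\<alpha>. pair a (arrow_path Q a))"

definition kI ::
    "('v, 'b) pre_digraph \<Rightarrow> 'b set \<Rightarrow> (('b \<times> ('v, 'b) path) \<Rightarrow>\<^sub>0 'k::field) set" where
  "kI Q \<alpha> = free.span {I_elt Q \<alpha>}"

text \<open>The product of the lines \<open>kI \<alpha>\<close> over \<open>classes_D\<close>, taken inside the space spanned by the
  symbols \<open>a//p\<close>, where it is a direct sum and contains \<open>im_delta0_rel\<close>.\<close>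

definition prod_kI ::
    "('v, 'b) pre_digraph \<Rightarrow> ('v, 'b) pre_digraph \<Rightarrow>
       (('b \<times> ('v, 'b) path) \<Rightarrow>\<^sub>0 'k::field) set" where
  "prod_kI QA QB = {(\<Sum>\<alpha>\<in>classes_D QA QB. z \<alpha>) | z. \<forall>\<alpha>\<in>classes_D QA QB. z \<alpha> \<in> kI QA \<alpha>}"

definition frak_a ::
    "('v, 'b) pre_digraph \<Rightarrow> ('v, 'b) pre_digraph \<Rightarrow>
       ('k::field, (('b \<times> ('v, 'b) path) \<Rightarrow>\<^sub>0 'k) set) lie" where
  "frak_a QA QB = lie_quotient (pair_lie (prod_kI QA QB)) (im_delta0_rel QA QB)"

definition class_enum :: "'b set \<Rightarrow> nat \<Rightarrow> 'b" where
  "class_enum \<alpha> = (SOME f. bij_betw f {..<card \<alpha>} \<alpha>)"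

text \<open>With \<open>\<alpha> = {a\<^sub>0, \<dots>, a\<^sub>n\<^sub>-\<^sub>1}\<close>, the symbol \<open>a\<^sub>i//a\<^sub>j\<close> corresponds to the linear map
  sending \<open>a\<^sub>i\<close> to \<open>a\<^sub>j\<close>, that is to the matrix unit in row \<open>j\<close> and column \<open>i\<close>; this turns
  the commutator of matrices into \<open>pair_bracket\<close>.\<close>

definition mat_elt ::
    "('v, 'b) pre_digraph \<Rightarrow> 'b set \<Rightarrow> 'k::field mat \<Rightarrow> (('b \<times> ('v, 'b) path) \<Rightarrow>\<^sub>0 'k)" where
  "mat_elt Q \<alpha> X = (\<Sum>i<card \<alpha>. \<Sum>j<card \<alpha>.
     pscale (X $$ (j, i)) (pair (class_enum \<alpha> i) (arrow_path Q (class_enum \<alpha> j))))"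

text \<open>The action of the product of the special linear algebras on the radical: the factor at
  \<open>\<alpha>\<close> acts by \<open>pair_bracket\<close> on \<open>frakI QA QB \<alpha>\<close>. It acts by zero on the other factors
  \<open>frakI QA QB \<beta>\<close> and, since \<open>I_elt QA \<alpha>\<close> commutes with all \<open>a//b\<close> for \<open>a, b \<in> \<alpha>\<close>, on all
  lines \<open>kI QA \<beta>\<close> and hence on \<open>frak_a QA QB\<close>. The pairs in the argument have their first
  component in \<open>kI QA \<alpha>\<close> and their second in \<open>frakI QA QB \<alpha>\<close>.\<close>

definition sl_act ::
    "('v, 'b) pre_digraph \<Rightarrow> ('v, 'b) pre_digraph \<Rightarrow> ('b set \<Rightarrow> 'k::field mat) \<Rightarrow>
     ('b set \<Rightarrow> (('b \<times> ('v, 'b) path) \<Rightarrow>\<^sub>0 'k) \<times> (('b \<times> ('v, 'b) path) \<Rightarrow>\<^sub>0 'k)) \<times>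
       (('b \<times> ('v, 'b) path) \<Rightarrow>\<^sub>0 'k) set \<Rightarrow>
     ('b set \<Rightarrow> (('b \<times> ('v, 'b) path) \<Rightarrow>\<^sub>0 'k) \<times> (('b \<times> ('v, 'b) path) \<Rightarrow>\<^sub>0 'k)) \<times>
       (('b \<times> ('v, 'b) path) \<Rightarrow>\<^sub>0 'k) set" where
  "sl_act QA QB X = (\<lambda>(f, z).
     ((\<lambda>\<alpha>\<in>classes_E QA QB.
         (0, if \<alpha> \<in> classes_S QA QB
             then pair_bracket (mat_elt QA \<alpha> (X \<alpha>)) (snd (f \<alpha>)) else 0)),
      lzero (frak_a QA QB)))"

end

theory Submission
  imports Defs
begin

text \<open>
  An element of \<open>A\<close> is determined by its coefficients at the vertices and at the arrows. In these
  coordinates a derivation that is a \<open>B\<close>-bimodule map is a matrix with entries \<open>m a b\<close>, where \<open>a\<close> is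
  an arrow of \<open>Q\<^sub>C\<close> and \<open>b\<close> is an arrow of \<open>Q\<^sub>A\<close> parallel to \<open>a\<close>, and every such matrix occurs:
  in characteristic different from two no loop can be sent to a vertex. The inner derivations are the
  diagonal matrices \<open>l (head a) - l (tail a)\<close> for functions \<open>l\<close> on the vertices; in \<open>Q\<^sub>C\<close> they are
  constant on every parallel class, and they vanish on a class that has a parallel arrow in \<open>Q\<^sub>B\<close>.
  For every class \<open>\<alpha>\<close> the block \<open>b \<in> \<alpha>\<close> of the matrix splits into a traceless part and a multiple
  of the identity, and the block \<open>b \<in> Q\<^sub>B\<close> is an element of \<open>frakI QA QB \<alpha>\<close>. The Lie algebra of these
  matrices thus maps onto both sides of the isomorphism, with the same kernel.
\<close>

section \<open>Lie algebras\<close>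

text \<open>Neither side is easily recognised as a Lie algebra by hand: one is a quotient whose
  elements are sets of functions, the other a nest of semidirect products with an action defined by
  cases. The Lie axioms are therefore checked by computation only for coefficient matrices, and
  surjections that respect the operations carry them to every other algebra. Comparing the fibres of
  two such surjections replaces an explicit map on cohomology classes.

  The scalar part of a block is stored in two different places. On a class in
  \<open>classes_E\<close> it acts on the block towards \<open>QB\<close> by a nonzero multiple, so
  it has to stay next to \<open>frakI\<close>. On a class in \<open>classes_D\<close> there is no
  such block, the scalar is central, and it goes into the abelian factor. Inner matrices are central
  and leave a trace only in that factor, which is why it alone is divided by the image of delta0.
  Splitting off the scalar divides by the size of a class, which characteristic zero
  permits.\<close>

lemma lie_homI:
  assumes "\<And>x. x \<in> lcarrier L \<Longrightarrow> \<phi> x \<in> lcarrier M"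
    and "\<And>x y. \<lbrakk>x \<in> lcarrier L; y \<in> lcarrier L\<rbrakk> \<Longrightarrow> \<phi> (lplus L x y) = lplus M (\<phi> x) (\<phi> y)"
    and "\<And>c x. x \<in> lcarrier L \<Longrightarrow> \<phi> (lscale L c x) = lscale M c (\<phi> x)"
    and "\<And>x y. \<lbrakk>x \<in> lcarrier L; y \<in> lcarrier L\<rbrakk> \<Longrightarrow> \<phi> (lbracket L x y) = lbracket M (\<phi> x) (\<phi> y)"
  shows "\<phi> \<in> lie_hom L M"
  using assms by (simp add: lie_hom_def)

lemma lie_homD:
  assumes "\<phi> \<in> lie_hom L M"
  shows "x \<in> lcarrier L \<Longrightarrow> \<phi> x \<in> lcarrier M"
    and "\<lbrakk>x \<in> lcarrier L; y \<in> lcarrier L\<rbrakk> \<Longrightarrow> \<phi> (lplus L x y) = lplus M (\<phi> x) (\<phi> y)"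
    and "x \<in> lcarrier L \<Longrightarrow> \<phi> (lscale L c x) = lscale M c (\<phi> x)"
    and "\<lbrakk>x \<in> lcarrier L; y \<in> lcarrier L\<rbrakk> \<Longrightarrow> \<phi> (lbracket L x y) = lbracket M (\<phi> x) (\<phi> y)"
  using assms by (auto simp: lie_hom_def)

lemma lie_hom_comp:
  assumes "\<phi> \<in> lie_hom L M" "\<psi> \<in> lie_hom M N"
  shows "\<psi> \<circ> \<phi> \<in> lie_hom L N"
  using assms by (auto simp: lie_hom_def Pi_def)

text \<open>Preservation of zero is demanded separately: nothing is known yet about the operations
  of \<open>M\<close>, so it cannot be derived from additivity.\<close>

definition lie_epi :: "('k, 'x) lie \<Rightarrow> ('k, 'y) lie \<Rightarrow> ('x \<Rightarrow> 'y) \<Rightarrow> bool" where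
  "lie_epi L M \<phi> \<longleftrightarrow>
     \<phi> \<in> lie_hom L M \<and> \<phi> ` lcarrier L = lcarrier M \<and> \<phi> (lzero L) = lzero M"

lemma lie_epi_comp: "\<lbrakk>lie_epi L M \<phi>; lie_epi M N \<psi>\<rbrakk> \<Longrightarrow> lie_epi L N (\<psi> \<circ> \<phi>)"
  unfolding lie_epi_def by (metis comp_apply image_comp lie_hom_comp)

text \<open>Every axiom is a closure property or an identity. Elements of \<open>M\<close> are
  images of elements of \<open>L\<close>, and the axiom for them is the image of the same axiom in
  \<open>L\<close>.\<close>

lemma lie_algebra_epi:
  assumes "lie_algebra L" and epi: "lie_epi L M \<phi>"
  shows "lie_algebra M"
proof -
  interpret lie_algebra L by fact
  have hom: "\<phi> \<in> lie_hom L M" and im: "lcarrier M = \<phi> ` lcarrier L"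
    and z: "lzero M = \<phi> (lzero L)"
    using epi by (auto simp: lie_epi_def)
  note pull = lie_homD(2-)[OF hom, symmetric]
  note clo = zero_closed plus_closed scale_closed bracket_closed
  show ?thesis
  proof (rule lie_algebra.intro, unfold im z, goal_cases)
    case 6 thus ?case by (elim imageE) (simp add: pull, metis plus_commute)
  qed (((elim imageE)?, simp only: pull clo imageI plus_assoc plus_zero plus_inverse scale_plus
      plus_scale scale_scale scale_one bracket_plus_left bracket_plus_right bracket_scale_left
      bracket_scale_right bracket_alternating jacobi)+)
qed

text \<open>\<open>M\<close> and \<open>N\<close> are quotients of \<open>L\<close> by the same
  equivalence relation. The hypothesis compares fibres instead of kernels, so no subtraction in
  \<open>M\<close> or \<open>N\<close> is involved.\<close>

lemma lie_isomorphic_if_same_kernel: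
  assumes "lie_algebra L" and \<phi>: "lie_epi L M \<phi>" and \<psi>: "lie_epi L N \<psi>"
    and ker: "\<And>x y. \<lbrakk>x \<in> lcarrier L; y \<in> lcarrier L\<rbrakk> \<Longrightarrow> \<phi> x = \<phi> y \<longleftrightarrow> \<psi> x = \<psi> y"
  shows "M \<cong>\<^sub>L N"
proof -
  interpret lie_algebra L by fact
  \<comment> \<open>An arbitrary section of \<phi>; by \<open>ker\<close>, the choice of the
    preimage is invisible after applying \<psi>.\<close>
  define s where "s = inv_into (lcarrier L) \<phi>"
  define \<theta> where "\<theta> = \<psi> \<circ> s"
  have h1: "\<phi> \<in> lie_hom L M" "\<psi> \<in> lie_hom L N"
    and im: "\<phi> ` lcarrier L = lcarrier M" "\<psi> ` lcarrier L = lcarrier N"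
    using \<phi> \<psi> by (auto simp: lie_epi_def)
  have \<theta>: "\<theta> (\<phi> x) = \<psi> x" if "x \<in> lcarrier L" for x
  proof -
    have "\<phi> (s (\<phi> x)) = \<phi> x" "s (\<phi> x) \<in> lcarrier L"
      unfolding s_def using that by (auto intro: f_inv_into_f inv_into_into)
    thus ?thesis using ker that by (simp add: \<theta>_def)
  qed
  note clo = zero_closed plus_closed scale_closed bracket_closed
  have "\<theta> \<in> lie_hom M N"
    by (rule lie_homI; unfold im[symmetric]; (elim imageE)?; hypsubst?)
      (simp_all add: \<theta> clo lie_homD(2-)[OF h1(1), symmetric] lie_homD(2-)[OF h1(2), symmetric])
  moreover have "bij_betw \<theta> (lcarrier M) (lcarrier N)"
    unfolding bij_betw_def
  proof
    show "inj_on \<theta> (lcarrier M)"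
      unfolding im[symmetric] by (rule inj_onI) (auto simp: \<theta> ker)
    show "\<theta> ` lcarrier M = lcarrier N"
      unfolding im[symmetric] image_image by (rule image_cong) (auto simp: \<theta>)
  qed
  ultimately show ?thesis
    unfolding lie_isomorphic_def
    by (intro conjI bexI[of _ \<theta>] lie_algebra_epi[OF assms(1) \<phi>] lie_algebra_epi[OF assms(1) \<psi>])
qed

section \<open>Vector arithmetic and quotients by ideals\<close>

context lie_algebra
begin

lemma zero_plus: "x \<in> lcarrier L \<Longrightarrow> lplus L (lzero L) x = x"
  by (simp add: plus_commute plus_zero zero_closed)

lemma plus_left_commute:
  "\<lbrakk>x \<in> lcarrier L; y \<in> lcarrier L; z \<in> lcarrier L\<rbrakk>
    \<Longrightarrow> lplus L x (lplus L y z) = lplus L y (lplus L x z)"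
  by (metis plus_assoc plus_commute)

lemma minus_cancel:
  assumes "x \<in> lcarrier L" "y \<in> lcarrier L"
  shows "lplus L x (lplus L (lscale L (-1) x) y) = y"
  using assms by (simp add: plus_assoc[symmetric] scale_closed plus_inverse zero_plus)

text \<open>Polarisation: the locale assumes only that the bracket is alternating, and expanding
  [x + y, x + y] = 0 leaves [x, y] + [y, x] = 0.\<close>

lemma bracket_anticommute:
  assumes "x \<in> lcarrier L" "y \<in> lcarrier L"
  shows "lbracket L x y = lscale L (-1) (lbracket L y x)"
proof -
  note clo = assms plus_closed bracket_closed scale_closed
  have "lbracket L (lplus L x y) (lplus L x y)
      = lplus L (lplus L (lbracket L x x) (lbracket L x y))
          (lplus L (lbracket L y x) (lbracket L y y))"
    using assms by (simp only: bracket_plus_left bracket_plus_right clo)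
      (simp add: plus_assoc plus_left_commute clo)
  then have "lplus L (lbracket L x y) (lbracket L y x) = lzero L"
    using assms by (simp add: clo bracket_alternating plus_zero zero_plus)
  moreover have "lbracket L x y = lplus L (lplus L (lbracket L x y) (lbracket L y x))
      (lscale L (-1) (lbracket L y x))"
    using assms by (simp add: plus_assoc clo plus_inverse plus_zero)
  ultimately show ?thesis
    using assms by (simp add: zero_plus clo)
qed

end

text \<open>The operations of \<open>lie_quotient\<close> are unions over all representatives;
  independence of the representative turns such a union into a single coset.\<close>

lemma UN_const: "\<lbrakk>x0 \<in> X; \<And>x. x \<in> X \<Longrightarrow> f x = C\<rbrakk> \<Longrightarrow> (\<Union>x\<in>X. f x) = C"
  by auto

locale lie_alg_ideal = lie_algebra L for L :: "('k::field, 'x) lie" +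
  fixes N
  assumes ideal: "lie_ideal N L"
begin

lemma subset: "x \<in> N \<Longrightarrow> x \<in> lcarrier L"
  and N_zero: "lzero L \<in> N"
  and N_plus: "\<lbrakk>x \<in> N; y \<in> N\<rbrakk> \<Longrightarrow> lplus L x y \<in> N"
  and N_scale: "x \<in> N \<Longrightarrow> lscale L c x \<in> N"
  and N_bracket: "\<lbrakk>x \<in> lcarrier L; y \<in> N\<rbrakk> \<Longrightarrow> lbracket L x y \<in> N"
  using ideal by (auto simp: lie_ideal_def lie_subspace_def)

text \<open>\<open>lie_ideal\<close> is one-sided by definition; anticommutativity supplies the
  other side.\<close>

lemma N_bracket': "\<lbrakk>x \<in> N; y \<in> lcarrier L\<rbrakk> \<Longrightarrow> lbracket L x y \<in> N"
  by (metis N_bracket N_scale bracket_anticommute subset)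

lemma coset_plus:
  assumes "x \<in> lcarrier L" "n \<in> N"
  shows "lie_coset L N (lplus L x n) = lie_coset L N x"
proof -
  have 1: "lplus L (lplus L x n) m = lplus L x (lplus L n m)" if "m \<in> N" for m
    using that assms subset by (simp add: plus_assoc)
  have 2: "lplus L x m = lplus L (lplus L x n) (lplus L (lscale L (-1) n) m)" if "m \<in> N" for m
    using that assms subset by (simp add: plus_assoc plus_closed scale_closed minus_cancel)
  show ?thesis
    unfolding lie_coset_def
  proof (intro equalityI image_subsetI)
    fix m assume m: "m \<in> N"
    show "lplus L (lplus L x n) m \<in> lplus L x ` N"
      unfolding 1[OF m] using m assms(2) by (intro imageI N_plus)
    show "lplus L x m \<in> lplus L (lplus L x n) ` N"
      unfolding 2[OF m] using m assms(2) by (intro imageI N_plus N_scale)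
  qed
qed

lemma coset_self: "x \<in> lcarrier L \<Longrightarrow> x \<in> lie_coset L N x"
  unfolding lie_coset_def using N_zero plus_zero by (metis image_eqI)

lemma coset_eq_iff:
  assumes "x \<in> lcarrier L" "y \<in> lcarrier L"
  shows "lie_coset L N x = lie_coset L N y \<longleftrightarrow> lplus L x (lscale L (-1) y) \<in> N"
proof
  assume "lie_coset L N x = lie_coset L N y"
  then have "x \<in> lie_coset L N y" using coset_self assms by blast
  then obtain n where n: "n \<in> N" "x = lplus L y n" by (auto simp: lie_coset_def)
  have "lplus L x (lscale L (-1) y) = n"
    using n assms subset
    by (metis minus_cancel plus_commute plus_closed scale_closed plus_left_commute)
  thus "lplus L x (lscale L (-1) y) \<in> N" using n by simp
next
  assume *: "lplus L x (lscale L (-1) y) \<in> N"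
  have "x = lplus L y (lplus L x (lscale L (-1) y))"
    using assms by (simp add: plus_left_commute[of y] plus_inverse scale_closed plus_zero)
  thus "lie_coset L N x = lie_coset L N y"
    using coset_plus[OF assms(2) *] by simp
qed

text \<open>What has to be shown is that the operations do not depend on representatives: changing
  \<open>x\<close> and \<open>y\<close> by elements of \<open>N\<close> changes the result by an
  element of \<open>N\<close>.\<close>

lemma coset_epi: "lie_epi L (lie_quotient L N) (lie_coset L N)"
proof -
  have elem: "z \<in> lie_coset L N x \<longleftrightarrow> (\<exists>n\<in>N. z = lplus L x n)" for x z
    by (auto simp: lie_coset_def)
  have 1: "(\<Union>u\<in>lie_coset L N x. \<Union>v\<in>lie_coset L N y. lie_coset L N (lplus L u v))
            = lie_coset L N (lplus L x y)"
    if "x \<in> lcarrier L" "y \<in> lcarrier L" for x y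
  proof (rule UN_const[OF coset_self[OF that(1)]], rule UN_const[OF coset_self[OF that(2)]])
    fix u v assume "u \<in> lie_coset L N x" "v \<in> lie_coset L N y"
    then obtain n m where *: "n \<in> N" "m \<in> N" "u = lplus L x n" "v = lplus L y m"
      unfolding elem by blast
    then have "lplus L u v = lplus L (lplus L x y) (lplus L n m)"
      using that subset by (simp add: plus_assoc plus_closed plus_left_commute)
    thus "lie_coset L N (lplus L u v) = lie_coset L N (lplus L x y)"
      using * that by (simp add: coset_plus N_plus plus_closed)
  qed
  have 2: "(\<Union>u\<in>lie_coset L N x. lie_coset L N (lscale L c u)) = lie_coset L N (lscale L c x)"
    if "x \<in> lcarrier L" for x c
  proof (rule UN_const[OF coset_self[OF that]])
    fix u assume "u \<in> lie_coset L N x"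
    then obtain n where *: "n \<in> N" "u = lplus L x n" unfolding elem by blast
    thus "lie_coset L N (lscale L c u) = lie_coset L N (lscale L c x)"
      using that subset by (simp add: scale_plus coset_plus N_scale scale_closed)
  qed
  have 3: "(\<Union>u\<in>lie_coset L N x. \<Union>v\<in>lie_coset L N y. lie_coset L N (lbracket L u v))
            = lie_coset L N (lbracket L x y)"
    if "x \<in> lcarrier L" "y \<in> lcarrier L" for x y
  proof (rule UN_const[OF coset_self[OF that(1)]], rule UN_const[OF coset_self[OF that(2)]])
    fix u v assume "u \<in> lie_coset L N x" "v \<in> lie_coset L N y"
    then obtain n m where *: "n \<in> N" "m \<in> N" "u = lplus L x n" "v = lplus L y m"
      unfolding elem by blast
    \<comment> \<open>All three correction terms lie in the ideal; the term with \<open>n\<close> on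
      the left is why the two-sided form is needed.\<close>
    then have "lbracket L u v = lplus L (lbracket L x y)
        (lplus L (lbracket L x m) (lplus L (lbracket L n y) (lbracket L n m)))"
      using that subset
      by (simp add: bracket_plus_left bracket_plus_right plus_assoc plus_closed bracket_closed
          plus_left_commute)
    thus "lie_coset L N (lbracket L u v) = lie_coset L N (lbracket L x y)"
      using * that subset by (simp add: coset_plus N_plus N_bracket N_bracket' bracket_closed)
  qed
  show ?thesis
    unfolding lie_epi_def
    by (intro conjI lie_homI) (auto simp: lie_quotient_def 1 2 3)
qed

end

section \<open>Subalgebras, images of subalgebras and of ideals\<close>

lemma lie_algebra_subalgebra:
  assumes "lie_algebra L" "lie_subalgebra N L"
  shows "lie_algebra (L\<lparr>lcarrier := N\<rparr>)"
proof -
  interpret lie_algebra L by fact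
  have "N \<subseteq> lcarrier L" "lzero L \<in> N" "\<And>x y. \<lbrakk>x \<in> N; y \<in> N\<rbrakk> \<Longrightarrow> lplus L x y \<in> N"
    "\<And>c x. x \<in> N \<Longrightarrow> lscale L c x \<in> N" "\<And>x y. \<lbrakk>x \<in> N; y \<in> N\<rbrakk> \<Longrightarrow> lbracket L x y \<in> N"
    using assms(2) by (auto simp: lie_subalgebra_def lie_subspace_def)
  thus ?thesis
    by (intro lie_algebra.intro; simp add: subset_iff)
      (simp_all add: plus_assoc plus_commute plus_left_commute plus_zero plus_inverse
        scale_plus plus_scale scale_scale scale_one bracket_plus_left bracket_plus_right
        bracket_scale_left bracket_scale_right bracket_alternating jacobi)
qed

text \<open>The second claim restricts an epimorphism to a subalgebra, so that the comparison of
  fibres also applies to subalgebras of the target.\<close>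

lemma lie_subalgebra_image:
  assumes "lie_algebra L" "lie_epi L M \<phi>" "lie_subalgebra N L"
  shows "lie_subalgebra (\<phi> ` N) M" and "lie_epi (L\<lparr>lcarrier := N\<rparr>) (M\<lparr>lcarrier := \<phi> ` N\<rparr>) \<phi>"
proof -
  have N: "N \<subseteq> lcarrier L" "lzero L \<in> N" "\<And>x y. \<lbrakk>x \<in> N; y \<in> N\<rbrakk> \<Longrightarrow> lplus L x y \<in> N"
    "\<And>c x. x \<in> N \<Longrightarrow> lscale L c x \<in> N" "\<And>x y. \<lbrakk>x \<in> N; y \<in> N\<rbrakk> \<Longrightarrow> lbracket L x y \<in> N"
    using assms(3) by (auto simp: lie_subalgebra_def lie_subspace_def)
  have hom: "\<phi> \<in> lie_hom L M" and im: "lcarrier M = \<phi> ` lcarrier L"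
    and z: "lzero M = \<phi> (lzero L)"
    using assms(2) by (auto simp: lie_epi_def)
  have *: "\<phi> (lplus L x y) = lplus M (\<phi> x) (\<phi> y)" "\<phi> (lscale L c x) = lscale M c (\<phi> x)"
    "\<phi> (lbracket L x y) = lbracket M (\<phi> x) (\<phi> y)" if "x \<in> N" "y \<in> N" for x y c
    using lie_homD(2-)[OF hom] that N(1) by (simp_all add: subsetD)
  show "lie_subalgebra (\<phi> ` N) M"
    unfolding lie_subalgebra_def lie_subspace_def im z
    using N by (auto simp: *[symmetric])
  show "lie_epi (L\<lparr>lcarrier := N\<rparr>) (M\<lparr>lcarrier := \<phi> ` N\<rparr>) \<phi>"
    unfolding lie_epi_def by (auto intro!: lie_homI simp: * z)
qed

text \<open>Surjectivity is essential: the bracket with an arbitrary element of \<open>M\<close>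
  must be the image of a bracket in \<open>L\<close>.\<close>

lemma lie_ideal_image:
  assumes "lie_epi L M \<phi>" "lie_ideal N L"
  shows "lie_ideal (\<phi> ` N) M"
proof -
  have N: "N \<subseteq> lcarrier L" "lzero L \<in> N" "\<And>x y. \<lbrakk>x \<in> N; y \<in> N\<rbrakk> \<Longrightarrow> lplus L x y \<in> N"
    "\<And>c x. x \<in> N \<Longrightarrow> lscale L c x \<in> N"
    "\<And>x y. \<lbrakk>x \<in> lcarrier L; y \<in> N\<rbrakk> \<Longrightarrow> lbracket L x y \<in> N"
    using assms(2) by (auto simp: lie_ideal_def lie_subspace_def)
  have hom: "\<phi> \<in> lie_hom L M" and im: "lcarrier M = \<phi> ` lcarrier L"
    and z: "lzero M = \<phi> (lzero L)"
    using assms(1) by (auto simp: lie_epi_def)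
  have *: "lplus M (\<phi> x) (\<phi> y) = \<phi> (lplus L x y)" "lscale M c (\<phi> x) = \<phi> (lscale L c x)"
    if "x \<in> N" "y \<in> N" for x y c
    using lie_homD(2-)[OF hom] that N(1) by (simp_all add: subsetD)
  have **: "lbracket M (\<phi> x) (\<phi> y) = \<phi> (lbracket L x y)" if "x \<in> lcarrier L" "y \<in> N" for x y
    using lie_homD(4)[OF hom] that N(1) by (simp add: subsetD)
  show ?thesis
    unfolding lie_ideal_def lie_subspace_def im z using N by (auto simp: * **)
qed

lemma lie_PiE_simps:
  "lcarrier (lie_PiE J L) = (\<Pi>\<^sub>E i\<in>J. lcarrier (L i))"
  "lplus (lie_PiE J L) f g = (\<lambda>i\<in>J. lplus (L i) (f i) (g i))"
  "lzero (lie_PiE J L) = (\<lambda>i\<in>J. lzero (L i))"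
  "lscale (lie_PiE J L) c f = (\<lambda>i\<in>J. lscale (L i) c (f i))"
  "lbracket (lie_PiE J L) f g = (\<lambda>i\<in>J. lbracket (L i) (f i) (g i))"
  by (simp_all add: lie_PiE_def)

lemma lie_prod_simps:
  "lcarrier (lie_prod L M) = lcarrier L \<times> lcarrier M"
  "lplus (lie_prod L M) (x, y) (x', y') = (lplus L x x', lplus M y y')"
  "lzero (lie_prod L M) = (lzero L, lzero M)"
  "lscale (lie_prod L M) c (x, y) = (lscale L c x, lscale M c y)"
  "lbracket (lie_prod L M) (x, y) (x', y') = (lbracket L x x', lbracket M y y')"
  by (simp_all add: lie_prod_def)

lemma lie_semidirect_simps:
  "lcarrier (lie_semidirect L M act) = lcarrier L \<times> lcarrier M"
  "lplus (lie_semidirect L M act) (x, y) (x', y') = (lplus L x x', lplus M y y')"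
  "lzero (lie_semidirect L M act) = (lzero L, lzero M)"
  "lscale (lie_semidirect L M act) c (x, y) = (lscale L c x, lscale M c y)"
  "lbracket (lie_semidirect L M act) (x, y) (x', y') =
     (lbracket L x x', lplus M (lbracket M y y') (lplus M (act x y') (lscale M (-1) (act x' y))))"
  by (simp_all add: lie_semidirect_def)

section \<open>Coordinates on the radical square zero algebra\<close>

lemma poly_mapping_sum_single: "(\<Sum>x\<in>Poly_Mapping.keys f. Poly_Mapping.single x (Poly_Mapping.lookup f x)) = f"
  by (rule poly_mapping_eqI) (simp add: lookup_sum lookup_single when_def in_keys_iff)

text \<open>Reduces an additive identity to basis vectors; applied once per argument, it does so for
  multilinear identities.\<close>

lemma poly_mapping_add_induct [case_names single add]:
  fixes f :: "'x \<Rightarrow>\<^sub>0 'a::comm_monoid_add"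
  assumes "\<And>x c. P (Poly_Mapping.single x c)" and "\<And>f g. P f \<Longrightarrow> P g \<Longrightarrow> P (f + g)"
  shows "P f"
proof -
  have "P (\<Sum>x\<in>X. Poly_Mapping.single x (c x))" for X and c
    by (induction X rule: infinite_finite_induct) (use assms(1)[of _ 0] assms in auto)
  from this[of _ "Poly_Mapping.keys f"] show ?thesis
    by (metis poly_mapping_sum_single)
qed

text \<open>The product inspects only the end points stored in the paths, so it is the same function
  for every quiver; \<open>undefined\<close> stands for an arbitrary one.\<close>

definition pmult where "pmult = mult (path_algebra undefined)"

lemma path_algebra_simps:
  "carrier (path_algebra Q) = {f. Poly_Mapping.keys f \<subseteq> paths Q}"
  "mult (path_algebra Q) = pmult"
  "one (path_algebra Q) = (\<Sum>e\<in>verts Q. Poly_Mapping.single (vertex_path e) 1)"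
  "zero (path_algebra Q) = 0"
  "add (path_algebra Q) = (+)"
  "smult (path_algebra Q) = pscale"
  by (simp_all add: path_algebra_def pmult_def)

text \<open>The sums in the definition run over the supports, which change under addition. Larger
  index sets give products of different elements a common range of summation.\<close>

lemma pmult_eq_sum:
  assumes "finite F" "Poly_Mapping.keys f \<subseteq> F" "finite H" "Poly_Mapping.keys g \<subseteq> H"
  shows "pmult f g = (\<Sum>x\<in>F. \<Sum>y\<in>H.
                if psource x = ptarget y
                then Poly_Mapping.single (path_comp x y)
                       (Poly_Mapping.lookup f x * Poly_Mapping.lookup g y)
                else 0)"
proof -
  have "pmult f g = (\<Sum>x\<in>Poly_Mapping.keys f. \<Sum>y\<in>H.
                if psource x = ptarget y
                then Poly_Mapping.single (path_comp x y)
                       (Poly_Mapping.lookup f x * Poly_Mapping.lookup g y)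
                else 0)"
    unfolding pmult_def path_algebra_def monoid.simps
    by (intro sum.cong sum.mono_neutral_left) (use assms in \<open>auto simp: in_keys_iff\<close>)
  also have "\<dots> = (\<Sum>x\<in>F. \<Sum>y\<in>H.
                if psource x = ptarget y
                then Poly_Mapping.single (path_comp x y)
                       (Poly_Mapping.lookup f x * Poly_Mapping.lookup g y)
                else 0)"
    by (intro sum.mono_neutral_left)
      (use assms in \<open>auto simp: in_keys_iff intro!: sum.neutral\<close>)
  finally show ?thesis .
qed

lemma pmult_add_left: "pmult (f + f') g = pmult f g + pmult f' g"
proof -
  let ?F = "Poly_Mapping.keys f \<union> Poly_Mapping.keys f'" and ?H = "Poly_Mapping.keys g"
  have "Poly_Mapping.keys (f + f') \<subseteq> ?F" by (rule keys_add)
  then show ?thesis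
    by (simp add: pmult_eq_sum[of ?F _ ?H] sum.distrib[symmetric] lookup_add distrib_right
        single_add if_distrib[of "\<lambda>x. x + _"] cong: if_cong)
qed

lemma pmult_add_right: "pmult g (f + f') = pmult g f + pmult g f'"
proof -
  let ?F = "Poly_Mapping.keys f \<union> Poly_Mapping.keys f'" and ?H = "Poly_Mapping.keys g"
  have "Poly_Mapping.keys (f + f') \<subseteq> ?F" by (rule keys_add)
  then show ?thesis
    by (simp add: pmult_eq_sum[of ?H _ ?F] sum.distrib[symmetric] lookup_add distrib_left
        single_add if_distrib[of "\<lambda>x. x + _"] cong: if_cong)
qed

lemma pmult_single:
  "pmult (Poly_Mapping.single x c) (Poly_Mapping.single y d) =
     (if psource x = ptarget y then Poly_Mapping.single (path_comp x y) (c * d) else 0)"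
  by (subst pmult_eq_sum[of "{x}" _ "{y}"]) auto

lemma pmult_0 [simp]: "pmult 0 f = 0" "pmult f 0 = 0"
  using pmult_add_left[of 0 0 f] pmult_add_right[of f 0 0] by simp_all

lemma pmult_sum_left: "pmult (\<Sum>i\<in>I. f i) g = (\<Sum>i\<in>I. pmult (f i) g)"
  by (induction I rule: infinite_finite_induct) (simp_all add: pmult_add_left)

lemma pmult_sum_right: "pmult g (\<Sum>i\<in>I. f i) = (\<Sum>i\<in>I. pmult g (f i))"
  by (induction I rule: infinite_finite_induct) (simp_all add: pmult_add_right)

lemma path_comp_simps [simp]:
  "psource (path_comp x y) = psource y" "ptarget (path_comp x y) = ptarget x"
  "parrows (path_comp x y) = parrows y @ parrows x"
  by (simp_all add: path_comp_def psource_def ptarget_def parrows_def)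

lemma path_comp_assoc: "path_comp (path_comp x y) z = path_comp x (path_comp y z)"
  by (simp add: path_comp_def psource_def ptarget_def parrows_def)

lemma pmult_assoc: "pmult (pmult f g) h = pmult f (pmult g h)"
proof (induction f rule: poly_mapping_add_induct)
  case (single x c)
  show ?case
  proof (induction g rule: poly_mapping_add_induct)
    case (single y d)
    show ?case
    proof (induction h rule: poly_mapping_add_induct)
      case (single z e)
      show ?case by (simp add: pmult_single path_comp_assoc mult.assoc)
    qed (simp add: pmult_add_right)
  qed (simp add: pmult_add_left pmult_add_right)
qed (simp add: pmult_add_left)

lemma lookup_pmult:
  assumes "finite F" "Poly_Mapping.keys f \<subseteq> F" "finite H" "Poly_Mapping.keys g \<subseteq> H"
  shows "Poly_Mapping.lookup (pmult f g) z = (\<Sum>(x, y)\<in>F \<times> H.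
           if psource x = ptarget y \<and> path_comp x y = z
           then Poly_Mapping.lookup f x * Poly_Mapping.lookup g y else 0)"
  unfolding pmult_eq_sum[OF assms] lookup_sum sum.cartesian_product
  by (intro sum.cong refl) (auto simp: lookup_single when_def)

lemma path_simps [simp]:
  "psource (vertex_path e) = e" "ptarget (vertex_path e) = e" "parrows (vertex_path e) = []"
  "psource (arrow_path Q a) = tail Q a" "ptarget (arrow_path Q a) = head Q a"
  "parrows (arrow_path Q a) = [a]"
  by (simp_all add: vertex_path_def arrow_path_def psource_def ptarget_def parrows_def)

lemma path_eq_iff: "x = y \<longleftrightarrow> psource x = psource y \<and> parrows x = parrows y \<and> ptarget x = ptarget y"
  by (cases x; cases y) (auto simp: psource_def ptarget_def parrows_def)

lemma arrow_path_inject [simp]: "arrow_path Q a = arrow_path Q b \<longleftrightarrow> a = b"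
  by (auto simp: path_eq_iff)

lemma vertex_path_inject [simp]: "vertex_path a = vertex_path b \<longleftrightarrow> a = b"
  by (auto simp: path_eq_iff)

lemma vertex_neq_arrow_path [simp]: "vertex_path e \<noteq> arrow_path Q a" "arrow_path Q a \<noteq> vertex_path e"
  by (auto simp: path_eq_iff)

lemma single_in_path_algebra:
  "x \<in> paths Q \<Longrightarrow> Poly_Mapping.single x c \<in> carrier (path_algebra Q)"
  by (simp add: path_algebra_simps)

lemma path_algebra_closed:
  assumes "f \<in> carrier (path_algebra Q)"
  shows "g \<in> carrier (path_algebra Q) \<Longrightarrow> f + g \<in> carrier (path_algebra Q)"
    and "pscale c f \<in> carrier (path_algebra Q)"
    and "- f \<in> carrier (path_algebra Q)"
proof -
  have "Poly_Mapping.keys (pscale c f) \<subseteq> Poly_Mapping.keys f"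
    "Poly_Mapping.keys (- f) \<subseteq> Poly_Mapping.keys f"
    by (simp_all add: subset_iff in_keys_iff del: split_paired_All)
  then show "g \<in> carrier (path_algebra Q) \<Longrightarrow> f + g \<in> carrier (path_algebra Q)"
    "pscale c f \<in> carrier (path_algebra Q)" "- f \<in> carrier (path_algebra Q)"
    using assms keys_add[of f g] unfolding path_algebra_simps mem_Collect_eq by blast+
qed

lemma path_algebra_sum_closed:
  "(\<And>i. i \<in> I \<Longrightarrow> f i \<in> carrier (path_algebra Q)) \<Longrightarrow> (\<Sum>i\<in>I. f i) \<in> carrier (path_algebra Q)"
  by (induction I rule: infinite_finite_induct)
    (auto intro!: path_algebra_closed(1), simp_all add: path_algebra_simps)

section \<open>Coefficients at short paths and the ideal of long paths\<close>

context fin_digraph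
begin

lemma paths_iff: "x \<in> paths G \<longleftrightarrow> awalk (psource x) (parrows x) (ptarget x)"
  by (cases x) (simp add: paths_def psource_def ptarget_def parrows_def)

lemma vertex_path_in_paths [simp]: "vertex_path e \<in> paths G \<longleftrightarrow> e \<in> verts G"
  by (simp add: paths_iff awalk_Nil_iff)

lemma arrow_path_in_paths [simp]: "arrow_path G a \<in> paths G \<longleftrightarrow> a \<in> arcs G"
  by (auto simp: paths_iff awalk_def)

lemma paths_ends: assumes "x \<in> paths G" shows "psource x \<in> verts G" "ptarget x \<in> verts G"
  using assms by (auto simp: paths_iff)

lemma path_comp_in_paths:
  "\<lbrakk>x \<in> paths G; y \<in> paths G; psource x = ptarget y\<rbrakk> \<Longrightarrow> path_comp x y \<in> paths G"
  by (auto simp: paths_iff)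

lemma short_path_cases:
  assumes "x \<in> paths G"
  obtains (vertex) e where "e \<in> verts G" "x = vertex_path e"
    | (arrow) a where "a \<in> arcs G" "x = arrow_path G a"
    | (long) "length (parrows x) \<ge> 2"
proof (cases "parrows x")
  case Nil
  then show ?thesis
    using assms by (intro vertex[of "psource x"]) (auto simp: paths_iff awalk_def path_eq_iff)
next
  case (Cons a p)
  show ?thesis
  proof (cases p)
    case Nil
    with Cons show ?thesis
      using assms by (intro arrow[of a]) (auto simp: paths_iff awalk_def path_eq_iff)
  qed (use Cons long in auto)
qed

lemma pmult_closed:
  assumes "f \<in> carrier (path_algebra G)" "g \<in> carrier (path_algebra G)"
  shows "pmult f g \<in> carrier (path_algebra G)"
proof -
  have "pmult f g = (\<Sum>x\<in>Poly_Mapping.keys f. \<Sum>y\<in>Poly_Mapping.keys g.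
                if psource x = ptarget y
                then Poly_Mapping.single (path_comp x y)
                       (Poly_Mapping.lookup f x * Poly_Mapping.lookup g y)
                else 0)"
    by (rule pmult_eq_sum) auto
  also have "\<dots> \<in> carrier (path_algebra G)"
    using assms
    by (intro path_algebra_sum_closed)
      (auto simp: path_algebra_simps subset_iff path_comp_in_paths)
  finally show ?thesis .
qed

lemma pmult_one:
  assumes "f \<in> carrier (path_algebra G)"
  shows "pmult \<one>\<^bsub>path_algebra G\<^esub> f = f" and "pmult f \<one>\<^bsub>path_algebra G\<^esub> = f"
proof -
  have sub: "Poly_Mapping.keys f \<subseteq> paths G" using assms by (simp add: path_algebra_simps)
  have ends: "psource x \<in> verts G" "ptarget x \<in> verts G" if "x \<in> Poly_Mapping.keys f" for x
    using paths_ends[OF subsetD[OF sub that]] by simp_all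
  have 1: "pmult \<one>\<^bsub>path_algebra G\<^esub> (Poly_Mapping.single x c) = Poly_Mapping.single x c"
    if "ptarget x \<in> verts G" for x and c :: 'c
    using that by (simp add: path_algebra_simps pmult_sum_left pmult_single path_comp_def
        psource_def ptarget_def parrows_def vertex_path_def)
  have 2: "pmult (Poly_Mapping.single x c) \<one>\<^bsub>path_algebra G\<^esub> = Poly_Mapping.single x c"
    if "psource x \<in> verts G" for x and c :: 'c
    using that by (simp add: path_algebra_simps pmult_sum_right pmult_single path_comp_def
        psource_def ptarget_def parrows_def vertex_path_def)
  have "pmult \<one>\<^bsub>path_algebra G\<^esub> (\<Sum>x\<in>Poly_Mapping.keys f. Poly_Mapping.single x (Poly_Mapping.lookup f x))
     = (\<Sum>x\<in>Poly_Mapping.keys f. Poly_Mapping.single x (Poly_Mapping.lookup f x))"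
    unfolding pmult_sum_right by (intro sum.cong refl 1 ends)
  then show "pmult \<one>\<^bsub>path_algebra G\<^esub> f = f" by (simp add: poly_mapping_sum_single)
  have "pmult (\<Sum>x\<in>Poly_Mapping.keys f. Poly_Mapping.single x (Poly_Mapping.lookup f x)) \<one>\<^bsub>path_algebra G\<^esub>
     = (\<Sum>x\<in>Poly_Mapping.keys f. Poly_Mapping.single x (Poly_Mapping.lookup f x))"
    unfolding pmult_sum_left by (intro sum.cong refl 2 ends)
  then show "pmult f \<one>\<^bsub>path_algebra G\<^esub> = f" by (simp add: poly_mapping_sum_single)
qed

lemma ring_path_algebra: "ring (path_algebra G :: ('k::field, _) module)"
proof (rule ringI)
  show "abelian_group (path_algebra G :: ('k, _) module)"
  proof (rule abelian_groupI; unfold path_algebra_simps(4,5))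
    fix f :: "('a, 'b) path \<Rightarrow>\<^sub>0 'k" assume "f \<in> carrier (path_algebra G)"
    then show "\<exists>g\<in>carrier (path_algebra G). g + f = 0"
      by (intro bexI[of _ "- f"]) (auto intro: path_algebra_closed)
  qed (auto intro: path_algebra_closed simp: algebra_simps, auto simp: path_algebra_simps)
  show "Group.monoid (path_algebra G :: ('k, _) module)"
    by (rule monoidI)
      (auto simp: path_algebra_simps(2) pmult_closed pmult_assoc pmult_one, 
       auto simp: path_algebra_simps(3) intro!: path_algebra_sum_closed single_in_path_algebra)
qed (auto simp: path_algebra_simps(2,5) pmult_add_left pmult_add_right)

text \<open>A concatenation is empty only if both factors are, so exactly one pair of paths
  contributes.\<close>

lemma lookup_pmult_vertex:
  assumes "f \<in> carrier (path_algebra G)" "g \<in> carrier (path_algebra G)"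
  shows "Poly_Mapping.lookup (pmult f g) (vertex_path e) =
    Poly_Mapping.lookup f (vertex_path e) * Poly_Mapping.lookup g (vertex_path e)"
proof -
  \<comment> \<open>The trivial path is inserted so that the one surviving term is present even if
    its coefficient is zero.\<close>
  let ?F = "insert (vertex_path e) (Poly_Mapping.keys f)"
  let ?H = "insert (vertex_path e) (Poly_Mapping.keys g)"
  have "Poly_Mapping.lookup (pmult f g) (vertex_path e) = (\<Sum>(x, y)\<in>?F \<times> ?H.
           if psource x = ptarget y \<and> path_comp x y = vertex_path e
           then Poly_Mapping.lookup f x * Poly_Mapping.lookup g y else 0)"
    by (rule lookup_pmult) auto
  also have "\<dots> = (\<Sum>z\<in>{(vertex_path e, vertex_path e)}.
           Poly_Mapping.lookup f (fst z) * Poly_Mapping.lookup g (snd z))"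
  proof (rule sum.mono_neutral_cong_right)
    have "x = vertex_path e \<and> y = vertex_path e"
      if "x \<in> ?F" "y \<in> ?H" "path_comp x y = vertex_path e" for x y
    proof -
      have "x = vertex_path e \<or> x \<in> paths G" "y = vertex_path e \<or> y \<in> paths G"
        using that assms by (auto simp: path_algebra_simps)
      then show ?thesis
        using that(3) by (auto simp: path_eq_iff paths_iff awalk_def)
    qed
    note key = this
    show "\<forall>i\<in>?F \<times> ?H - {(vertex_path e, vertex_path e)}. (case i of (x, y) \<Rightarrow>
        if psource x = ptarget y \<and> path_comp x y = vertex_path e
        then Poly_Mapping.lookup f x * Poly_Mapping.lookup g y else 0) = 0"
    proof
      fix i assume i: "i \<in> ?F \<times> ?H - {(vertex_path e, vertex_path e)}"
      obtain x y where xy: "i = (x, y)" by (cases i)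
      have "path_comp x y \<noteq> vertex_path e"
        using key[of x y] i unfolding xy by blast
      then show "(case i of (x, y) \<Rightarrow>
        if psource x = ptarget y \<and> path_comp x y = vertex_path e
        then Poly_Mapping.lookup f x * Poly_Mapping.lookup g y else 0) = 0"
        by (simp add: xy)
    qed
  qed (auto simp: path_eq_iff)
  finally show ?thesis by simp
qed

text \<open>A path of length one has exactly two factorisations: the trivial path at its head after
  the arrow, and the arrow after the trivial path at its tail.\<close>

lemma lookup_pmult_arrow:
  assumes "f \<in> carrier (path_algebra G)" "g \<in> carrier (path_algebra G)"
  shows "Poly_Mapping.lookup (pmult f g) (arrow_path G a) =
    Poly_Mapping.lookup f (vertex_path (head G a)) * Poly_Mapping.lookup g (arrow_path G a) +
    Poly_Mapping.lookup f (arrow_path G a) * Poly_Mapping.lookup g (vertex_path (tail G a))"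
proof -
  let ?F = "{vertex_path (head G a), arrow_path G a} \<union> Poly_Mapping.keys f"
  let ?H = "{vertex_path (tail G a), arrow_path G a} \<union> Poly_Mapping.keys g"
  let ?Z = "{(vertex_path (head G a), arrow_path G a), (arrow_path G a, vertex_path (tail G a))}"
  have "Poly_Mapping.lookup (pmult f g) (arrow_path G a) = (\<Sum>(x, y)\<in>?F \<times> ?H.
           if psource x = ptarget y \<and> path_comp x y = arrow_path G a
           then Poly_Mapping.lookup f x * Poly_Mapping.lookup g y else 0)"
    by (rule lookup_pmult) auto
  also have "\<dots> = (\<Sum>z\<in>?Z. Poly_Mapping.lookup f (fst z) * Poly_Mapping.lookup g (snd z))"
  proof (rule sum.mono_neutral_cong_right)
    have "(x, y) \<in> ?Z"
      if "x \<in> ?F" "y \<in> ?H" "path_comp x y = arrow_path G a" for x y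
    proof -
      have *: "x = vertex_path (head G a) \<or> x = arrow_path G a \<or> x \<in> paths G"
           "y = vertex_path (tail G a) \<or> y = arrow_path G a \<or> y \<in> paths G"
        using that assms by (auto simp: path_algebra_simps)
      have "parrows y @ parrows x = [a]" "psource y = tail G a" "ptarget x = head G a"
        using that(3) by (auto simp: path_eq_iff)
      then show ?thesis
        using * by (cases "parrows y") (auto simp: path_eq_iff paths_iff awalk_def)
    qed
    note key = this
    show "\<forall>i\<in>?F \<times> ?H - ?Z. (case i of (x, y) \<Rightarrow>
        if psource x = ptarget y \<and> path_comp x y = arrow_path G a
        then Poly_Mapping.lookup f x * Poly_Mapping.lookup g y else 0) = 0"
    proof
      fix i assume i: "i \<in> ?F \<times> ?H - ?Z"
      obtain x y where xy: "i = (x, y)" by (cases i)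
      have "path_comp x y \<noteq> arrow_path G a"
        using key[of x y] i unfolding xy by blast
      then show "(case i of (x, y) \<Rightarrow>
        if psource x = ptarget y \<and> path_comp x y = arrow_path G a
        then Poly_Mapping.lookup f x * Poly_Mapping.lookup g y else 0) = 0"
        by (simp add: xy)
    qed
  qed (auto simp: path_eq_iff)
  finally show ?thesis by simp
qed

definition same_coords :: "(('a, 'b) path \<Rightarrow>\<^sub>0 'k::field) \<Rightarrow> (('a, 'b) path \<Rightarrow>\<^sub>0 'k) \<Rightarrow> bool" where
  "same_coords f g \<longleftrightarrow>
     (\<forall>e\<in>verts G. Poly_Mapping.lookup f (vertex_path e) = Poly_Mapping.lookup g (vertex_path e)) \<and>
     (\<forall>a\<in>arcs G. Poly_Mapping.lookup f (arrow_path G a) = Poly_Mapping.lookup g (arrow_path G a))"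

text \<open>The two formulas for products are linear in the short coefficients of each factor; if
  these vanish for one factor, they vanish for the product.\<close>

lemma long_paths_ideal:
  "ideal {f \<in> carrier (path_algebra G). same_coords f 0} (path_algebra G :: ('k::field, _) module)"
    (is "ideal ?I ?R")
proof (rule idealI[OF ring_path_algebra])
  interpret ring ?R by (rule ring_path_algebra)
  have neg: "\<ominus>\<^bsub>?R\<^esub> f = - f" if "f \<in> carrier ?R" for f
    using that by (intro minus_equality) (auto simp: path_algebra_simps(4,5) path_algebra_closed)
  show "subgroup ?I (add_monoid ?R)"
  proof (rule add.subgroupI)
    show "?I \<noteq> {}" by (auto simp: path_algebra_simps same_coords_def intro!: exI[of _ 0])
    fix f assume "f \<in> ?I"
    then show "\<ominus>\<^bsub>?R\<^esub> f \<in> ?I" 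
      by (auto simp: neg path_algebra_closed same_coords_def)
  next
    fix f g assume "f \<in> ?I" "g \<in> ?I"
    then show "f \<oplus>\<^bsub>?R\<^esub> g \<in> ?I" 
      by (auto simp: path_algebra_simps(5) path_algebra_closed same_coords_def lookup_add)
  qed auto
qed (auto simp: path_algebra_simps(2) pmult_closed same_coords_def lookup_pmult_vertex
      lookup_pmult_arrow)

text \<open>One inclusion is minimality of the generated ideal. For the other, an element without
  short coefficients is a combination of paths of length at least two, and each of these is a
  multiple of a generator.\<close>

lemma rsz_ideal_eq:
  "(rsz_ideal G :: (('a, 'b) path \<Rightarrow>\<^sub>0 'k::field) set) = {f \<in> carrier (path_algebra G). same_coords f 0}"
    (is "_ = ?I")
proof
  let ?R = "path_algebra G :: ('k, _) module"
  interpret ring ?R by (rule ring_path_algebra)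
  let ?S = "{Poly_Mapping.single x (1 :: 'k) | x. x \<in> paths G \<and> length (parrows x) = 2}"
  have S: "?S \<subseteq> ?I"
    by (auto simp: same_coords_def single_in_path_algebra lookup_single when_def)
  show "rsz_ideal G \<subseteq> ?I"
    unfolding rsz_ideal_def by (rule genideal_minimal[OF long_paths_ideal S])
  have "ideal (rsz_ideal G) ?R"
    unfolding rsz_ideal_def using S by (intro genideal_ideal) auto
  then interpret J: ideal "rsz_ideal G" ?R .
  have gen: "?S \<subseteq> rsz_ideal G"
    unfolding rsz_ideal_def using S by (intro genideal_self) auto
  have single: "Poly_Mapping.single x c \<in> rsz_ideal G"
    if x: "x \<in> paths G" "length (parrows x) \<ge> 2" for x and c :: 'k
  proof -
    obtain a b p where p: "parrows x = a # b # p"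
      using x(2) by (metis Suc_le_length_iff numeral_2_eq_2)
    \<comment> \<open>The generator consists of the two arrows traversed first; composition from
      right to left puts the rest of the path on its left.\<close>
    let ?y = "(tail G a, [a, b], head G b)" and ?z = "(head G b, p, ptarget x)"
    have *: "?y \<in> paths G" "?z \<in> paths G" "psource ?z = ptarget ?y" "path_comp ?z ?y = x"
      using x(1) p
      by (auto simp: paths_iff awalk_def path_eq_iff, auto simp: psource_def ptarget_def parrows_def)
    have "Poly_Mapping.single ?z c \<otimes>\<^bsub>?R\<^esub> Poly_Mapping.single ?y 1 \<in> rsz_ideal G"
      using * by (intro J.I_l_closed single_in_path_algebra subsetD[OF gen] CollectI exI[of _ ?y])
        (simp_all add: parrows_def)
    then show ?thesis using * by (simp add: path_algebra_simps(2) pmult_single)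
  qed
  have zero: "(0 :: ('a, 'b) path \<Rightarrow>\<^sub>0 'k) \<in> rsz_ideal G" using J.zero_closed by (simp add: path_algebra_simps)
  have sum: "(\<Sum>x\<in>X. h x) \<in> rsz_ideal G" if "\<And>x. x \<in> X \<Longrightarrow> h x \<in> rsz_ideal G" for X and h :: "('a, 'b) path \<Rightarrow> ('a, 'b) path \<Rightarrow>\<^sub>0 'k"
    using that by (induction X rule: infinite_finite_induct)
      (use zero J.a_closed in \<open>simp_all add: path_algebra_simps(5)\<close>)
  show "?I \<subseteq> rsz_ideal G"
  proof
    fix f assume f: "f \<in> ?I"
    have "(\<Sum>x\<in>Poly_Mapping.keys f. Poly_Mapping.single x (Poly_Mapping.lookup f x)) \<in> rsz_ideal G"
    proof (intro sum single)
      fix x assume x: "x \<in> Poly_Mapping.keys f"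
      then show "x \<in> paths G" using f by (auto simp: path_algebra_simps)
      then show "length (parrows x) \<ge> 2"
        using x f by (cases rule: short_path_cases) (auto simp: same_coords_def in_keys_iff)
    qed
    then show "f \<in> rsz_ideal G" by (simp add: poly_mapping_sum_single)
  qed
qed

end

text \<open>The representative is arbitrary: by \<open>coef_class\<close>, its coefficients at the
  vertices and arrows of the quiver depend only on the coset.\<close>

definition vcoef :: "(('v, 'b) path \<Rightarrow>\<^sub>0 'k::field) set \<Rightarrow> 'v \<Rightarrow> 'k" where
  "vcoef X e = Poly_Mapping.lookup (SOME f. f \<in> X) (vertex_path e)"

definition acoef :: "('v, 'b) pre_digraph \<Rightarrow> (('v, 'b) path \<Rightarrow>\<^sub>0 'k::field) set \<Rightarrow> 'b \<Rightarrow> 'k" where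
  "acoef Q X a = Poly_Mapping.lookup (SOME f. f \<in> X) (arrow_path Q a)"

definition short_elt :: "('v, 'b) pre_digraph \<Rightarrow> ('v \<Rightarrow> 'k) \<Rightarrow> ('b \<Rightarrow> 'k) \<Rightarrow> (('v, 'b) path \<Rightarrow>\<^sub>0 'k::field)" where
  "short_elt Q u w = (\<Sum>e\<in>verts Q. Poly_Mapping.single (vertex_path e) (u e)) +
     (\<Sum>a\<in>arcs Q. Poly_Mapping.single (arrow_path Q a) (w a))"

definition rsz_elt :: "('v, 'b) pre_digraph \<Rightarrow> ('v \<Rightarrow> 'k) \<Rightarrow> ('b \<Rightarrow> 'k) \<Rightarrow> (('v, 'b) path \<Rightarrow>\<^sub>0 'k::field) set" where
  "rsz_elt Q u w = rsz_class Q (short_elt Q u w)"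

section \<open>Arithmetic of the quotient algebra in coefficients\<close>

context fin_digraph
begin

lemma same_coordsD:
  assumes "same_coords f g"
  shows "e \<in> verts G \<Longrightarrow> Poly_Mapping.lookup f (vertex_path e) = Poly_Mapping.lookup g (vertex_path e)"
    and "a \<in> arcs G \<Longrightarrow> Poly_Mapping.lookup f (arrow_path G a) = Poly_Mapping.lookup g (arrow_path G a)"
  using assms by (auto simp: same_coords_def)

lemma rsz_class_eq:
  assumes f: "f \<in> carrier (path_algebra G)"
  shows "rsz_class G f = {g \<in> carrier (path_algebra G). same_coords g f}"
proof -
  have "rsz_class G f = (\<lambda>h. h + f) ` {h \<in> carrier (path_algebra G). same_coords h 0}"
    by (auto simp: rsz_class_def a_r_coset_def' rsz_ideal_eq path_algebra_simps(5))
  also have "\<dots> = {g \<in> carrier (path_algebra G). same_coords g f}"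
  proof (intro equalityI subsetI)
    fix g assume g: "g \<in> {g \<in> carrier (path_algebra G). same_coords g f}"
    have "g + - f \<in> carrier (path_algebra G)"
      using f g by (intro path_algebra_closed) auto
    then have "g - f \<in> {h \<in> carrier (path_algebra G). same_coords h 0}"
      using g by (auto simp: same_coords_def lookup_minus)
    then show "g \<in> (\<lambda>h. h + f) ` {h \<in> carrier (path_algebra G). same_coords h 0}"
      by (rule rev_image_eqI) simp
  qed (use f path_algebra_closed in \<open>auto simp: same_coords_def lookup_add\<close>)
  finally show ?thesis .
qed

lemma rsz_class_cong:
  assumes "f \<in> carrier (path_algebra G)" "g \<in> carrier (path_algebra G)" "same_coords f g"
  shows "rsz_class G f = rsz_class G g"
  using assms by (auto simp: rsz_class_eq same_coords_def)

lemma self_in_rsz_class: "f \<in> carrier (path_algebra G) \<Longrightarrow> f \<in> rsz_class G f"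
  by (simp add: rsz_class_eq same_coords_def)

lemma some_in_rsz_class:
  assumes f: "f \<in> carrier (path_algebra G)"
  shows "same_coords (SOME g. g \<in> rsz_class G f) f"
  using someI[of "\<lambda>g. g \<in> rsz_class G f", OF self_in_rsz_class[OF f]] f by (simp add: rsz_class_eq)

lemma coef_class:
  assumes "f \<in> carrier (path_algebra G)"
  shows "e \<in> verts G \<Longrightarrow> vcoef (rsz_class G f) e = Poly_Mapping.lookup f (vertex_path e)"
    and "a \<in> arcs G \<Longrightarrow> acoef G (rsz_class G f) a = Poly_Mapping.lookup f (arrow_path G a)"
  using same_coordsD[OF some_in_rsz_class[OF assms]] by (simp_all add: vcoef_def acoef_def)

lemma ideal_rsz_ideal: "ideal (rsz_ideal G) (path_algebra G :: ('k::field, _) module)"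
  unfolding rsz_ideal_eq by (rule long_paths_ideal)

lemma rsz_algebra_simps:
  "carrier (rsz_algebra G) = rsz_class G ` carrier (path_algebra G)"
  "\<zero>\<^bsub>rsz_algebra G :: ('k::field, _) module\<^esub> = rsz_class G 0"
  "\<lbrakk>f \<in> carrier (path_algebra G); g \<in> carrier (path_algebra G)\<rbrakk> \<Longrightarrow>
     rsz_class G f \<oplus>\<^bsub>rsz_algebra G :: ('k, _) module\<^esub> rsz_class G g = rsz_class G (f + g)"
  "\<lbrakk>f \<in> carrier (path_algebra G); g \<in> carrier (path_algebra G)\<rbrakk> \<Longrightarrow>
     rsz_class G f \<otimes>\<^bsub>rsz_algebra G :: ('k, _) module\<^esub> rsz_class G g = rsz_class G (pmult f g)"
  "f \<in> carrier (path_algebra G) \<Longrightarrow>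
     c \<odot>\<^bsub>rsz_algebra G :: ('k, _) module\<^esub> rsz_class G f = rsz_class G (pscale c f)"
proof -
  let ?R = "path_algebra G :: ('k, _) module"
  interpret I: ideal "rsz_ideal G" ?R by (rule ideal_rsz_ideal)
  note d = rsz_algebra_def quotient_algebra_def ring.extend_def module.fields_def FactRing_def
  show "carrier (rsz_algebra G) = rsz_class G ` carrier (path_algebra G)"
    unfolding rsz_algebra_def quotient_algebra_def
    by (simp add: ring.extend_def)
      (simp only: FactRing_def partial_object.simps A_RCOSETS_def' rsz_class_def, blast)
  have "rsz_class G 0 = (rsz_ideal G :: (('a, 'b) path \<Rightarrow>\<^sub>0 'k) set)"
    unfolding rsz_ideal_eq by (rule rsz_class_eq) (simp add: path_algebra_simps)
  then show "\<zero>\<^bsub>rsz_algebra G :: ('k, _) module\<^esub> = rsz_class G 0"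
    by (simp add: d)
  show "rsz_class G f \<oplus>\<^bsub>rsz_algebra G :: ('k, _) module\<^esub> rsz_class G g = rsz_class G (f + g)"
    if "f \<in> carrier (path_algebra G)" "g \<in> carrier (path_algebra G)" for f g
    using I.a_rcos_sum[OF that] by (simp add: d rsz_class_def path_algebra_simps)
  show "rsz_class G f \<otimes>\<^bsub>rsz_algebra G :: ('k, _) module\<^esub> rsz_class G g = rsz_class G (pmult f g)"
    if "f \<in> carrier (path_algebra G)" "g \<in> carrier (path_algebra G)" for f g
    using I.rcoset_mult_add[OF that] by (simp add: d rsz_class_def path_algebra_simps)
  show "c \<odot>\<^bsub>rsz_algebra G :: ('k, _) module\<^esub> rsz_class G f = rsz_class G (pscale c f)"
    if f: "f \<in> carrier (path_algebra G)"
  proof -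
    have "c \<odot>\<^bsub>rsz_algebra G :: ('k, _) module\<^esub> rsz_class G f
        = (\<Union>g\<in>rsz_class G f. rsz_class G (pscale c g))"
      by (simp add: d rsz_class_def path_algebra_simps)
    \<comment> \<open>The quotient scales all representatives and takes the union; scaling preserves
      agreement of short coefficients, so all of them give the same coset.\<close>
    also have "\<dots> = (\<Union>g\<in>rsz_class G f. rsz_class G (pscale c f))"
    proof (intro SUP_cong refl rsz_class_cong path_algebra_closed f)
      fix g assume "g \<in> rsz_class G f"
      then show "g \<in> carrier (path_algebra G)" "same_coords (pscale c g) (pscale c f)"
        using f by (simp_all add: rsz_class_eq same_coords_def)
    qed
    also have "\<dots> = rsz_class G (pscale c f)"
      using self_in_rsz_class[OF f] by auto
    finally show ?thesis .
  qed
qed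

text \<open>The main tool below: an equation in the algebra becomes a family of scalar equations,
  one per vertex and one per arrow.\<close>

lemma rsz_eqI:
  assumes "X \<in> carrier (rsz_algebra G)" "Y \<in> carrier (rsz_algebra G)"
    and "\<And>e. e \<in> verts G \<Longrightarrow> vcoef X e = vcoef Y e"
    and "\<And>a. a \<in> arcs G \<Longrightarrow> acoef G X a = acoef G Y a"
  shows "X = Y"
proof -
  from assms(1) obtain f where f: "X = rsz_class G f" "f \<in> carrier (path_algebra G)"
    unfolding rsz_algebra_simps(1) by (rule imageE)
  from assms(2) obtain g where g: "Y = rsz_class G g" "g \<in> carrier (path_algebra G)"
    unfolding rsz_algebra_simps(1) by (rule imageE)
  have "same_coords f g"
    using assms(3,4) f g by (simp add: same_coords_def coef_class)
  with f g show ?thesis by (simp only: rsz_class_cong)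
qed

lemma short_elt_closed: "short_elt G u w \<in> carrier (path_algebra G)"
  unfolding short_elt_def
  by (intro path_algebra_closed path_algebra_sum_closed single_in_path_algebra) auto

lemma lookup_short_elt:
  "e \<in> verts G \<Longrightarrow> Poly_Mapping.lookup (short_elt G u w) (vertex_path e) = u e"
  "a \<in> arcs G \<Longrightarrow> Poly_Mapping.lookup (short_elt G u w) (arrow_path G a) = w a"
  by (simp_all add: short_elt_def lookup_add lookup_sum lookup_single when_def)

lemma rsz_elt_closed: "rsz_elt G u w \<in> carrier (rsz_algebra G)"
  by (simp add: rsz_elt_def rsz_algebra_simps short_elt_closed)

lemma coef_rsz_elt:
  "e \<in> verts G \<Longrightarrow> vcoef (rsz_elt G u w) e = u e"
  "a \<in> arcs G \<Longrightarrow> acoef G (rsz_elt G u w) a = w a"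
  by (simp_all add: rsz_elt_def coef_class short_elt_closed lookup_short_elt)

lemma rsz_closed:
  assumes "X \<in> carrier (rsz_algebra G)"
  shows "Y \<in> carrier (rsz_algebra G) \<Longrightarrow> X \<oplus>\<^bsub>rsz_algebra G\<^esub> Y \<in> carrier (rsz_algebra G)"
    and "Y \<in> carrier (rsz_algebra G) \<Longrightarrow> X \<otimes>\<^bsub>rsz_algebra G\<^esub> Y \<in> carrier (rsz_algebra G)"
    and "c \<odot>\<^bsub>rsz_algebra G\<^esub> X \<in> carrier (rsz_algebra G)"
  using assms unfolding rsz_algebra_simps(1)
  by (auto simp: rsz_algebra_simps path_algebra_closed pmult_closed)

lemma rsz_zero_closed: "\<zero>\<^bsub>rsz_algebra G\<^esub> \<in> carrier (rsz_algebra G)"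
  by (auto simp: rsz_algebra_simps path_algebra_simps)

lemma coef_zero:
  "e \<in> verts G \<Longrightarrow> vcoef \<zero>\<^bsub>rsz_algebra G\<^esub> e = 0"
  "a \<in> arcs G \<Longrightarrow> acoef G \<zero>\<^bsub>rsz_algebra G\<^esub> a = 0"
  by (simp_all add: rsz_algebra_simps coef_class path_algebra_simps)

lemma coef_add:
  assumes "X \<in> carrier (rsz_algebra G)" "Y \<in> carrier (rsz_algebra G)"
  shows "e \<in> verts G \<Longrightarrow> vcoef (X \<oplus>\<^bsub>rsz_algebra G\<^esub> Y) e = vcoef X e + vcoef Y e"
    and "a \<in> arcs G \<Longrightarrow> acoef G (X \<oplus>\<^bsub>rsz_algebra G\<^esub> Y) a = acoef G X a + acoef G Y a"
  using assms unfolding rsz_algebra_simps(1)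
  by (auto simp: rsz_algebra_simps coef_class path_algebra_closed lookup_add)

lemma coef_scale:
  assumes "X \<in> carrier (rsz_algebra G)"
  shows "e \<in> verts G \<Longrightarrow> vcoef (c \<odot>\<^bsub>rsz_algebra G\<^esub> X) e = c * vcoef X e"
    and "a \<in> arcs G \<Longrightarrow> acoef G (c \<odot>\<^bsub>rsz_algebra G\<^esub> X) a = c * acoef G X a"
  using assms unfolding rsz_algebra_simps(1)
  by (auto simp: rsz_algebra_simps coef_class path_algebra_closed)

lemma coef_mult:
  assumes "X \<in> carrier (rsz_algebra G)" "Y \<in> carrier (rsz_algebra G)"
  shows "e \<in> verts G \<Longrightarrow> vcoef (X \<otimes>\<^bsub>rsz_algebra G\<^esub> Y) e = vcoef X e * vcoef Y e"
    and "a \<in> arcs G \<Longrightarrow> acoef G (X \<otimes>\<^bsub>rsz_algebra G\<^esub> Y) a =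
       vcoef X (head G a) * acoef G Y a + acoef G X a * vcoef Y (tail G a)"
  using assms unfolding rsz_algebra_simps(1)
  by (auto simp: rsz_algebra_simps coef_class pmult_closed lookup_pmult_vertex lookup_pmult_arrow)

lemma abelian_group_rsz: "abelian_group (rsz_algebra G)"
proof (rule abelian_groupI)
  fix X assume X: "X \<in> carrier (rsz_algebra G)"
  show "\<exists>Y\<in>carrier (rsz_algebra G). Y \<oplus>\<^bsub>rsz_algebra G\<^esub> X = \<zero>\<^bsub>rsz_algebra G\<^esub>"
    using X
    by (intro bexI[of _ "(-1) \<odot>\<^bsub>rsz_algebra G\<^esub> X"] rsz_eqI)
      (auto simp: coef_add coef_scale coef_zero rsz_closed rsz_zero_closed)
qed (simp_all add: rsz_closed rsz_zero_closed,
    (rule rsz_eqI; simp add: coef_add coef_zero rsz_closed rsz_zero_closed algebra_simps)+)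

text \<open>Subtraction is defined through the additive inverse, whose coefficients become
  accessible once it is identified with the multiple by -1.\<close>

lemma coef_minus:
  assumes "X \<in> carrier (rsz_algebra G)" "Y \<in> carrier (rsz_algebra G)"
  shows "X \<ominus>\<^bsub>rsz_algebra G\<^esub> Y \<in> carrier (rsz_algebra G)"
    and "e \<in> verts G \<Longrightarrow> vcoef (X \<ominus>\<^bsub>rsz_algebra G\<^esub> Y) e = vcoef X e - vcoef Y e"
    and "a \<in> arcs G \<Longrightarrow> acoef G (X \<ominus>\<^bsub>rsz_algebra G\<^esub> Y) a = acoef G X a - acoef G Y a"
proof -
  interpret abelian_group "rsz_algebra G" by (rule abelian_group_rsz)
  have "\<ominus>\<^bsub>rsz_algebra G\<^esub> Y = (-1) \<odot>\<^bsub>rsz_algebra G\<^esub> Y"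
    using assms(2)
    by (intro minus_equality rsz_eqI)
      (auto simp: coef_add coef_scale coef_zero rsz_closed rsz_zero_closed)
  then show "X \<ominus>\<^bsub>rsz_algebra G\<^esub> Y \<in> carrier (rsz_algebra G)"
    "e \<in> verts G \<Longrightarrow> vcoef (X \<ominus>\<^bsub>rsz_algebra G\<^esub> Y) e = vcoef X e - vcoef Y e"
    "a \<in> arcs G \<Longrightarrow> acoef G (X \<ominus>\<^bsub>rsz_algebra G\<^esub> Y) a = acoef G X a - acoef G Y a"
    using assms by (simp_all add: a_minus_def coef_add coef_scale rsz_closed)
qed

text \<open>Since \<open>QB\<close> has all vertices of \<open>G\<close>, membership in the
  subalgebra imposes no condition at vertices, only the vanishing at the arrows outside
  \<open>QB\<close>.\<close>

lemma rsz_subalgebra_iff: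
  assumes "spanning QB G"
  shows "X \<in> rsz_subalgebra G QB \<longleftrightarrow>
    X \<in> carrier (rsz_algebra G) \<and> (\<forall>a\<in>arcs G - arcs QB. acoef G X a = 0)"
proof -
  have QB: "verts QB = verts G" "arcs QB \<subseteq> arcs G" "tail QB = tail G" "head QB = head G"
    using assms by (auto simp: spanning_def subgraph_def compatible_def)
  have aw: "awalk u p v" if "pre_digraph.awalk QB u p v" for u p v
    using assms that by (metis spanning_def subgraph_awalk_imp_awalk)
  show ?thesis
  proof
    assume "X \<in> rsz_subalgebra G QB"
    then obtain f where f: "Poly_Mapping.keys f \<subseteq> paths QB" "X = rsz_class G f"
      by (auto simp: rsz_subalgebra_def path_algebra_simps)
    have "paths QB \<subseteq> paths G" using aw by (auto simp: paths_def)
    then have f': "f \<in> carrier (path_algebra G)" using f by (auto simp: path_algebra_simps)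
    have "arrow_path G a \<notin> paths QB" if "a \<notin> arcs QB" for a
      using that by (auto simp: paths_def arrow_path_def pre_digraph.awalk_def)
    then have "Poly_Mapping.lookup f (arrow_path G a) = 0" if "a \<notin> arcs QB" for a
      using f that by (metis in_keys_iff subsetD)
    then show "X \<in> carrier (rsz_algebra G) \<and> (\<forall>a\<in>arcs G - arcs QB. acoef G X a = 0)"
      using f f' by (auto simp: rsz_algebra_simps coef_class)
  next
    assume X: "X \<in> carrier (rsz_algebra G) \<and> (\<forall>a\<in>arcs G - arcs QB. acoef G X a = 0)"
    \<comment> \<open>A representative that uses only \<open>QB\<close>; it equals the short
      representative over \<open>G\<close>, because the omitted arrows have coefficient
      zero.\<close>
    let ?f = "short_elt QB (vcoef X) (acoef G X)"
    have sub: "?f \<in> carrier (path_algebra QB)"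
      unfolding short_elt_def
      by (intro path_algebra_closed path_algebra_sum_closed single_in_path_algebra)
        (use QB(2) in \<open>auto simp: QB paths_def vertex_path_def arrow_path_def
          pre_digraph.awalk_def pre_digraph.cas.simps subset_iff\<close>)
    have "arrow_path QB = arrow_path G" by (simp add: QB arrow_path_def fun_eq_iff)
    then have "?f = short_elt G (vcoef X) (acoef G X)"
      unfolding short_elt_def QB(1) using X QB(2)
      by (auto intro!: sum.mono_neutral_left)
    then have "X = rsz_class G ?f"
      using X rsz_elt_closed[of "vcoef X" "acoef G X"] 
      by (intro rsz_eqI) (auto simp: coef_rsz_elt rsz_elt_def[symmetric])
    then show "X \<in> rsz_subalgebra G QB"
      unfolding rsz_subalgebra_def using sub by blast
  qed
qed

end

section \<open>Derivations in coordinates\<close>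

text \<open>A \<open>B\<close>-bimodule derivation is determined by the coefficients \<open>m a b\<close> of \<open>b\<close> in the image of
  \<open>a\<close>; composition of derivations becomes \<open>coef_bracket\<close>.\<close>

definition coef_carrier ::
    "('v, 'b) pre_digraph \<Rightarrow> ('v, 'b) pre_digraph \<Rightarrow> ('b \<Rightarrow> 'b \<Rightarrow> 'k::field) set" where
  "coef_carrier QA QB = {m. \<forall>a b. m a b \<noteq> 0 \<longrightarrow>
     a \<in> arcs QA - arcs QB \<and> b \<in> arcs QA \<and> arc_to_ends QA a = arc_to_ends QA b}"

definition coef_bracket ::
    "('v, 'b) pre_digraph \<Rightarrow> ('b \<Rightarrow> 'b \<Rightarrow> 'k::field) \<Rightarrow> ('b \<Rightarrow> 'b \<Rightarrow> 'k) \<Rightarrow> 'b \<Rightarrow> 'b \<Rightarrow> 'k" where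
  "coef_bracket Q m n a b = (\<Sum>c\<in>arcs Q. n a c * m c b - m a c * n c b)"

definition coef_lie ::
    "('v, 'b) pre_digraph \<Rightarrow> ('v, 'b) pre_digraph \<Rightarrow> ('k::field, 'b \<Rightarrow> 'b \<Rightarrow> 'k) lie" where
  "coef_lie QA QB =
    \<lparr> lcarrier = coef_carrier QA QB,
      lplus = (\<lambda>m n a b. m a b + n a b),
      lzero = (\<lambda>a b. 0),
      lscale = (\<lambda>c m a b. c * m a b),
      lbracket = coef_bracket QA \<rparr>"

lemma coef_lie_simps [simp]:
  "lcarrier (coef_lie QA QB) = coef_carrier QA QB"
  "lplus (coef_lie QA QB) = (\<lambda>m n a b. m a b + n a b)"
  "lzero (coef_lie QA QB) = (\<lambda>a b. 0)"
  "lscale (coef_lie QA QB) = (\<lambda>c m a b. c * m a b)"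
  "lbracket (coef_lie QA QB) = coef_bracket QA"
  by (simp_all add: coef_lie_def)

lemma coef_carrierD:
  assumes "m \<in> coef_carrier QA QB" "m a b \<noteq> 0"
  shows "a \<in> arcs QA" "a \<notin> arcs QB" "b \<in> arcs QA" "tail QA a = tail QA b" "head QA a = head QA b"
  using assms by (auto simp: coef_carrier_def arc_to_ends_def)

lemma coef_carrier_0:
  assumes "m \<in> coef_carrier QA QB"
    "a \<notin> arcs QA \<or> a \<in> arcs QB \<or> b \<notin> arcs QA \<or> arc_to_ends QA a \<noteq> arc_to_ends QA b"
  shows "m a b = 0"
  using assms by (auto simp: coef_carrier_def)

lemma coef_bracket_add_left:
  "coef_bracket Q (\<lambda>a b. m a b + m' a b) n = (\<lambda>a b. coef_bracket Q m n a b + coef_bracket Q m' n a b)"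
  by (simp add: coef_bracket_def fun_eq_iff sum.distrib[symmetric] algebra_simps)

lemma coef_bracket_closed:
  assumes "m \<in> coef_carrier QA QB" "n \<in> coef_carrier QA QB"
  shows "coef_bracket QA m n \<in> coef_carrier QA QB"
  unfolding coef_carrier_def
proof (intro CollectI allI impI)
  fix a b assume "coef_bracket QA m n a b \<noteq> 0"
  then obtain c where "n a c * m c b - m a c * n c b \<noteq> 0"
    unfolding coef_bracket_def by (meson sum.not_neutral_contains_not_neutral)
  then have "n a c \<noteq> 0 \<and> m c b \<noteq> 0 \<or> m a c \<noteq> 0 \<and> n c b \<noteq> 0" by auto
  then show "a \<in> arcs QA - arcs QB \<and> b \<in> arcs QA \<and> arc_to_ends QA a = arc_to_ends QA b"
    using coef_carrierD[OF assms(1)] coef_carrierD[OF assms(2)]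
    by (auto simp: arc_to_ends_def)
qed

text \<open>\<open>T\<close> is an entry of a triple matrix product. In the cyclic sum of the Jacobi
  identity each of the six orders of the factors occurs twice, with opposite signs.\<close>

lemma coef_bracket_bracket:
  fixes Q :: "('v, 'b) pre_digraph" and x y z :: "'b \<Rightarrow> 'b \<Rightarrow> 'k::field"
  defines "T \<equiv> \<lambda>a b x y z. \<Sum>c\<in>arcs Q. \<Sum>d\<in>arcs Q. x a c * y c d * z d b"
  shows "coef_bracket Q x (coef_bracket Q y z) a b
    = T a b z y x - T a b y z x - (T a b x z y - T a b x y z)"
proof -
  have "coef_bracket Q x (coef_bracket Q y z) a b
     = (\<Sum>c\<in>arcs Q. \<Sum>d\<in>arcs Q. z a d * y d c * x c b - y a d * z d c * x c b)
       - (\<Sum>c\<in>arcs Q. \<Sum>d\<in>arcs Q. x a c * z c d * y d b - x a c * y c d * z d b)"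
    by (simp add: coef_bracket_def sum_distrib_left sum_distrib_right sum_subtractf sum.distrib
        algebra_simps)
  also have "(\<Sum>c\<in>arcs Q. \<Sum>d\<in>arcs Q. z a d * y d c * x c b - y a d * z d c * x c b)
     = T a b z y x - T a b y z x"
    unfolding T_def by (subst sum.swap) (simp add: sum_subtractf)
  also have "(\<Sum>c\<in>arcs Q. \<Sum>d\<in>arcs Q. x a c * z c d * y d b - x a c * y c d * z d b)
     = T a b x z y - T a b x y z"
    unfolding T_def by (simp add: sum_subtractf)
  finally show ?thesis .
qed

text \<open>The only direct verification of the Lie axioms; all other Lie algebras receive them from
  here.\<close>

lemma lie_algebra_coef: "lie_algebra (coef_lie QA QB :: ('k::field, 'b \<Rightarrow> 'b \<Rightarrow> 'k) lie)"
proof (rule lie_algebra.intro; simp add: coef_bracket_closed)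
  show "(\<lambda>a b. x a b + y a b) \<in> coef_carrier QA QB"
    if "x \<in> coef_carrier QA QB" "y \<in> coef_carrier QA QB" for x y :: "'b \<Rightarrow> 'b \<Rightarrow> 'k"
    unfolding coef_carrier_def
  proof (intro CollectI allI impI)
    fix a b assume "x a b + y a b \<noteq> 0"
    then have "x a b \<noteq> 0 \<or> y a b \<noteq> 0" by auto
    then show "a \<in> arcs QA - arcs QB \<and> b \<in> arcs QA \<and> arc_to_ends QA a = arc_to_ends QA b"
      using that by (auto simp: coef_carrier_def)
  qed
  show "(\<lambda>a b. coef_bracket QA x (coef_bracket QA y z) a b +
       (coef_bracket QA y (coef_bracket QA z x) a b + coef_bracket QA z (coef_bracket QA x y) a b))
       = (\<lambda>a b. 0)" for x y z :: "'b \<Rightarrow> 'b \<Rightarrow> 'k"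
    unfolding coef_bracket_bracket by (simp add: algebra_simps)
qed (simp_all add: coef_carrier_def coef_bracket_def fun_eq_iff sum.distrib[symmetric]
      sum_distrib_left algebra_simps, metis)

text \<open>The parameter \<open>K\<close> only fixes the field.\<close>

locale rsz_pair = fin_digraph QA for QA :: "('v, 'b) pre_digraph" +
  fixes QB :: "('v, 'b) pre_digraph" and K :: "'k::field_char_0 itself"
  assumes spanning: "spanning QB QA"
begin

abbreviation A :: "('k, (('v, 'b) path \<Rightarrow>\<^sub>0 'k) set) module" where
  "A \<equiv> rsz_algebra QA"

abbreviation B :: "(('v, 'b) path \<Rightarrow>\<^sub>0 'k) set set" where
  "B \<equiv> rsz_subalgebra QA QB"

definition der_of ::
    "('b \<Rightarrow> 'b \<Rightarrow> 'k) \<Rightarrow> (('v, 'b) path \<Rightarrow>\<^sub>0 'k) set \<Rightarrow> (('v, 'b) path \<Rightarrow>\<^sub>0 'k) set" where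
  "der_of m = (\<lambda>X\<in>carrier A. rsz_elt QA (\<lambda>e. 0) (\<lambda>b. \<Sum>a\<in>arcs QA. acoef QA X a * m a b))"

lemmas closed_simps = rsz_closed rsz_zero_closed rsz_elt_closed coef_minus(1)
lemmas coef_simps = coef_zero coef_add coef_scale coef_mult coef_minus(2,3) coef_rsz_elt

lemma B_iff: "X \<in> B \<longleftrightarrow> X \<in> carrier A \<and> (\<forall>a\<in>arcs QA - arcs QB. acoef QA X a = 0)"
  by (rule rsz_subalgebra_iff[OF spanning])

lemma arcs_QB: "arcs QB \<subseteq> arcs QA"
  using spanning by (auto simp: spanning_def subgraph_def)

lemma coef_der_of:
  assumes "X \<in> carrier A"
  shows "der_of m X \<in> carrier A"
    and "e \<in> verts QA \<Longrightarrow> vcoef (der_of m X) e = 0"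
    and "b \<in> arcs QA \<Longrightarrow> acoef QA (der_of m X) b = (\<Sum>a\<in>arcs QA. acoef QA X a * m a b)"
  using assms by (simp_all add: der_of_def closed_simps coef_simps)

lemma der_of_B:
  assumes "m \<in> coef_carrier QA QB" "X \<in> B"
  shows "der_of m X = \<zero>\<^bsub>A\<^esub>"
proof -
  have "acoef QA X a * m a b = 0" if "a \<in> arcs QA" for a b
    using assms that coef_carrier_0[OF assms(1), of a b] by (auto simp: B_iff)
  then show ?thesis
    using assms
    by (intro rsz_eqI) (auto simp: B_iff coef_der_of coef_simps closed_simps intro!: sum.neutral)
qed

text \<open>The other factor enters an arrow coefficient through its value at an end of the arrow.
  Since \<open>m\<close> relates only arrows with the same ends, these values can be moved through
  the sum.\<close>

lemma der_of_mult:
  assumes "m \<in> coef_carrier QA QB" "X \<in> carrier A" "Y \<in> carrier A"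
  shows "der_of m (X \<otimes>\<^bsub>A\<^esub> Y) = (der_of m X \<otimes>\<^bsub>A\<^esub> Y) \<oplus>\<^bsub>A\<^esub> (X \<otimes>\<^bsub>A\<^esub> der_of m Y)"
proof (rule rsz_eqI)
  fix b assume b: "b \<in> arcs QA"
  have *: "(vcoef X (head QA a) * acoef QA Y a + acoef QA X a * vcoef Y (tail QA a)) * m a b
     = acoef QA X a * m a b * vcoef Y (tail QA b) + vcoef X (head QA b) * (acoef QA Y a * m a b)" for a
    using coef_carrierD(4,5)[OF assms(1), of a b] by (cases "m a b = 0") (auto simp: algebra_simps)
  show "acoef QA (der_of m (X \<otimes>\<^bsub>A\<^esub> Y)) b
      = acoef QA ((der_of m X \<otimes>\<^bsub>A\<^esub> Y) \<oplus>\<^bsub>A\<^esub> (X \<otimes>\<^bsub>A\<^esub> der_of m Y)) b"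
    using assms b
    by (simp add: coef_der_of coef_simps closed_simps * sum.distrib sum_distrib_left sum_distrib_right)
qed (use assms in \<open>simp_all add: coef_der_of coef_simps closed_simps\<close>)

text \<open>Compatibility with \<open>B\<close> is the Leibniz rule in which the term that
  differentiates the element of \<open>B\<close> drops out.\<close>

lemma der_of_in_rel_Der:
  assumes "m \<in> coef_carrier QA QB"
  shows "der_of m \<in> rel_Der A B"
proof -
  have "der_of m \<in> Der A"
    unfolding Der_def
  proof (intro CollectI conjI ballI allI)
    show "der_of m \<in> carrier A \<rightarrow>\<^sub>E carrier A"
      by (auto simp: der_of_def closed_simps)
  next
    fix X Y assume "X \<in> carrier A" "Y \<in> carrier A"
    then show "der_of m (X \<oplus>\<^bsub>A\<^esub> Y) = der_of m X \<oplus>\<^bsub>A\<^esub> der_of m Y"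
      by (intro rsz_eqI)
        (simp_all add: coef_der_of coef_simps closed_simps algebra_simps sum.distrib)
  next
    fix c X assume "X \<in> carrier A"
    then show "der_of m (c \<odot>\<^bsub>A\<^esub> X) = c \<odot>\<^bsub>A\<^esub> der_of m X"
      by (intro rsz_eqI)
        (simp_all add: coef_der_of coef_simps closed_simps algebra_simps sum_distrib_left)
  qed (rule der_of_mult[OF assms])
  moreover have "der_of m (X \<otimes>\<^bsub>A\<^esub> Y) = X \<otimes>\<^bsub>A\<^esub> der_of m Y \<and> der_of m (Y \<otimes>\<^bsub>A\<^esub> X) = der_of m Y \<otimes>\<^bsub>A\<^esub> X"
    if "X \<in> B" "Y \<in> carrier A" for X Y
  proof -
    have "X \<in> carrier A" using that by (simp add: B_iff)
    then show ?thesis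
      using that assms
      by (intro conjI; intro rsz_eqI;
          simp add: der_of_mult der_of_B coef_der_of coef_simps closed_simps)
  qed
  ultimately show ?thesis by (auto simp: rel_Der_def)
qed

lemma der_of_inject:
  assumes "m \<in> coef_carrier QA QB" "n \<in> coef_carrier QA QB" "der_of m = der_of n"
  shows "m = n"
proof (intro ext)
  fix a b
  show "m a b = n a b"
  proof (cases "a \<in> arcs QA \<and> b \<in> arcs QA")
    case True
    let ?X = "rsz_elt QA (\<lambda>e. 0) (\<lambda>c. if c = a then 1 else 0)"
    have "acoef QA (der_of m ?X) b = acoef QA (der_of n ?X) b" using assms by simp
    then show ?thesis
      using True by (simp add: coef_der_of closed_simps coef_simps if_distrib[of "\<lambda>x. x * _"] cong: if_cong)
  qed (use assms coef_carrier_0 in metis)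
qed

text \<open>Surjectivity is the substantial part. A relative derivation kills \<open>B\<close>,
  hence all vertices; multiplying by vertices confines the image of an arrow to parallel paths, and
  what remains is a matrix.\<close>

lemma der_of_epi: "lie_epi (coef_lie QA QB) (rel_Der_lie A B) der_of"
proof -
  have eqI: "D = E" if "D \<in> rel_Der A B" "E \<in> extensional (carrier A)"
    "\<And>X. X \<in> carrier A \<Longrightarrow> D X = E X" for D E
    using that by (intro extensionalityI[of D "carrier A"]) (auto simp: rel_Der_def Der_def PiE_def)
  have ext: "D = E" if "D \<in> extensional (carrier A)" "E \<in> extensional (carrier A)"
    "\<And>X. X \<in> carrier A \<Longrightarrow> D X = E X" for D E :: "(('v, 'b) path \<Rightarrow>\<^sub>0 'k) set \<Rightarrow> (('v, 'b) path \<Rightarrow>\<^sub>0 'k) set"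
    using that by (rule extensionalityI)
  have der_ext: "der_of m \<in> extensional (carrier A)" for m by (simp add: der_of_def)
  have hom: "der_of \<in> lie_hom (coef_lie QA QB) (rel_Der_lie A B)"
  proof (rule lie_homI; simp add: rel_Der_lie_def der_of_in_rel_Der)
    fix m n :: "'b \<Rightarrow> 'b \<Rightarrow> 'k" and c
    assume mn: "m \<in> coef_carrier QA QB"
    show "der_of (\<lambda>a b. c * m a b) = (\<lambda>X\<in>carrier A. c \<odot>\<^bsub>A\<^esub> der_of m X)"
      by (rule ext[OF der_ext restrict_extensional], rule rsz_eqI)
        (simp_all add: coef_der_of coef_simps closed_simps sum_distrib_left mult.left_commute)
    assume "n \<in> coef_carrier QA QB"
    show "der_of (\<lambda>a b. m a b + n a b) = (\<lambda>X\<in>carrier A. der_of m X \<oplus>\<^bsub>A\<^esub> der_of n X)"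
      by (rule ext[OF der_ext restrict_extensional], rule rsz_eqI)
        (simp_all add: coef_der_of coef_simps closed_simps sum.distrib distrib_left)
    show "der_of (coef_bracket QA m n) =
        (\<lambda>X\<in>carrier A. der_of m (der_of n X) \<ominus>\<^bsub>A\<^esub> der_of n (der_of m X))"
    proof (rule ext[OF der_ext restrict_extensional], rule rsz_eqI)
      fix X b assume X: "X \<in> carrier A" and b: "b \<in> arcs QA"
      have "(\<Sum>a\<in>arcs QA. acoef QA X a * coef_bracket QA m n a b) =
        (\<Sum>a\<in>arcs QA. \<Sum>c\<in>arcs QA. acoef QA X a * n a c * m c b) -
        (\<Sum>a\<in>arcs QA. \<Sum>c\<in>arcs QA. acoef QA X a * m a c * n c b)"
        by (simp add: coef_bracket_def sum_distrib_left right_diff_distrib sum_subtractf mult.assoc)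
      also have "\<dots> = (\<Sum>c\<in>arcs QA. (\<Sum>a\<in>arcs QA. acoef QA X a * n a c) * m c b) -
        (\<Sum>c\<in>arcs QA. (\<Sum>a\<in>arcs QA. acoef QA X a * m a c) * n c b)"
        by (subst (1 2) sum.swap) (simp add: sum_distrib_right)
      finally show "acoef QA (der_of (coef_bracket QA m n) X) b = acoef QA
          ((\<lambda>X\<in>carrier A. der_of m (der_of n X) \<ominus>\<^bsub>A\<^esub> der_of n (der_of m X)) X) b"
        using X b by (simp add: coef_der_of coef_simps closed_simps)
    qed (simp_all add: coef_der_of coef_simps closed_simps)
  qed
  have surj: "D \<in> der_of ` coef_carrier QA QB" if D: "D \<in> rel_Der A B" for D
  proof -
    define arr where "arr a = rsz_elt QA (\<lambda>e. 0 :: 'k) (\<lambda>c. if c = a then 1 else 0)" for a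
    define ver where "ver e = rsz_elt QA (\<lambda>v. if v = e then 1 else 0) (\<lambda>c. 0 :: 'k)" for e
    define un where "un = rsz_elt QA (\<lambda>v. 1) (\<lambda>c. 0 :: 'k)"
    have Dclosed: "D X \<in> carrier A" if "X \<in> carrier A" for X
      using D that by (auto simp: rel_Der_def Der_def)
    have Dmult: "D (X \<otimes>\<^bsub>A\<^esub> Y) = (D X \<otimes>\<^bsub>A\<^esub> Y) \<oplus>\<^bsub>A\<^esub> (X \<otimes>\<^bsub>A\<^esub> D Y)"
      and Dadd: "D (X \<oplus>\<^bsub>A\<^esub> Y) = D X \<oplus>\<^bsub>A\<^esub> D Y" if "X \<in> carrier A" "Y \<in> carrier A" for X Y
      using D that by (auto simp: rel_Der_def Der_def)
    have Dscale: "D (c \<odot>\<^bsub>A\<^esub> X) = c \<odot>\<^bsub>A\<^esub> D X" if "X \<in> carrier A" for c X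
      using D that by (auto simp: rel_Der_def Der_def)
    have DB: "D (b \<otimes>\<^bsub>A\<^esub> X) = b \<otimes>\<^bsub>A\<^esub> D X" "D (X \<otimes>\<^bsub>A\<^esub> b) = D X \<otimes>\<^bsub>A\<^esub> b"
      if "b \<in> B" "X \<in> carrier A" for b X
      using D that by (auto simp: rel_Der_def)
    have BA: "X \<in> carrier A" if "X \<in> B" for X using that by (simp add: B_iff)
    have un: "un \<in> carrier A" "un \<in> B" and ver: "ver e \<in> carrier A" "ver e \<in> B"
      and arr: "arr a \<in> carrier A" for e a
      by (simp_all add: un_def ver_def arr_def B_iff coef_simps closed_simps)
    note clos = closed_simps Dclosed un ver arr
    \<comment> \<open>The unit is idempotent, so its image equals twice itself and vanishes.\<close>
    have "D (un \<otimes>\<^bsub>A\<^esub> un) = (D un \<otimes>\<^bsub>A\<^esub> un) \<oplus>\<^bsub>A\<^esub> (un \<otimes>\<^bsub>A\<^esub> D un)"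
      by (rule Dmult) (rule un)+
    moreover have un_l: "un \<otimes>\<^bsub>A\<^esub> X = X" and un_r: "X \<otimes>\<^bsub>A\<^esub> un = X" if "X \<in> carrier A" for X
      using that by (intro rsz_eqI; simp add: un_def coef_simps closed_simps)+
    ultimately have Dun2: "D un = D un \<oplus>\<^bsub>A\<^esub> D un" by (simp add: clos)
    have Dun: "D un = \<zero>\<^bsub>A\<^esub>"
    proof (rule rsz_eqI)
      show "vcoef (D un) e = vcoef \<zero>\<^bsub>A\<^esub> e" if "e \<in> verts QA" for e
        using arg_cong[OF Dun2, where f = "\<lambda>X. vcoef X e"] that by (simp add: coef_simps clos)
      show "acoef QA (D un) a = acoef QA \<zero>\<^bsub>A\<^esub> a" if "a \<in> arcs QA" for a
        using arg_cong[OF Dun2, where f = "\<lambda>X. acoef QA X a"] that by (simp add: coef_simps clos)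
    qed (simp_all add: clos)
    \<comment> \<open>Linearity over \<open>B\<close> gives D b = b D(1).\<close>
    have D0: "D b = \<zero>\<^bsub>A\<^esub>" if "b \<in> B" for b
    proof -
      have "D b = b \<otimes>\<^bsub>A\<^esub> D un"
        using DB(1)[OF that un(1)] by (simp add: un_r BA that)
      also have "\<dots> = \<zero>\<^bsub>A\<^esub>"
        unfolding Dun by (rule rsz_eqI) (simp_all add: coef_simps clos BA that)
      finally show ?thesis .
    qed
    \<comment> \<open>Vertices lie in \<open>B\<close>, so \<open>D\<close> commutes with cutting an
      arrow down to its own ends; its image is therefore cut down in the same way.\<close>
    have left: "D (arr a) = ver (head QA a) \<otimes>\<^bsub>A\<^esub> D (arr a)"
      and right: "D (arr a) = D (arr a) \<otimes>\<^bsub>A\<^esub> ver (tail QA a)" if "a \<in> arcs QA" for a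
    proof -
      have "ver (head QA a) \<otimes>\<^bsub>A\<^esub> arr a = arr a" "arr a \<otimes>\<^bsub>A\<^esub> ver (tail QA a) = arr a"
        using that by (intro rsz_eqI; auto simp: arr_def ver_def coef_simps closed_simps)+
      then show "D (arr a) = ver (head QA a) \<otimes>\<^bsub>A\<^esub> D (arr a)"
        "D (arr a) = D (arr a) \<otimes>\<^bsub>A\<^esub> ver (tail QA a)"
        using DB[OF ver(2) arr] by metis+
    qed
    have parallel: "arc_to_ends QA a = arc_to_ends QA b"
      if "a \<in> arcs QA" "b \<in> arcs QA" "acoef QA (D (arr a)) b \<noteq> 0" for a b
    proof -
      have "acoef QA (D (arr a)) b = acoef QA (ver (head QA a) \<otimes>\<^bsub>A\<^esub> D (arr a)) b"
        by (rule arg_cong[OF left[OF that(1)]])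
      also have "\<dots> = (if head QA b = head QA a then 1 else 0) * acoef QA (D (arr a)) b"
        using that(1,2) by (simp only: coef_simps clos) (simp add: ver_def coef_simps)
      finally have "acoef QA (D (arr a)) b
          = (if head QA b = head QA a then 1 else 0) * acoef QA (D (arr a)) b" .
      moreover have "acoef QA (D (arr a)) b = acoef QA (D (arr a)) b * (if tail QA b = tail QA a then 1 else 0)"
        by (rule trans[OF arg_cong[OF right[OF that(1)], where f = "\<lambda>X. acoef QA X b"]])
          (use that(1,2) in \<open>simp only: coef_simps clos, simp add: ver_def coef_simps\<close>)
      ultimately show ?thesis
        using that(3)
        by (cases "head QA b = head QA a"; cases "tail QA b = tail QA a")
          (simp_all add: arc_to_ends_def)
    qed
    \<comment> \<open>A derivation could send a loop to a multiple of its vertex; \<open>a a = 0\<close> forces twice the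
      coefficient to vanish.\<close>
    have varr: "vcoef (D (arr a)) e = 0" if a: "a \<in> arcs QA" and e: "e \<in> verts QA" for a e
    proof (rule ccontr)
      assume nz: "vcoef (D (arr a)) e \<noteq> 0"
      have "vcoef (D (arr a)) e = vcoef (ver (head QA a) \<otimes>\<^bsub>A\<^esub> D (arr a)) e"
        by (rule arg_cong[OF left[OF a]])
      also have "\<dots> = (if e = head QA a then 1 else 0) * vcoef (D (arr a)) e"
        using a e by (simp only: coef_simps clos) (simp add: ver_def coef_simps)
      finally have "vcoef (D (arr a)) e = (if e = head QA a then 1 else 0) * vcoef (D (arr a)) e" .
      moreover have "vcoef (D (arr a)) e = vcoef (D (arr a)) e * (if e = tail QA a then 1 else 0)"
        by (rule trans[OF arg_cong[OF right[OF a], where f = "\<lambda>X. vcoef X e"]])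
          (use a e in \<open>simp only: coef_simps clos, simp add: ver_def coef_simps\<close>)
      ultimately have loop: "head QA a = e" "tail QA a = e"
        using nz by (cases "e = head QA a"; cases "e = tail QA a"; simp)+
      have "arr a \<otimes>\<^bsub>A\<^esub> arr a = \<zero>\<^bsub>A\<^esub>"
        by (rule rsz_eqI) (simp_all add: clos coef_simps, simp_all add: arr_def coef_simps)
      moreover have "\<zero>\<^bsub>A\<^esub> \<in> B" by (simp add: B_iff clos coef_simps)
      ultimately have z: "(D (arr a) \<otimes>\<^bsub>A\<^esub> arr a) \<oplus>\<^bsub>A\<^esub> (arr a \<otimes>\<^bsub>A\<^esub> D (arr a)) = \<zero>\<^bsub>A\<^esub>"
        using Dmult[OF arr arr, of a a] D0 by simp
      have "acoef QA ((D (arr a) \<otimes>\<^bsub>A\<^esub> arr a) \<oplus>\<^bsub>A\<^esub> (arr a \<otimes>\<^bsub>A\<^esub> D (arr a))) a = 0"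
        unfolding z using a by (simp add: coef_simps)
      moreover have "acoef QA (arr a) a = 1" "vcoef (arr a) e = 0"
        using a e by (simp_all add: arr_def coef_simps)
      ultimately have "2 * vcoef (D (arr a)) e = 0"
        using a loop by (simp add: clos coef_simps)
      with nz show False by simp
    qed
    \<comment> \<open>The cut-off outside the arrows of \<open>QA\<close> makes the matrix unique
      and places it in \<open>coef_carrier\<close>.\<close>
    define m where "m a b = (if a \<in> arcs QA \<and> b \<in> arcs QA then acoef QA (D (arr a)) b else 0)" for a b
    have Darr: "D (arr a) = \<zero>\<^bsub>A\<^esub>" if "a \<in> arcs QB" for a
      using that by (intro D0) (auto simp: B_iff arr, auto simp: arr_def coef_simps)
    have m: "m \<in> coef_carrier QA QB"
      using parallel Darr by (auto simp: coef_carrier_def m_def coef_simps split: if_splits)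
    \<comment> \<open>Linear extension from single arrows: \<open>D\<close> is additive only on two
      summands, so coefficients are switched on one arrow at a time.\<close>
    have sum: "(\<forall>e\<in>verts QA. vcoef (D (rsz_elt QA (\<lambda>e. 0) (\<lambda>a. if a \<in> F then w a else 0))) e = 0) \<and>
      (\<forall>b\<in>arcs QA. acoef QA (D (rsz_elt QA (\<lambda>e. 0) (\<lambda>a. if a \<in> F then w a else 0))) b
        = (\<Sum>a\<in>F. w a * m a b))"
      if "finite F" "F \<subseteq> arcs QA" for F w
      using that(1,2)
    proof (induction F rule: finite_induct)
      case empty
      have "D (rsz_elt QA (\<lambda>e. 0) (\<lambda>a. 0 :: 'k)) = \<zero>\<^bsub>A\<^esub>"
        by (intro D0) (simp add: B_iff clos coef_simps)
      then show ?case by (simp add: coef_simps)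
    next
      case (insert x F)
      have "rsz_elt QA (\<lambda>e. 0) (\<lambda>a. if a \<in> insert x F then w a else 0)
         = (w x \<odot>\<^bsub>A\<^esub> arr x) \<oplus>\<^bsub>A\<^esub> rsz_elt QA (\<lambda>e. 0) (\<lambda>a. if a \<in> F then w a else 0)"
        using insert.hyps
        by (intro rsz_eqI) (auto simp: arr_def closed_simps coef_simps)
      then show ?case
        using insert by (simp add: Dadd Dscale clos coef_simps varr) (simp add: m_def)
    qed
    have "D X = der_of m X" if X: "X \<in> carrier A" for X
    proof -
      let ?Y = "rsz_elt QA (\<lambda>e. 0) (\<lambda>a. if a \<in> arcs QA then acoef QA X a else 0)"
      let ?Z = "rsz_elt QA (vcoef X) (\<lambda>a. 0)"
      have XZY: "X = ?Z \<oplus>\<^bsub>A\<^esub> ?Y"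
        using X by (intro rsz_eqI) (simp_all add: clos coef_simps)
      \<comment> \<open>The vertex part of any element lies in \<open>B\<close>, so only the arrow
        part contributes.\<close>
      have "D ?Z = \<zero>\<^bsub>A\<^esub>" by (intro D0) (simp add: B_iff clos coef_simps)
      then have "D (?Z \<oplus>\<^bsub>A\<^esub> ?Y) = \<zero>\<^bsub>A\<^esub> \<oplus>\<^bsub>A\<^esub> D ?Y"
        by (simp only: Dadd rsz_elt_closed)
      then have *: "D X = \<zero>\<^bsub>A\<^esub> \<oplus>\<^bsub>A\<^esub> D ?Y"
        by (simp only: XZY[symmetric])
      show ?thesis
        unfolding * using X sum[OF finite_arcs order_refl, of "acoef QA X"]
        by (intro rsz_eqI) (simp_all add: clos coef_simps coef_der_of)
    qed
    then have "D = der_of m" by (intro eqI D der_ext)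
    then show ?thesis using m by blast
  qed
  have zero: "der_of (\<lambda>a b. 0) = (\<lambda>X\<in>carrier A. \<zero>\<^bsub>A\<^esub>)"
    by (rule ext[OF der_ext restrict_extensional], rule rsz_eqI)
      (simp_all add: coef_der_of coef_simps closed_simps)
  show ?thesis
    unfolding lie_epi_def
    using hom surj der_of_in_rel_Der zero by (auto simp: rel_Der_lie_def)
qed

end

section \<open>Inner derivations and the map onto cohomology\<close>

context rsz_pair
begin

text \<open>Membership in \<open>coef_carrier\<close> is a restriction on the potential
  \<open>l\<close>: the row of an arrow of \<open>QB\<close> is zero, so \<open>l\<close> takes
  equal values at the two ends of that arrow.\<close>

definition coef_inner :: "('b \<Rightarrow> 'b \<Rightarrow> 'k) set" where
  "coef_inner = {m \<in> coef_carrier QA QB. \<exists>l. \<forall>a\<in>arcs QA. \<forall>b.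
     m a b = (if a = b then l (head QA a) - l (tail QA a) else 0)}"

text \<open>These matrices are even central: a diagonal matrix that is constant along parallel
  arrows commutes with every matrix that relates only parallel arrows.\<close>

lemma coef_inner_ideal: "lie_ideal coef_inner (coef_lie QA QB)"
proof -
  interpret L: lie_algebra "coef_lie QA QB :: ('k, _) lie" by (rule lie_algebra_coef)
  note clo = L.zero_closed L.plus_closed L.scale_closed L.bracket_closed
  have "(\<lambda>a b. 0) \<in> coef_inner"
    using clo by (auto simp: coef_inner_def intro!: exI[of _ "\<lambda>e. 0"])
  moreover have "(\<lambda>a b. m a b + n a b) \<in> coef_inner" if mn: "m \<in> coef_inner" "n \<in> coef_inner" for m n
  proof -
    obtain l l' where
      "\<forall>a\<in>arcs QA. \<forall>b. m a b = (if a = b then l (head QA a) - l (tail QA a) else 0)"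
      "\<forall>a\<in>arcs QA. \<forall>b. n a b = (if a = b then l' (head QA a) - l' (tail QA a) else 0)"
      using mn unfolding coef_inner_def by blast
    then show ?thesis
      using mn clo by (auto simp: coef_inner_def intro!: exI[of _ "\<lambda>e. l e + l' e"])
  qed
  moreover have "(\<lambda>a b. c * m a b) \<in> coef_inner" if m: "m \<in> coef_inner" for m c
  proof -
    obtain l where
      "\<forall>a\<in>arcs QA. \<forall>b. m a b = (if a = b then l (head QA a) - l (tail QA a) else 0)"
      using m by (auto simp: coef_inner_def)
    then show ?thesis
      using m clo
      by (auto simp: coef_inner_def right_diff_distrib intro!: exI[of _ "\<lambda>e. c * l e"])
  qed
  moreover have "coef_bracket QA m n \<in> coef_inner" if m: "m \<in> coef_carrier QA QB" and n: "n \<in> coef_inner" for m n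
  proof -
    obtain l where
      l: "\<forall>a\<in>arcs QA. \<forall>b. n a b = (if a = b then l (head QA a) - l (tail QA a) else 0)"
      using n by (auto simp: coef_inner_def)
    have "coef_bracket QA m n a b = 0" if a: "a \<in> arcs QA" for a b
    proof (cases "m a b = 0")
      case True
      have "coef_bracket QA m n a b = (\<Sum>c\<in>arcs QA. (if a = c then (l (head QA a) - l (tail QA a)) * m c b else 0)
            - (if c = b then m a c * (l (head QA c) - l (tail QA c)) else 0))"
        unfolding coef_bracket_def using l a by (intro sum.cong) auto
      then show ?thesis using a True by (simp add: sum_subtractf)
    next
      case False
      have "coef_bracket QA m n a b = (\<Sum>c\<in>arcs QA. (if a = c then (l (head QA a) - l (tail QA a)) * m c b else 0)
            - (if c = b then m a c * (l (head QA c) - l (tail QA c)) else 0))"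
        unfolding coef_bracket_def using l a by (intro sum.cong) auto
      \<comment> \<open>A nonzero entry \<open>m a b\<close> forces \<open>a\<close> and
        \<open>b\<close> to be parallel, so both differences of \<open>l\<close> are the same
        scalar.\<close>
      also have "\<dots> = (l (head QA a) - l (tail QA a)) * m a b - m a b * (l (head QA b) - l (tail QA b))"
        using a coef_carrierD[OF m False] by (simp add: sum_subtractf)
      finally show ?thesis using coef_carrierD[OF m False] by simp
    qed
    then show ?thesis
      using coef_bracket_closed[OF m] n by (auto simp: coef_inner_def intro!: exI[of _ "\<lambda>e. 0"])
  qed
  ultimately show ?thesis
    by (auto simp: lie_ideal_def lie_subspace_def) (auto simp: coef_inner_def)
qed

text \<open>The potential is the family of vertex coefficients of the element inducing the
  derivation. Its arrow coefficients do not affect the images of arrows, since products of arrows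
  vanish.\<close>

lemma rel_Inn_eq: "rel_Inn A B = der_of ` coef_inner"
proof (intro equalityI subsetI)
  fix D assume "D \<in> rel_Inn A B"
  then obtain x where x: "x \<in> carrier A" "D = inner_der A x" and "D \<in> rel_Der A B"
    by (auto simp: rel_Inn_def)
  then obtain m where m: "m \<in> coef_carrier QA QB" "D = der_of m"
    using der_of_epi by (auto simp: lie_epi_def rel_Der_lie_def)
  have "m a b = (if a = b then vcoef x (head QA a) - vcoef x (tail QA a) else 0)" if a: "a \<in> arcs QA" for a b
  proof (cases "b \<in> arcs QA")
    case True
    let ?X = "rsz_elt QA (\<lambda>e. 0) (\<lambda>c. if c = a then 1 else 0)"
    have "m a b = acoef QA (der_of m ?X) b"
      using a True
      by (simp add: coef_der_of closed_simps coef_simps if_distrib[of "\<lambda>x. x * _"] cong: if_cong)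
    also have "\<dots> = acoef QA ((x \<otimes>\<^bsub>A\<^esub> ?X) \<ominus>\<^bsub>A\<^esub> (?X \<otimes>\<^bsub>A\<^esub> x)) b"
      using x m by (simp add: inner_der_def closed_simps)
    also have "\<dots> = (if a = b then vcoef x (head QA a) - vcoef x (tail QA a) else 0)"
      using x True by (simp add: closed_simps coef_simps)
    finally show ?thesis .
  qed (use a coef_carrier_0[OF m(1)] in auto)
  then show "D \<in> der_of ` coef_inner"
    using m by (auto simp: coef_inner_def intro!: exI[of _ "vcoef x"])
next
  fix D assume "D \<in> der_of ` coef_inner"
  then obtain m l where m: "m \<in> coef_carrier QA QB" "D = der_of m" and
    l: "\<forall>a\<in>arcs QA. \<forall>b. m a b = (if a = b then l (head QA a) - l (tail QA a) else 0)"
    by (auto simp: coef_inner_def)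
  \<comment> \<open>Conversely, the combination of vertices with coefficients \<open>l\<close>
    induces the derivation.\<close>
  let ?x = "rsz_elt QA l (\<lambda>a. 0)"
  have "der_of m = inner_der A ?x"
  proof (rule extensionalityI[of _ "carrier A"])
    fix X assume X: "X \<in> carrier A"
    have "(\<Sum>a\<in>arcs QA. acoef QA X a * m a b) = (\<Sum>a\<in>arcs QA. if a = b then
        acoef QA X a * (l (head QA a) - l (tail QA a)) else 0)" for b
      using l by (intro sum.cong) auto
    then show "der_of m X = inner_der A ?x X"
      unfolding inner_der_def using X
      by (intro rsz_eqI) (simp_all add: coef_der_of closed_simps coef_simps algebra_simps)
  qed (simp_all add: der_of_def inner_der_def)
  then show "D \<in> rel_Inn A B"
    using m(2) der_of_in_rel_Der[OF m(1)] by (auto simp: rel_Inn_def closed_simps)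
qed

definition hh_map :: "('b \<Rightarrow> 'b \<Rightarrow> 'k) \<Rightarrow> ((('v, 'b) path \<Rightarrow>\<^sub>0 'k) set \<Rightarrow> (('v, 'b) path \<Rightarrow>\<^sub>0 'k) set) set" where
  "hh_map = lie_coset (rel_Der_lie A B) (rel_Inn A B) \<circ> der_of"

lemma rel_Inn_ideal: "lie_alg_ideal (rel_Der_lie A B) (rel_Inn A B)"
  unfolding lie_alg_ideal_def lie_alg_ideal_axioms_def rel_Inn_eq
  using lie_algebra_epi[OF lie_algebra_coef der_of_epi] lie_ideal_image[OF der_of_epi coef_inner_ideal]
  by blast

lemma hh_map_epi: "lie_epi (coef_lie QA QB) (HH1 A B) hh_map"
  unfolding hh_map_def HH1_def
  by (rule lie_epi_comp[OF der_of_epi lie_alg_ideal.coset_epi[OF rel_Inn_ideal]])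

text \<open>Equality of cosets speaks about derivations; injectivity of \<open>der_of\<close> brings
  the condition back to matrices.\<close>

lemma hh_map_eq_iff:
  assumes m: "m \<in> coef_carrier QA QB" and n: "n \<in> coef_carrier QA QB"
  shows "hh_map m = hh_map n \<longleftrightarrow> (\<lambda>a b. m a b - n a b) \<in> coef_inner"
proof -
  let ?R = "rel_Der_lie A B"
  interpret L: lie_algebra "coef_lie QA QB :: ('k, _) lie" by (rule lie_algebra_coef)
  have hom: "der_of \<in> lie_hom (coef_lie QA QB) ?R"
    using der_of_epi by (simp add: lie_epi_def)
  have n': "(\<lambda>a b. - 1 * n a b) \<in> coef_carrier QA QB"
    using L.scale_closed[of n "-1"] n by simp
  have "hh_map m = hh_map n \<longleftrightarrow> lplus ?R (der_of m) (lscale ?R (-1) (der_of n)) \<in> der_of ` coef_inner"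
    unfolding hh_map_def comp_def rel_Inn_eq[symmetric]
    using m n by (intro lie_alg_ideal.coset_eq_iff[OF rel_Inn_ideal])
      (simp_all add: rel_Der_lie_def der_of_in_rel_Der)
  also have "lplus ?R (der_of m) (lscale ?R (-1) (der_of n)) = der_of (\<lambda>a b. m a b - n a b)"
    using lie_homD(3)[OF hom, of n "-1"] lie_homD(2)[OF hom, of m "\<lambda>a b. - 1 * n a b"] m n n'
    by simp
  also have "\<dots> \<in> der_of ` coef_inner \<longleftrightarrow> (\<lambda>a b. m a b - n a b) \<in> coef_inner"
  proof
    assume "der_of (\<lambda>a b. m a b - n a b) \<in> der_of ` coef_inner"
    then obtain k where k: "k \<in> coef_inner" "der_of (\<lambda>a b. m a b - n a b) = der_of k" by auto
    have "(\<lambda>a b. m a b - n a b) \<in> coef_carrier QA QB"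
      using L.plus_closed[of m "\<lambda>a b. - 1 * n a b"] m n' by simp
    then have "(\<lambda>a b. m a b - n a b) = k"
      using k by (intro der_of_inject) (auto simp: coef_inner_def)
    then show "(\<lambda>a b. m a b - n a b) \<in> coef_inner" using k by simp
  qed simp
  finally show ?thesis .
qed

end

section \<open>Parallel pairs in coordinates\<close>

definition coef_pair ::
    "('v, 'b) pre_digraph \<Rightarrow> ('b \<Rightarrow> 'b \<Rightarrow> 'k::field) \<Rightarrow> (('b \<times> ('v, 'b) path) \<Rightarrow>\<^sub>0 'k)" where
  "coef_pair Q m = (\<Sum>a\<in>arcs Q. \<Sum>b\<in>arcs Q. pscale (m a b) (pair a (arrow_path Q b)))"

lemma lookup_pair: "Poly_Mapping.lookup (pair a p) x = (if x = (a, p) then 1 else 0)"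
  by (auto simp: pair_def lookup_single when_def)

lemma pscale_simps [simp]: "pscale c 0 = 0" "pscale 1 f = f"
  by simp_all

lemma pscale_if: "pscale (if P then c else d) f = (if P then pscale c f else pscale d f)"
  by simp

lemma pair_lie_simps:
  "lcarrier (pair_lie V) = V" "lplus (pair_lie V) = (+)" "lzero (pair_lie V) = 0"
  "lscale (pair_lie V) = pscale" "lbracket (pair_lie V) = pair_bracket"
  by (simp_all add: pair_lie_def)

lemma pair_lin_single: "pair_lin b (Poly_Mapping.single q 1) = pair b q"
  by (simp add: pair_lin_def)

lemma pair_lin_0 [simp]: "pair_lin b 0 = 0"
  by (simp add: pair_lin_def)

text \<open>\<open>path_replace\<close> keeps the end points of the path in which it replaces; the
  result is a genuine arrow path only because \<open>a\<close> and \<open>c\<close> are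
  parallel.\<close>

lemma path_replace_arrow:
  assumes "arc_to_ends Q a = arc_to_ends Q c"
  shows "path_replace a (arrow_path Q c) (arrow_path Q d) =
    (if d = a then Poly_Mapping.single (arrow_path Q c) 1 else 0)"
proof -
  have "{i. i < length (parrows (arrow_path Q d)) \<and> parrows (arrow_path Q d) ! i = a} =
      (if d = a then {0} else {})"
    by auto
  then show ?thesis
    using assms unfolding path_replace_def
    by (simp add: Let_def) (simp add: arrow_path_def arc_to_ends_def)
qed

lemma pair_bracket_superset:
  assumes "finite F" "Poly_Mapping.keys x \<subseteq> F" "finite H" "Poly_Mapping.keys y \<subseteq> H"
  shows "pair_bracket x y = (\<Sum>(a, p)\<in>F. \<Sum>(b, q)\<in>H.
        pscale (Poly_Mapping.lookup x (a, p) * Poly_Mapping.lookup y (b, q))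
          (pair_lin b (path_replace a p q) - pair_lin a (path_replace b q p)))"
proof -
  have "pair_bracket x y = (\<Sum>(a, p)\<in>Poly_Mapping.keys x. \<Sum>(b, q)\<in>H.
        pscale (Poly_Mapping.lookup x (a, p) * Poly_Mapping.lookup y (b, q))
          (pair_lin b (path_replace a p q) - pair_lin a (path_replace b q p)))"
    unfolding pair_bracket_def case_prod_beta
    by (intro sum.cong refl sum.mono_neutral_left)
      (use assms in \<open>auto simp: in_keys_iff\<close>)
  also have "\<dots> = (\<Sum>(a, p)\<in>F. \<Sum>(b, q)\<in>H.
        pscale (Poly_Mapping.lookup x (a, p) * Poly_Mapping.lookup y (b, q))
          (pair_lin b (path_replace a p q) - pair_lin a (path_replace b q p)))"
    unfolding case_prod_beta
    by (intro sum.mono_neutral_left)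
      (use assms in \<open>auto simp: in_keys_iff intro!: sum.neutral\<close>)
  finally show ?thesis .
qed

context fin_digraph
begin

lemma lookup_coef_pair:
  "Poly_Mapping.lookup (coef_pair G m) (a, p) =
    (\<Sum>b\<in>arcs G. if a \<in> arcs G \<and> p = arrow_path G b then m a b else 0)"
proof -
  have "Poly_Mapping.lookup (coef_pair G m) (a, p) =
      (\<Sum>x\<in>arcs G. if x = a then \<Sum>b\<in>arcs G. if p = arrow_path G b then m a b else 0 else 0)"
    unfolding coef_pair_def lookup_sum by (intro sum.cong) (auto simp: lookup_pair intro!: sum.cong)
  then show ?thesis by (cases "a \<in> arcs G") simp_all
qed

lemma lookup_coef_pair_arrow [simp]:
  "Poly_Mapping.lookup (coef_pair G m) (a, arrow_path G b) = (if a \<in> arcs G \<and> b \<in> arcs G then m a b else 0)"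
  unfolding lookup_coef_pair by (cases "a \<in> arcs G") (auto intro: sum.neutral)

lemma coef_pair_cong:
  "(\<And>a b. \<lbrakk>a \<in> arcs G; b \<in> arcs G\<rbrakk> \<Longrightarrow> m a b = n a b) \<Longrightarrow> coef_pair G m = coef_pair G n"
  unfolding coef_pair_def by (intro sum.cong) auto

lemma coef_pair_eqD:
  "\<lbrakk>coef_pair G m = coef_pair G n; a \<in> arcs G; b \<in> arcs G\<rbrakk> \<Longrightarrow> m a b = n a b"
  by (metis lookup_coef_pair_arrow)

lemma coef_pair_add: "coef_pair G (\<lambda>a b. m a b + n a b) = coef_pair G m + coef_pair G n"
  by (simp add: coef_pair_def free.scale_left_distrib sum.distrib)

lemma coef_pair_diff: "coef_pair G (\<lambda>a b. m a b - n a b) = coef_pair G m - coef_pair G n"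
  by (simp add: coef_pair_def free.scale_left_diff_distrib sum_subtractf)

lemma coef_pair_scale: "coef_pair G (\<lambda>a b. c * m a b) = pscale c (coef_pair G m)"
  by (simp add: coef_pair_def free.scale_sum_right)

lemma coef_pair_0 [simp]: "coef_pair G (\<lambda>a b. 0) = 0"
  by (simp add: coef_pair_def)

lemma coef_pair_sum: "coef_pair G (\<lambda>a b. \<Sum>i\<in>I. m i a b) = (\<Sum>i\<in>I. coef_pair G (m i))"
  by (induction I rule: infinite_finite_induct) (simp_all add: coef_pair_add)

lemma keys_coef_pair:
  "Poly_Mapping.keys (coef_pair G m) \<subseteq> (\<lambda>(a, b). (a, arrow_path G b)) ` (arcs G \<times> arcs G)"
proof (rule subsetI, rule ccontr)
  fix z assume z: "z \<in> Poly_Mapping.keys (coef_pair G m)"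
    "z \<notin> (\<lambda>(a, b). (a, arrow_path G b)) ` (arcs G \<times> arcs G)"
  obtain a p where ap: "z = (a, p)" by (cases z)
  have "Poly_Mapping.lookup (coef_pair G m) z = 0"
    unfolding ap lookup_coef_pair using z(2) by (intro sum.neutral) (auto simp: ap)
  then show False using z(1) by (simp add: in_keys_iff)
qed

text \<open>For parallel pairs, [a//c, b//d] is b//c if d = a, minus a//d if c = b. Summing with
  coefficients contracts the repeated arrow and leaves the two matrix products of the
  commutator.\<close>

lemma pair_bracket_coef_pair:
  assumes m: "\<And>a b. \<lbrakk>a \<in> arcs G; b \<in> arcs G; m a b \<noteq> 0\<rbrakk> \<Longrightarrow> arc_to_ends G a = arc_to_ends G b"
    and n: "\<And>a b. \<lbrakk>a \<in> arcs G; b \<in> arcs G; n a b \<noteq> 0\<rbrakk> \<Longrightarrow> arc_to_ends G a = arc_to_ends G b"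
  shows "pair_bracket (coef_pair G m) (coef_pair G n) = coef_pair G (coef_bracket G m n)"
proof -
  let ?A = "arcs G" and ?P = "\<lambda>a b. pair a (arrow_path G b)"
  let ?F = "(\<lambda>(a, b). (a, arrow_path G b)) ` (?A \<times> ?A)"
  have inj: "inj_on (\<lambda>(a, b). (a, arrow_path G b)) (?A \<times> ?A)"
    by (auto simp: inj_on_def)
  have re: "(\<Sum>(a, p)\<in>?F. f a p) = (\<Sum>a\<in>?A. \<Sum>b\<in>?A. f a (arrow_path G b))"
    for f :: "'b \<Rightarrow> ('a, 'b) path \<Rightarrow> 'b \<times> ('a, 'b) path \<Rightarrow>\<^sub>0 'c"
    by (subst sum.reindex[OF inj]) (simp add: sum.cartesian_product case_prod_beta)
  have "pair_bracket (coef_pair G m) (coef_pair G n) = (\<Sum>(a, p)\<in>?F. \<Sum>(b, q)\<in>?F.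
        pscale (Poly_Mapping.lookup (coef_pair G m) (a, p) * Poly_Mapping.lookup (coef_pair G n) (b, q))
          (pair_lin b (path_replace a p q) - pair_lin a (path_replace b q p)))"
    by (intro pair_bracket_superset keys_coef_pair finite_imageI finite_cartesian_product finite_arcs)
  also have "\<dots> = (\<Sum>a\<in>?A. \<Sum>c\<in>?A. \<Sum>b\<in>?A. \<Sum>d\<in>?A. pscale (m a c * n b d)
          (pair_lin b (path_replace a (arrow_path G c) (arrow_path G d))
            - pair_lin a (path_replace b (arrow_path G d) (arrow_path G c))))"
    unfolding re by (intro sum.cong refl) simp
  also have "\<dots> = (\<Sum>a\<in>?A. \<Sum>c\<in>?A. \<Sum>b\<in>?A. \<Sum>d\<in>?A.
        (if d = a then pscale (m a c * n b d) (?P b c) else 0) -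
        (if c = b then pscale (m a c * n b d) (?P a d) else 0))"
  proof (intro sum.cong refl)
    fix a b c d assume "a \<in> ?A" "c \<in> ?A" "b \<in> ?A" "d \<in> ?A"
    then show "pscale (m a c * n b d)
          (pair_lin b (path_replace a (arrow_path G c) (arrow_path G d))
            - pair_lin a (path_replace b (arrow_path G d) (arrow_path G c))) =
        (if d = a then pscale (m a c * n b d) (?P b c) else 0) -
        (if c = b then pscale (m a c * n b d) (?P a d) else 0)"
      \<comment> \<open>The replacement formula is available for parallel arrows only; all other
        pairs have coefficient zero.\<close>
      using m[of a c] n[of b d]
      by (cases "m a c = 0"; cases "n b d = 0")
        (auto simp: path_replace_arrow pair_lin_single free.scale_right_diff_distrib)
  qed
  also have "\<dots> = (\<Sum>a\<in>?A. \<Sum>c\<in>?A. \<Sum>b\<in>?A. \<Sum>d\<in>?A.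
        if d = a then pscale (m a c * n b d) (?P b c) else 0) -
      (\<Sum>a\<in>?A. \<Sum>c\<in>?A. \<Sum>b\<in>?A. \<Sum>d\<in>?A. if c = b then pscale (m a c * n b d) (?P a d) else 0)"
    by (simp only: sum_subtractf)
  also have "(\<Sum>a\<in>?A. \<Sum>c\<in>?A. \<Sum>b\<in>?A. \<Sum>d\<in>?A.
        if d = a then pscale (m a c * n b d) (?P b c) else 0)
      = (\<Sum>a\<in>?A. \<Sum>c\<in>?A. \<Sum>b\<in>?A. pscale (m a c * n b a) (?P b c))"
    by simp
  also have "\<dots> = (\<Sum>a\<in>?A. \<Sum>b\<in>?A. \<Sum>c\<in>?A. pscale (m a c * n b a) (?P b c))"
    by (intro sum.cong refl sum.swap)
  also have "\<dots> = (\<Sum>b\<in>?A. \<Sum>a\<in>?A. \<Sum>c\<in>?A. pscale (m a c * n b a) (?P b c))"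
    by (rule sum.swap)
  also have "\<dots> = (\<Sum>b\<in>?A. \<Sum>c\<in>?A. \<Sum>a\<in>?A. pscale (m a c * n b a) (?P b c))"
    by (intro sum.cong refl sum.swap)
  also have "\<dots> = coef_pair G (\<lambda>b c. \<Sum>a\<in>?A. n b a * m a c)"
    by (simp add: coef_pair_def free.scale_sum_left mult.commute)
  also have "(\<Sum>a\<in>?A. \<Sum>c\<in>?A. \<Sum>b\<in>?A. \<Sum>d\<in>?A. if c = b then pscale (m a c * n b d) (?P a d) else 0)
      = (\<Sum>a\<in>?A. \<Sum>c\<in>?A. \<Sum>d\<in>?A. \<Sum>b\<in>?A. if c = b then pscale (m a c * n b d) (?P a d) else 0)"
    by (intro sum.cong refl sum.swap)
  also have "\<dots> = (\<Sum>a\<in>?A. \<Sum>c\<in>?A. \<Sum>d\<in>?A. pscale (m a c * n c d) (?P a d))"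
    by simp
  also have "\<dots> = (\<Sum>a\<in>?A. \<Sum>d\<in>?A. \<Sum>c\<in>?A. pscale (m a c * n c d) (?P a d))"
    by (intro sum.cong refl sum.swap)
  also have "\<dots> = coef_pair G (\<lambda>a d. \<Sum>c\<in>?A. m a c * n c d)"
    by (simp add: coef_pair_def free.scale_sum_left)
  finally show ?thesis
    by (simp add: coef_pair_diff[symmetric] coef_bracket_def[abs_def] sum_subtractf)
qed

end

section \<open>The pieces of the decomposition\<close>

context rsz_pair
begin

section \<open>Parallel classes of the complementary quiver\<close>

definition arrow_class :: "'b \<Rightarrow> 'b set" where
  "arrow_class a = {b \<in> arcs QA - arcs QB. arc_to_ends QA a = arc_to_ends QA b}"

definition C_classes :: "'b set set" where
  "C_classes = parallel_classes (complement_quiver QA QB)"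

lemma classes_eq: "C_classes = arrow_class ` (arcs QA - arcs QB)"
proof -
  have "arc_to_ends (complement_quiver QA QB) = arc_to_ends QA"
    by (simp add: fun_eq_iff arc_to_ends_def complement_quiver_def)
  then show ?thesis
    by (auto simp: C_classes_def parallel_classes_def quotient_def complement_quiver_def arrow_class_def)
qed

lemma finite_classes: "finite C_classes"
  by (simp add: classes_eq)

lemma class_mem:
  assumes "\<alpha> \<in> C_classes" "a \<in> \<alpha>"
  shows "a \<in> arcs QA" "a \<notin> arcs QB" "arrow_class a = \<alpha>"
    and "b \<in> \<alpha> \<longleftrightarrow> b \<in> arcs QA \<and> b \<notin> arcs QB \<and> arc_to_ends QA a = arc_to_ends QA b"
  using assms by (auto simp: classes_eq arrow_class_def)

lemma arrow_class_mem: "\<lbrakk>a \<in> arcs QA; a \<notin> arcs QB\<rbrakk> \<Longrightarrow> a \<in> arrow_class a \<and> arrow_class a \<in> C_classes"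
  by (auto simp: classes_eq arrow_class_def)

lemma class_subset: "\<alpha> \<in> C_classes \<Longrightarrow> \<alpha> \<subseteq> arcs QA - arcs QB"
  using class_mem by blast

lemma finite_class: "\<alpha> \<in> C_classes \<Longrightarrow> finite \<alpha>"
  using class_subset finite_subset[OF _ finite_arcs] by blast

lemma card_class: "\<alpha> \<in> C_classes \<Longrightarrow> card \<alpha> > 0"
  using finite_class arrow_class_mem by (auto simp: classes_eq card_gt_0_iff)

lemma classes_S_sub: "classes_S QA QB \<subseteq> C_classes"
  and classes_D_sub: "classes_D QA QB \<subseteq> C_classes"
  and classes_E_sub: "classes_E QA QB \<subseteq> C_classes"
  by (auto simp: C_classes_def classes_S_def classes_D_def classes_E_def)

lemma classes_E_iff:
  "\<alpha> \<in> classes_E QA QB \<longleftrightarrow> \<alpha> \<in> C_classes \<and> (\<exists>a\<in>\<alpha>. \<exists>b\<in>arcs QB. arc_to_ends QA a = arc_to_ends QA b)"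
  by (auto simp: C_classes_def classes_E_def classes_D_def)

text \<open>An arrow outside \<open>QB\<close> lies in exactly one class, so at most one summand
  survives.\<close>

lemma sum_over_classes:
  assumes "J \<subseteq> C_classes" "a \<in> arcs QA" "a \<notin> arcs QB"
  shows "(\<Sum>\<alpha>\<in>J. if a \<in> \<alpha> then f \<alpha> else 0) = (if arrow_class a \<in> J then f (arrow_class a) else 0)"
proof -
  have "(\<Sum>\<alpha>\<in>J. if a \<in> \<alpha> then f \<alpha> else 0) = (\<Sum>\<alpha>\<in>J. if \<alpha> = arrow_class a then f \<alpha> else 0)"
    using assms arrow_class_mem class_mem(3) by (intro sum.cong refl if_cong) auto
  then show ?thesis
    using finite_subset[OF assms(1) finite_classes] by simp
qed

text \<open>The normalised trace: it is 1 on the identity block, so subtracting it from the diagonal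
  leaves a traceless block. The division is legitimate because classes are nonempty and the
  characteristic is zero.\<close>

definition tr :: "('b \<Rightarrow> 'b \<Rightarrow> 'k) \<Rightarrow> 'b set \<Rightarrow> 'k" where
  "tr m \<alpha> = (\<Sum>a\<in>\<alpha>. m a a) / of_nat (card \<alpha>)"

definition id_coef :: "'b set \<Rightarrow> 'b \<Rightarrow> 'b \<Rightarrow> 'k" where
  "id_coef \<alpha> a b = (if a = b \<and> a \<in> \<alpha> then 1 else 0)"

definition B_part :: "('b \<Rightarrow> 'b \<Rightarrow> 'k) \<Rightarrow> 'b set \<Rightarrow> 'b \<Rightarrow> 'b \<Rightarrow> 'k" where
  "B_part m \<alpha> a b = (if a \<in> \<alpha> \<and> b \<in> arcs QB then m a b else 0)"

lemma tr_linear: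
  "tr (\<lambda>a b. m a b + n a b) \<alpha> = tr m \<alpha> + tr n \<alpha>"
  "tr (\<lambda>a b. c * m a b) \<alpha> = c * tr m \<alpha>"
  "tr (\<lambda>a b. m a b - n a b) \<alpha> = tr m \<alpha> - tr n \<alpha>"
  "tr (\<lambda>a b. 0) \<alpha> = 0"
  by (simp_all add: tr_def sum.distrib sum_subtractf sum_distrib_left[symmetric] add_divide_distrib
      diff_divide_distrib)

lemma tr_const:
  assumes "\<alpha> \<in> C_classes" "\<And>a. a \<in> \<alpha> \<Longrightarrow> m a a = c"
  shows "tr m \<alpha> = c"
  using assms card_class[OF assms(1)] by (simp add: tr_def)

text \<open>An intermediate arrow must be parallel to \<open>a\<close>, hence lies in \<alpha> or in
  \<open>QB\<close>; in the second case its row is zero. The matrices are thus block triangular, and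
  no other class interferes.\<close>

lemma coef_bracket_class:
  assumes "m \<in> coef_carrier QA QB" "n \<in> coef_carrier QA QB" "\<alpha> \<in> C_classes" "a \<in> \<alpha>"
  shows "coef_bracket QA m n a b = (\<Sum>c\<in>\<alpha>. n a c * m c b - m a c * n c b)"
  unfolding coef_bracket_def
proof (rule sum.mono_neutral_right)
  show "\<forall>c\<in>arcs QA - \<alpha>. n a c * m c b - m a c * n c b = 0"
  proof
    fix c assume c: "c \<in> arcs QA - \<alpha>"
    then have "c \<in> arcs QB \<or> arc_to_ends QA a \<noteq> arc_to_ends QA c"
      using class_mem(4)[OF assms(3,4)] by blast
    then show "n a c * m c b - m a c * n c b = 0"
      using coef_carrier_0[OF assms(1), of c b] coef_carrier_0[OF assms(1), of a c]
        coef_carrier_0[OF assms(2), of c b] coef_carrier_0[OF assms(2), of a c] by auto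
  qed
qed (use class_subset[OF assms(3)] in auto)

lemma tr_bracket:
  assumes "m \<in> coef_carrier QA QB" "n \<in> coef_carrier QA QB" "\<alpha> \<in> C_classes"
  shows "tr (coef_bracket QA m n) \<alpha> = 0"
proof -
  have "(\<Sum>a\<in>\<alpha>. coef_bracket QA m n a a) = (\<Sum>a\<in>\<alpha>. \<Sum>c\<in>\<alpha>. n a c * m c a - m a c * n c a)"
    using assms by (intro sum.cong refl coef_bracket_class)
  also have "\<dots> = (\<Sum>a\<in>\<alpha>. \<Sum>c\<in>\<alpha>. n a c * m c a) - (\<Sum>a\<in>\<alpha>. \<Sum>c\<in>\<alpha>. m a c * n c a)"
    by (simp add: sum_subtractf)
  also have "(\<Sum>a\<in>\<alpha>. \<Sum>c\<in>\<alpha>. m a c * n c a) = (\<Sum>a\<in>\<alpha>. \<Sum>c\<in>\<alpha>. n a c * m c a)"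
    by (subst sum.swap) (simp add: mult.commute)
  finally show ?thesis by (simp add: tr_def)
qed

lemma I_elt_eq:
  assumes "\<alpha> \<in> C_classes"
  shows "I_elt QA \<alpha> = coef_pair QA (id_coef \<alpha>)"
proof -
  have "coef_pair QA (id_coef \<alpha>) = (\<Sum>a\<in>arcs QA. if a \<in> \<alpha> then pair a (arrow_path QA a) else 0)"
    unfolding coef_pair_def
  proof (intro sum.cong refl)
    fix a assume "a \<in> arcs QA"
    have "(\<Sum>b\<in>arcs QA. pscale (id_coef \<alpha> a b) (pair a (arrow_path QA b)))
      = (\<Sum>b\<in>arcs QA. if b = a then if a \<in> \<alpha> then pair a (arrow_path QA b) else 0 else 0)"
      by (intro sum.cong) (auto simp: id_coef_def)
    then show "(\<Sum>b\<in>arcs QA. pscale (id_coef \<alpha> a b) (pair a (arrow_path QA b)))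
      = (if a \<in> \<alpha> then pair a (arrow_path QA a) else 0)"
      using \<open>a \<in> arcs QA\<close> by simp
  qed
  also have "\<dots> = I_elt QA \<alpha>"
    unfolding I_elt_def using class_subset[OF assms]
    by (intro sum.mono_neutral_cong_right) auto
  finally show ?thesis ..
qed

lemma kI_eq: "kI QA \<alpha> = range (\<lambda>c. pscale c (I_elt QA \<alpha>))"
  unfolding kI_def by (rule free.span_singleton)

text \<open>Replaces the span by matrices supported in one block, so that elements of
  \<open>frakI\<close> can be handled with \<open>coef_pair\<close> and
  \<open>coef_bracket\<close>.\<close>

lemma frakI_eq:
  assumes "\<alpha> \<in> C_classes"
  shows "frakI QA QB \<alpha> = {coef_pair QA n | n.
    \<forall>a b. n a b \<noteq> (0 :: 'k) \<longrightarrow> a \<in> \<alpha> \<and> b \<in> arcs QB \<and> arc_to_ends QA a = arc_to_ends QA b}"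
    (is "_ = ?V")
proof
  show "frakI QA QB \<alpha> \<subseteq> ?V"
    unfolding frakI_def
  proof (rule free.span_minimal)
    show "free.subspace ?V"
    proof (rule free.subspaceI)
      show "0 \<in> ?V" by (auto intro!: exI[of _ "\<lambda>a b. 0"])
      fix x y c assume "x \<in> ?V"
      then obtain n where n: "x = coef_pair QA n"
        "\<forall>a b. n a b \<noteq> 0 \<longrightarrow> a \<in> \<alpha> \<and> b \<in> arcs QB \<and> arc_to_ends QA a = arc_to_ends QA b" by blast
      show "pscale c x \<in> ?V"
        unfolding n coef_pair_scale[symmetric] using n(2) by fastforce
      assume "y \<in> ?V"
      then obtain n' where n': "y = coef_pair QA n'"
        "\<forall>a b. n' a b \<noteq> 0 \<longrightarrow> a \<in> \<alpha> \<and> b \<in> arcs QB \<and> arc_to_ends QA a = arc_to_ends QA b" by blast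
      have "n a b + n' a b \<noteq> 0 \<longrightarrow> a \<in> \<alpha> \<and> b \<in> arcs QB \<and> arc_to_ends QA a = arc_to_ends QA b" for a b
        using n(2)[rule_format, of a b] n'(2)[rule_format, of a b] by (cases "n a b = 0") auto
      then show "x + y \<in> ?V"
        unfolding n(1) n'(1) coef_pair_add[symmetric] by blast
    qed
    show "{pair a (arrow_path QA b) |a b. a \<in> \<alpha> \<and> b \<in> arcs QB \<and> arc_to_ends QA a = arc_to_ends QA b} \<subseteq> ?V"
    proof clarify
      fix a b assume ab: "a \<in> \<alpha>" "b \<in> arcs QB" "arc_to_ends QA a = arc_to_ends QA b"
      have "a \<in> arcs QA" "b \<in> arcs QA" using ab class_subset[OF assms] arcs_QB by auto
      have "coef_pair QA (\<lambda>x y. if x = a \<and> y = b then (1 :: 'k) else 0)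
         = (\<Sum>x\<in>arcs QA. if x = a then \<Sum>y\<in>arcs QA. if y = b then pair x (arrow_path QA y) else 0 else 0)"
        unfolding coef_pair_def by (intro sum.cong refl) (simp add: pscale_if cong: if_cong)
      also have "\<dots> = pair a (arrow_path QA b)"
        using \<open>a \<in> arcs QA\<close> \<open>b \<in> arcs QA\<close> by simp
      finally show "\<exists>n. pair a (arrow_path QA b) = coef_pair QA n \<and>
          (\<forall>a b. n a b \<noteq> (0 :: 'k) \<longrightarrow> a \<in> \<alpha> \<and> b \<in> arcs QB \<and> arc_to_ends QA a = arc_to_ends QA b)"
        using ab by (intro exI[of _ "\<lambda>x y. if x = a \<and> y = b then 1 else 0"]) auto
    qed
  qed
  show "?V \<subseteq> frakI QA QB \<alpha>"
  proof clarify
    fix n assume n: "\<forall>a b. n a b \<noteq> (0 :: 'k) \<longrightarrow> a \<in> \<alpha> \<and> b \<in> arcs QB \<and> arc_to_ends QA a = arc_to_ends QA b"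
    show "coef_pair QA n \<in> frakI QA QB \<alpha>"
      unfolding coef_pair_def frakI_def
    proof (intro free.span_sum)
      fix a b
      show "pscale (n a b) (pair a (arrow_path QA b)) \<in> free.span {pair a (arrow_path QA b) |a b.
          a \<in> \<alpha> \<and> b \<in> arcs QB \<and> arc_to_ends QA a = arc_to_ends QA b}"
      proof (cases "n a b = 0")
        case False
        then show ?thesis using n by (intro free.span_scale free.span_base) blast
      qed (simp add: free.span_zero)
    qed
  qed
qed

lemma B_part_frakI:
  assumes "m \<in> coef_carrier QA QB" "\<alpha> \<in> C_classes"
  shows "coef_pair QA (B_part m \<alpha>) \<in> frakI QA QB \<alpha>"
  unfolding frakI_eq[OF assms(2)] using assms(1)
  by (auto simp: B_part_def coef_carrier_def split: if_splits)

lemma B_part_linear: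
  "B_part (\<lambda>a b. m a b + n a b) \<alpha> = (\<lambda>a b. B_part m \<alpha> a b + B_part n \<alpha> a b)"
  "B_part (\<lambda>a b. c * m a b) \<alpha> = (\<lambda>a b. c * B_part m \<alpha> a b)"
  "B_part (\<lambda>a b. 0) \<alpha> = (\<lambda>a b. 0)"
  by (auto simp: B_part_def fun_eq_iff)

text \<open>The traceless part of the block of \<alpha>, transposed: column \<open>i\<close> holds
  the image of the arrow number \<open>i\<close>, as in \<open>mat_elt\<close>. With this convention
  the commutator keeps its sign.\<close>

definition smat :: "('b \<Rightarrow> 'b \<Rightarrow> 'k) \<Rightarrow> 'b set \<Rightarrow> 'k mat" where
  "smat m \<alpha> = mat (card \<alpha>) (card \<alpha>) (\<lambda>(j, i). m (class_enum \<alpha> i) (class_enum \<alpha> j)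
     - (if i = j then tr m \<alpha> else 0))"

lemma class_enum_bij: "\<alpha> \<in> C_classes \<Longrightarrow> bij_betw (class_enum \<alpha>) {..<card \<alpha>} \<alpha>"
  unfolding class_enum_def using finite_class ex_bij_betw_nat_finite[of \<alpha>]
  by (intro someI_ex[of "\<lambda>f. bij_betw f {..<card \<alpha>} \<alpha>"]) (auto simp: atLeast0LessThan)

lemma sum_class_enum:
  "\<alpha> \<in> C_classes \<Longrightarrow> (\<Sum>i<card \<alpha>. f (class_enum \<alpha> i)) = (\<Sum>a\<in>\<alpha>. f a)"
  by (rule sum.reindex_bij_betw[OF class_enum_bij])

lemma class_enum_mem: "\<lbrakk>\<alpha> \<in> C_classes; i < card \<alpha>\<rbrakk> \<Longrightarrow> class_enum \<alpha> i \<in> \<alpha>"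
  using class_enum_bij by (auto simp: bij_betw_def)

lemma class_enum_inject:
  "\<lbrakk>\<alpha> \<in> C_classes; i < card \<alpha>; j < card \<alpha>\<rbrakk> \<Longrightarrow> class_enum \<alpha> i = class_enum \<alpha> j \<longleftrightarrow> i = j"
  using class_enum_bij[of \<alpha>] by (auto simp: bij_betw_def inj_on_def)

lemma smat_closed:
  assumes "\<alpha> \<in> C_classes"
  shows "smat m \<alpha> \<in> lcarrier (sl (card \<alpha>))"
proof -
  have "(\<Sum>i<card \<alpha>. smat m \<alpha> $$ (i, i)) = (\<Sum>i<card \<alpha>. m (class_enum \<alpha> i) (class_enum \<alpha> i) - tr m \<alpha>)"
    by (intro sum.cong) (auto simp: smat_def)
  also have "\<dots> = 0"
    unfolding sum_class_enum[OF assms, of "\<lambda>a. m a a - tr m \<alpha>"]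
    using card_class[OF assms] by (simp add: sum_subtractf tr_def)
  finally show ?thesis by (simp add: sl_def) (simp add: smat_def)
qed

lemma smat_linear:
  "smat (\<lambda>a b. m a b + n a b) \<alpha> = smat m \<alpha> + smat n \<alpha>"
  "smat (\<lambda>a b. c * m a b) \<alpha> = c \<cdot>\<^sub>m smat m \<alpha>"
  "smat (\<lambda>a b. 0) \<alpha> = 0\<^sub>m (card \<alpha>) (card \<alpha>)"
  by (auto intro!: eq_matI simp: smat_def tr_linear algebra_simps)

text \<open>Removing scalars does not change a commutator, and a commutator has trace zero, so
  nothing is removed from it.\<close>

lemma smat_bracket:
  assumes m: "m \<in> coef_carrier QA QB" and n: "n \<in> coef_carrier QA QB" and \<alpha>: "\<alpha> \<in> C_classes"
  shows "smat (coef_bracket QA m n) \<alpha> = smat m \<alpha> * smat n \<alpha> - smat n \<alpha> * smat m \<alpha>"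
proof (rule eq_matI)
  fix j i assume "j < dim_row (smat m \<alpha> * smat n \<alpha> - smat n \<alpha> * smat m \<alpha>)"
    "i < dim_col (smat m \<alpha> * smat n \<alpha> - smat n \<alpha> * smat m \<alpha>)"
  then have ji: "j < card \<alpha>" "i < card \<alpha>" by (simp_all add: smat_def)
  let ?e = "class_enum \<alpha>" and ?t = "tr m \<alpha>" and ?s = "tr n \<alpha>"
  have "(smat m \<alpha> * smat n \<alpha> - smat n \<alpha> * smat m \<alpha>) $$ (j, i) =
      (\<Sum>l<card \<alpha>. (m (?e l) (?e j) - (if l = j then ?t else 0)) * (n (?e i) (?e l) - (if i = l then ?s else 0)))
    - (\<Sum>l<card \<alpha>. (n (?e l) (?e j) - (if l = j then ?s else 0)) * (m (?e i) (?e l) - (if i = l then ?t else 0)))"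
    using ji by (simp add: smat_def scalar_prod_def atLeast0LessThan)
  \<comment> \<open>The products of the two traces cancel at once. The mixed terms are concentrated
    at l = j and at l = i, where they take opposite values.\<close>
  also have "\<dots> = (\<Sum>l<card \<alpha>. (n (?e i) (?e l) * m (?e l) (?e j) - m (?e i) (?e l) * n (?e l) (?e j))
      + ((if l = j then ?s * m (?e i) (?e l) - ?t * n (?e i) (?e l) else 0)
      + (if l = i then ?t * n (?e l) (?e j) - ?s * m (?e l) (?e j) else 0)))"
    unfolding sum_subtractf[symmetric] by (intro sum.cong) (auto simp: algebra_simps)
  also have "\<dots> = (\<Sum>l<card \<alpha>. n (?e i) (?e l) * m (?e l) (?e j) - m (?e i) (?e l) * n (?e l) (?e j))"
    using ji by (simp add: sum.distrib)
  also have "\<dots> = coef_bracket QA m n (?e i) (?e j)"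
    using sum_class_enum[OF \<alpha>, of "\<lambda>c. n (?e i) c * m c (?e j) - m (?e i) c * n c (?e j)"]
      coef_bracket_class[OF m n \<alpha> class_enum_mem[OF \<alpha> ji(2)]] by simp
  finally show "smat (coef_bracket QA m n) \<alpha> $$ (j, i)
      = (smat m \<alpha> * smat n \<alpha> - smat n \<alpha> * smat m \<alpha>) $$ (j, i)"
    using ji by (simp add: smat_def tr_bracket[OF m n \<alpha>])
qed (simp_all add: smat_def)

definition idx :: "'b set \<Rightarrow> 'b \<Rightarrow> nat" where
  "idx \<alpha> = inv_into {..<card \<alpha>} (class_enum \<alpha>)"

lemma idx:
  assumes "\<alpha> \<in> C_classes"
  shows "a \<in> \<alpha> \<Longrightarrow> idx \<alpha> a < card \<alpha>" "a \<in> \<alpha> \<Longrightarrow> class_enum \<alpha> (idx \<alpha> a) = a"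
    "i < card \<alpha> \<Longrightarrow> idx \<alpha> (class_enum \<alpha> i) = i"
  using class_enum_bij[OF assms] inv_into_into[of a "class_enum \<alpha>" "{..<card \<alpha>}"]
    f_inv_into_f[of a "class_enum \<alpha>" "{..<card \<alpha>}"]
  by (auto simp: idx_def bij_betw_def)

text \<open>Rewrites the enumeration of the class as a sum over arrows, which makes the bracket
  formula for \<open>coef_pair\<close> applicable to the action of \<open>sl\<close>.\<close>

lemma mat_elt_eq:
  assumes \<alpha>: "\<alpha> \<in> C_classes"
  shows "mat_elt QA \<alpha> X = coef_pair QA
    (\<lambda>a b. if a \<in> \<alpha> \<and> b \<in> \<alpha> then X $$ (idx \<alpha> b, idx \<alpha> a) else (0 :: 'k))"
proof -
  have "mat_elt QA \<alpha> X = (\<Sum>i<card \<alpha>. \<Sum>j<card \<alpha>. pscale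
      (X $$ (idx \<alpha> (class_enum \<alpha> j), idx \<alpha> (class_enum \<alpha> i)))
      (pair (class_enum \<alpha> i) (arrow_path QA (class_enum \<alpha> j))))"
    unfolding mat_elt_def by (intro sum.cong refl) (simp add: idx[OF \<alpha>])
  also have "\<dots> = (\<Sum>a\<in>\<alpha>. \<Sum>b\<in>\<alpha>. pscale (X $$ (idx \<alpha> b, idx \<alpha> a)) (pair a (arrow_path QA b)))"
    by (simp add: sum_class_enum[OF \<alpha>, of "\<lambda>b. pscale (X $$ (idx \<alpha> b, idx \<alpha> _)) (pair _ (arrow_path QA b))"]
      sum_class_enum[OF \<alpha>, of "\<lambda>a. \<Sum>b\<in>\<alpha>. pscale (X $$ (idx \<alpha> b, idx \<alpha> a)) (pair a (arrow_path QA b))"])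
  also have "\<dots> = coef_pair QA (\<lambda>a b. if a \<in> \<alpha> \<and> b \<in> \<alpha> then X $$ (idx \<alpha> b, idx \<alpha> a) else 0)"
    unfolding coef_pair_def using class_subset[OF \<alpha>]
    by (intro sum.mono_neutral_cong_left) (auto intro!: sum.mono_neutral_cong_left sum.neutral)
  finally show ?thesis .
qed

end

section \<open>The image of \<open>\<delta>\<^sup>0\<close> and the abelian factor\<close>

context rsz_pair
begin

definition diag :: "('b \<Rightarrow> 'k) \<Rightarrow> 'b \<Rightarrow> 'b \<Rightarrow> 'k" where
  "diag d a b = (if a = b then d a else 0)"

definition grad :: "('v \<Rightarrow> 'k) \<Rightarrow> 'b \<Rightarrow> 'k" where
  "grad l a = l (head QA a) - l (tail QA a)"

lemma coef_inner_iff: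
  "m \<in> coef_inner \<longleftrightarrow> m \<in> coef_carrier QA QB \<and> (\<exists>l. \<forall>a\<in>arcs QA. \<forall>b. m a b = diag (grad l) a b)"
  by (simp add: coef_inner_def diag_def grad_def)

lemma coef_pair_diag:
  "coef_pair QA (diag d) = (\<Sum>a\<in>arcs QA. pscale (d a) (pair a (arrow_path QA a)))"
  unfolding coef_pair_def by (intro sum.cong refl) (simp add: diag_def pscale_if cong: if_cong)

text \<open>The potential is minus the indicator of \<open>e\<close> because \<open>delta0\<close>
  counts outgoing arrows positively while \<open>grad\<close> subtracts the value at the
  tail.\<close>

lemma delta0_vertex:
  "delta0 QA e (vertex_path e) = coef_pair QA (diag (grad (\<lambda>v. if v = e then -1 else 0)))"
proof -
  have 1: "path_comp (arrow_path QA a) (vertex_path (tail QA a)) = arrow_path QA a" for a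
    by (simp add: path_eq_iff)
  have 2: "path_comp (vertex_path (head QA a)) (arrow_path QA a) = arrow_path QA a" for a
    by (simp add: path_eq_iff)
  have nz: "arrow_path QA a \<in> nz_paths QA" if "a \<in> arcs QA" for a
    using that by (simp add: nz_paths_def)
  have "delta0 QA e (vertex_path e) =
      (\<Sum>a\<in>{a \<in> arcs QA. tail QA a = e}. pair a (arrow_path QA a)) -
      (\<Sum>a\<in>{a \<in> arcs QA. head QA a = e}. pair a (arrow_path QA a))"
    unfolding delta0_def
    by (intro arg_cong2[where f = minus] sum.cong) (auto simp: 1 2 nz)
  also have "\<dots> = (\<Sum>a\<in>arcs QA. if tail QA a = e then pair a (arrow_path QA a) else 0) -
      (\<Sum>a\<in>arcs QA. if head QA a = e then pair a (arrow_path QA a) else 0)"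
    by (simp add: sum.inter_filter)
  also have "\<dots> = (\<Sum>a\<in>arcs QA. pscale (grad (\<lambda>v. if v = e then -1 else 0) a) (pair a (arrow_path QA a)))"
    unfolding sum_subtractf[symmetric] by (intro sum.cong) (auto simp: grad_def)
  finally show ?thesis by (simp add: coef_pair_diag)
qed

text \<open>Composing a nontrivial path with an arrow gives length at least two, so both sums are
  empty.\<close>

lemma delta0_arrow:
  assumes "parrows p \<noteq> []"
  shows "delta0 QA e p = 0"
proof -
  have "length (parrows p) \<ge> 1" using assms by (cases "parrows p") auto
  then show ?thesis using assms by (simp add: delta0_def nz_paths_def)
qed

text \<open>Loops contribute nothing, so the image is spanned by the gradients of indicators of
  vertices, and these give the gradients of all potentials.\<close>

lemma im_delta0_eq: "im_delta0 QA = range (\<lambda>l. coef_pair QA (diag (grad l)))"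
proof
  have lin: "coef_pair QA (diag (grad l)) + coef_pair QA (diag (grad l')) = coef_pair QA (diag (grad (\<lambda>v. l v + l' v)))"
    "pscale c (coef_pair QA (diag (grad l))) = coef_pair QA (diag (grad (\<lambda>v. c * l v)))" for l l' c
    unfolding coef_pair_add[symmetric] coef_pair_scale[symmetric]
    by (auto intro!: coef_pair_cong simp: diag_def grad_def algebra_simps)
  have zero: "0 = coef_pair QA (diag (grad (\<lambda>v. 0)))"
    by (simp add: coef_pair_diag grad_def)
  show "im_delta0 QA \<subseteq> range (\<lambda>l. coef_pair QA (diag (grad l)))"
    unfolding im_delta0_def
  proof (rule free.span_minimal)
    show "free.subspace (range (\<lambda>l. coef_pair QA (diag (grad l))))"
      by (rule free.subspaceI) (auto simp: lin zero)
    show "{delta0 QA e p |e p. e \<in> verts QA \<and> p \<in> nz_paths QA \<and> psource p = e \<and> ptarget p = e}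
        \<subseteq> range (\<lambda>l. coef_pair QA (diag (grad l)))"
    proof
      fix x :: "('b \<times> ('v, 'b) path) \<Rightarrow>\<^sub>0 'k"
      assume "x \<in> {delta0 QA e p |e p. e \<in> verts QA \<and> p \<in> nz_paths QA \<and> psource p = e \<and> ptarget p = e}"
      then obtain e p where x: "x = delta0 QA e p" "psource p = e" "ptarget p = e" by blast
      show "x \<in> range (\<lambda>l. coef_pair QA (diag (grad l)))"
      proof (cases "parrows p = []")
        case True
        then have "p = vertex_path e" using x by (simp add: path_eq_iff)
        then show ?thesis unfolding x(1) by (simp add: delta0_vertex)
      next
        case False
        show ?thesis unfolding x(1) delta0_arrow[OF False] zero by (rule range_eqI[OF refl])
      qed
    qed
  qed
  show "range (\<lambda>l. coef_pair QA (diag (grad l))) \<subseteq> im_delta0 QA"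
  proof clarify
    fix l :: "'v \<Rightarrow> 'k"
    \<comment> \<open>The sign compensates the minus sign in \<open>delta0_vertex\<close>.\<close>
    have "(\<Sum>e\<in>verts QA. pscale (- l e) (delta0 QA e (vertex_path e))) \<in> im_delta0 QA"
      unfolding im_delta0_def
      by (intro free.span_sum free.span_scale free.span_base CollectI exI conjI, rule refl)
        (simp_all add: nz_paths_def)
    also have "(\<Sum>e\<in>verts QA. pscale (- l e) (delta0 QA e (vertex_path e))) =
        coef_pair QA (\<lambda>a b. \<Sum>e\<in>verts QA. - l e * diag (grad (\<lambda>v. if v = e then -1 else 0)) a b)"
      unfolding delta0_vertex coef_pair_scale[symmetric] coef_pair_sum ..
    also have "\<dots> = coef_pair QA (diag (grad l))"
    proof (rule coef_pair_cong)
      fix a b assume "a \<in> arcs QA"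
      have "(\<Sum>e\<in>verts QA. - l e * diag (grad (\<lambda>v. if v = e then -1 else 0)) a b)
        = (\<Sum>e\<in>verts QA. (if e = head QA a then if a = b then l e else 0 else 0)
            - (if e = tail QA a then if a = b then l e else 0 else 0))"
        by (intro sum.cong) (auto simp: diag_def grad_def)
      then show "(\<Sum>e\<in>verts QA. - l e * diag (grad (\<lambda>v. if v = e then -1 else 0)) a b) = diag (grad l) a b"
        using \<open>a \<in> arcs QA\<close> by (simp add: sum_subtractf diag_def grad_def)
    qed
    finally show "coef_pair QA (diag (grad l)) \<in> im_delta0 QA" .
  qed
qed

lemma pair_value_coef_pair:
  fixes m :: "'b \<Rightarrow> 'b \<Rightarrow> 'k"
  assumes "a \<in> arcs QA"
  shows "pair_value (coef_pair QA m) a = (\<Sum>b\<in>arcs QA. Poly_Mapping.single (arrow_path QA b) (m a b))"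
proof -
  let ?F = "(\<lambda>(a, b). (a, arrow_path QA b)) ` (arcs QA \<times> arcs QA)"
  have inj: "inj_on (\<lambda>(a, b). (a, arrow_path QA b)) (arcs QA \<times> arcs QA)"
    by (auto simp: inj_on_def)
  have re: "(\<Sum>(b, p)\<in>?F. f b p) = (\<Sum>b\<in>arcs QA. \<Sum>c\<in>arcs QA. f b (arrow_path QA c))"
    for f :: "'b \<Rightarrow> ('v, 'b) path \<Rightarrow> ('v, 'b) path \<Rightarrow>\<^sub>0 'k"
    by (subst sum.reindex[OF inj]) (simp add: sum.cartesian_product case_prod_beta)
  have "pair_value (coef_pair QA m) a = (\<Sum>(b, p)\<in>?F.
      if b = a then Poly_Mapping.single p (Poly_Mapping.lookup (coef_pair QA m) (b, p)) else 0)"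
    unfolding pair_value_def
    by (intro sum.mono_neutral_left keys_coef_pair) (auto simp: in_keys_iff)
  also have "\<dots> = (\<Sum>b\<in>arcs QA. \<Sum>c\<in>arcs QA. if b = a then Poly_Mapping.single (arrow_path QA c)
      (Poly_Mapping.lookup (coef_pair QA m) (b, arrow_path QA c)) else 0)"
    by (rule re)
  also have "\<dots> = (\<Sum>b\<in>arcs QA. if b = a then \<Sum>c\<in>arcs QA. Poly_Mapping.single (arrow_path QA c) (m a c) else 0)"
    by (intro sum.cong refl) auto
  finally show ?thesis using assms by simp
qed

text \<open>The derivation required by \<open>ker_delta1\<close> is \<open>der_of m\<close>; it
  kills the vertices because they lie in \<open>B\<close>.\<close>

lemma coef_pair_ker:
  fixes m :: "'b \<Rightarrow> 'b \<Rightarrow> 'k"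
  assumes m: "m \<in> coef_carrier QA QB"
  shows "coef_pair QA m \<in> ker_delta1_rel QA QB"
proof -
  have keys: "a \<in> arcs QA \<and> a \<notin> arcs QB \<and> (\<exists>b\<in>arcs QA. p = arrow_path QA b \<and>
      tail QA a = tail QA b \<and> head QA a = head QA b)"
    if key: "(a, p) \<in> Poly_Mapping.keys (coef_pair QA m)" for a p
  proof -
    obtain b where b: "a \<in> arcs QA" "b \<in> arcs QA" "p = arrow_path QA b"
      using subsetD[OF keys_coef_pair key] by auto
    then have "m a b \<noteq> 0" using key by (simp add: in_keys_iff)
    then show ?thesis using coef_carrierD[OF m] b by blast
  qed
  have "Poly_Mapping.keys (coef_pair QA m) \<subseteq> parallel_pairs QA"
  proof
    fix z assume z: "z \<in> Poly_Mapping.keys (coef_pair QA m)"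
    obtain a p where "z = (a, p)" by (cases z)
    then show "z \<in> parallel_pairs QA"
      using keys[of a p] z by (auto simp: parallel_pairs_def nz_paths_def)
  qed
  moreover have "der_of m \<in> Der A"
    using der_of_in_rel_Der[OF m] by (simp add: rel_Der_def)
  moreover have "der_of m (rsz_class QA (Poly_Mapping.single (vertex_path e) 1)) = \<zero>\<^bsub>A\<^esub>"
    if "e \<in> verts QA" for e
  proof -
    have "Poly_Mapping.single (vertex_path e) (1 :: 'k) \<in> carrier (path_algebra QA)"
      using that by (intro single_in_path_algebra) simp
    then show ?thesis
      by (intro der_of_B[OF m])
        (auto simp: B_iff rsz_algebra_simps(1) coef_class lookup_single when_def)
  qed
  moreover have "der_of m (rsz_class QA (Poly_Mapping.single (arrow_path QA a) 1))
      = rsz_class QA (pair_value (coef_pair QA m) a)" if a: "a \<in> arcs QA" for a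
  proof (rule rsz_eqI)
    have s: "Poly_Mapping.single (arrow_path QA a) (1 :: 'k) \<in> carrier (path_algebra QA)"
      using a by (intro single_in_path_algebra) simp
    then have s': "rsz_class QA (Poly_Mapping.single (arrow_path QA a) 1) \<in> carrier A"
      by (simp add: rsz_algebra_simps(1))
    have v: "pair_value (coef_pair QA m) a \<in> carrier (path_algebra QA)"
      unfolding pair_value_coef_pair[OF a]
      by (intro path_algebra_sum_closed single_in_path_algebra) simp
    show "der_of m (rsz_class QA (Poly_Mapping.single (arrow_path QA a) 1)) \<in> carrier A"
      by (rule coef_der_of(1)[OF s'])
    show "rsz_class QA (pair_value (coef_pair QA m) a) \<in> carrier A"
      using v by (simp add: rsz_algebra_simps(1))
    show "vcoef (der_of m (rsz_class QA (Poly_Mapping.single (arrow_path QA a) 1))) e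
      = vcoef (rsz_class QA (pair_value (coef_pair QA m) a)) e" if "e \<in> verts QA" for e
      using that v s' by (simp add: coef_der_of coef_class)
        (simp add: pair_value_coef_pair[OF a] lookup_sum lookup_single)
    show "acoef QA (der_of m (rsz_class QA (Poly_Mapping.single (arrow_path QA a) 1))) b
      = acoef QA (rsz_class QA (pair_value (coef_pair QA m) a)) b" if b: "b \<in> arcs QA" for b
    proof -
      have "acoef QA (der_of m (rsz_class QA (Poly_Mapping.single (arrow_path QA a) 1))) b
        = (\<Sum>c\<in>arcs QA. if c = a then m c b else 0)"
        unfolding coef_der_of(3)[OF s' b] using s
        by (intro sum.cong refl) (auto simp: coef_class lookup_single when_def)
      then show ?thesis
        using a b v by (simp add: coef_class)
          (simp add: pair_value_coef_pair[OF a] lookup_sum lookup_single when_def)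
    qed
  qed
  ultimately have "coef_pair QA m \<in> ker_delta1 QA"
    unfolding ker_delta1_def by blast
  then show ?thesis
    unfolding ker_delta1_rel_def using keys by auto
qed

lemma im_delta0_rel_eq: "im_delta0_rel QA QB = coef_pair QA ` coef_inner"
proof (intro equalityI subsetI)
  fix x :: "('b \<times> ('v, 'b) path) \<Rightarrow>\<^sub>0 'k" assume x: "x \<in> im_delta0_rel QA QB"
  then obtain l where l: "x = coef_pair QA (diag (grad l))"
    by (auto simp: im_delta0_rel_def im_delta0_eq)
  \<comment> \<open>The gradient need not vanish outside the quiver, so it is cut off there to
    obtain an element of \<open>coef_carrier\<close>.\<close>
  let ?m = "\<lambda>a b. if a \<in> arcs QA then diag (grad l) a b else 0"
  \<comment> \<open>The gradient at \<open>a\<close> is the coefficient of a//a, and no symbol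
    starting with an arrow of \<open>QB\<close> occurs in \<open>x\<close>.\<close>
  have "grad l a = 0" if "a \<in> arcs QB" for a
  proof -
    have "(a, arrow_path QA a) \<notin> Poly_Mapping.keys x"
      using x that by (auto simp: im_delta0_rel_def ker_delta1_rel_def)
    then show ?thesis using that arcs_QB by (auto simp: l in_keys_iff diag_def)
  qed
  then have "?m \<in> coef_carrier QA QB"
    by (auto simp: coef_carrier_def diag_def)
  then have "?m \<in> coef_inner" by (auto simp: coef_inner_iff)
  moreover have "x = coef_pair QA ?m"
    unfolding l by (rule coef_pair_cong) simp
  ultimately show "x \<in> coef_pair QA ` coef_inner" by blast
next
  fix x assume "x \<in> coef_pair QA ` coef_inner"
  then obtain m where "x = coef_pair QA m" "m \<in> coef_inner" by (rule imageE)
  then obtain l where m: "x = coef_pair QA m" "m \<in> coef_carrier QA QB"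
    "\<forall>a\<in>arcs QA. \<forall>b. m a b = diag (grad l) a b"
    unfolding coef_inner_iff by blast
  have "x = coef_pair QA (diag (grad l))"
    unfolding m(1) using m(3) by (intro coef_pair_cong) blast
  then show "x \<in> im_delta0_rel QA QB"
    using coef_pair_ker[OF m(2)] m(1) by (auto simp: im_delta0_rel_def im_delta0_eq)
qed

definition tau :: "('b \<Rightarrow> 'b \<Rightarrow> 'k) \<Rightarrow> ('b \<times> ('v, 'b) path) \<Rightarrow>\<^sub>0 'k" where
  "tau m = (\<Sum>\<alpha>\<in>classes_D QA QB. pscale (tr m \<alpha>) (I_elt QA \<alpha>))"

text \<open>The block scalar matrix with value \<open>c\<close> on each class in
  \<open>classes_D\<close> and zero elsewhere. It is a canonical preimage under \<open>tau\<close>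
  and shows that \<open>tau\<close> depends only on traces.\<close>

definition tcoef :: "('b set \<Rightarrow> 'k) \<Rightarrow> 'b \<Rightarrow> 'b \<Rightarrow> 'k" where
  "tcoef c a b = (if a = b \<and> a \<in> arcs QA - arcs QB \<and> arrow_class a \<in> classes_D QA QB then c (arrow_class a) else 0)"

lemma tcoef_sum:
  "(\<Sum>\<alpha>\<in>classes_D QA QB. pscale (c \<alpha>) (I_elt QA \<alpha>)) = coef_pair QA (tcoef c)"
proof -
  have "(\<Sum>\<alpha>\<in>classes_D QA QB. pscale (c \<alpha>) (I_elt QA \<alpha>))
      = coef_pair QA (\<lambda>a b. \<Sum>\<alpha>\<in>classes_D QA QB. c \<alpha> * id_coef \<alpha> a b)"
    unfolding coef_pair_sum coef_pair_scale using classes_D_sub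
    by (intro sum.cong refl) (auto simp: I_elt_eq)
  also have "\<dots> = coef_pair QA (tcoef c)"
  proof (rule coef_pair_cong)
    fix a b assume a: "a \<in> arcs QA"
    have *: "(\<Sum>\<alpha>\<in>classes_D QA QB. c \<alpha> * id_coef \<alpha> a b)
        = (if a = b then \<Sum>\<alpha>\<in>classes_D QA QB. if a \<in> \<alpha> then c \<alpha> else 0 else 0)"
      by (auto simp: id_coef_def intro!: sum.cong)
    show "(\<Sum>\<alpha>\<in>classes_D QA QB. c \<alpha> * id_coef \<alpha> a b) = tcoef c a b"
    proof (cases "a \<in> arcs QB")
      case True
      then have "a \<notin> \<alpha>" if "\<alpha> \<in> classes_D QA QB" for \<alpha>
        using that classes_D_sub class_subset by blast
      then show ?thesis using True by (auto simp: * tcoef_def intro: sum.neutral)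
    next
      case False
      then show ?thesis
        unfolding * using a sum_over_classes[OF classes_D_sub a False] False
        by (auto simp: tcoef_def)
    qed
  qed
  finally show ?thesis .
qed

lemma tau_eq: "tau m = coef_pair QA (tcoef (tr m))"
  unfolding tau_def by (rule tcoef_sum)

lemma tau_linear:
  "tau (\<lambda>a b. m a b + n a b) = tau m + tau n"
  "tau (\<lambda>a b. c * m a b) = pscale c (tau m)"
  "tau (\<lambda>a b. m a b - n a b) = tau m - tau n"
  "tau (\<lambda>a b. 0) = 0"
  by (simp_all add: tau_def tr_linear free.scale_left_distrib free.scale_left_diff_distrib
      sum.distrib sum_subtractf free.scale_sum_right)

text \<open>An inner matrix is recovered from its traces on the classes in \<open>classes_D\<close>.
  Hence \<open>tau\<close> loses no information on inner matrices, and the quotient in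
  \<open>frak_a\<close> removes exactly them.\<close>

lemma inner_tcoef:
  assumes "m \<in> coef_inner" "a \<in> arcs QA"
  shows "tcoef (tr m) a b = m a b"
proof -
  obtain l where m: "m \<in> coef_carrier QA QB" and l: "\<And>a b. a \<in> arcs QA \<Longrightarrow> m a b = diag (grad l) a b"
    using assms(1) by (auto simp: coef_inner_iff)
  show ?thesis
  proof (cases "a = b \<and> a \<notin> arcs QB")
    case False
    then show ?thesis
      using assms(2) l[of a b] coef_carrier_0[OF m, of a b] by (auto simp: tcoef_def diag_def)
  next
    case True
    then have cl: "arrow_class a \<in> C_classes" "a \<in> arrow_class a" using arrow_class_mem assms(2) by auto
    have same: "m c c = m a a" if "c \<in> arcs QA" "arc_to_ends QA a = arc_to_ends QA c" for c
      using that assms(2) by (simp add: l diag_def grad_def arc_to_ends_def)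
    show ?thesis
    proof (cases "arrow_class a \<in> classes_D QA QB")
      case D: True
      have "tr m (arrow_class a) = m a a"
        using cl(1) by (rule tr_const) (rule same, auto simp: arrow_class_def)
      then show ?thesis using True D assms(2) by (auto simp: tcoef_def)
    next
      case False
      \<comment> \<open>An arrow \<open>c\<close> of \<open>QB\<close> parallel to the class; its
        row vanishes, and the constant diagonal value must agree with \<open>m c c\<close>.\<close>
      then obtain a' c where c: "a' \<in> arrow_class a" "c \<in> arcs QB" "arc_to_ends QA a' = arc_to_ends QA c"
        using cl classes_E_iff[of "arrow_class a"] by (auto simp: classes_E_def C_classes_def)
      then have "arc_to_ends QA a = arc_to_ends QA c" by (simp add: arrow_class_def)
      then have "m a a = m c c" using same c(2) arcs_QB by auto
      also have "\<dots> = 0" using c(2) by (intro coef_carrier_0[OF m]) simp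
      finally show ?thesis using True False by (auto simp: tcoef_def)
    qed
  qed
qed

lemma tau_inner:
  assumes "m \<in> coef_inner"
  shows "tau m = coef_pair QA m"
  unfolding tau_eq using inner_tcoef[OF assms] by (intro coef_pair_cong)

text \<open>In this form the subspace is the image of an ideal under an epimorphism, hence an
  ideal.\<close>

lemma im_delta0_rel_tau: "im_delta0_rel QA QB = tau ` coef_inner"
  unfolding im_delta0_rel_eq by (intro image_cong refl) (simp add: tau_inner)

lemma tcoef_carrier: "tcoef c \<in> coef_carrier QA QB"
  by (auto simp: coef_carrier_def tcoef_def)

lemma tr_tcoef:
  assumes "\<alpha> \<in> classes_D QA QB"
  shows "tr (tcoef c) \<alpha> = c \<alpha>"
proof (rule tr_const)
  show \<alpha>: "\<alpha> \<in> C_classes" using assms classes_D_sub by blast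
  show "tcoef c a a = c \<alpha>" if "a \<in> \<alpha>" for a
    using class_mem[OF \<alpha> that] assms by (simp add: tcoef_def)
qed

lemma tau_tcoef: "tau (tcoef c) = coef_pair QA (tcoef c)"
  unfolding tcoef_sum[symmetric] tau_def by (intro sum.cong refl) (simp add: tr_tcoef)

lemma prod_kI_eq: "prod_kI QA QB = tau ` coef_carrier QA QB"
proof (intro equalityI subsetI)
  fix x :: "('b \<times> ('v, 'b) path) \<Rightarrow>\<^sub>0 'k" assume "x \<in> prod_kI QA QB"
  then obtain z where z: "x = (\<Sum>\<alpha>\<in>classes_D QA QB. z \<alpha>)" "\<forall>\<alpha>\<in>classes_D QA QB. z \<alpha> \<in> kI QA \<alpha>"
    by (auto simp: prod_kI_def)
  then have "\<forall>\<alpha>\<in>classes_D QA QB. \<exists>c. z \<alpha> = pscale c (I_elt QA \<alpha>)"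
    by (auto simp: kI_eq)
  then obtain c where c: "\<forall>\<alpha>\<in>classes_D QA QB. z \<alpha> = pscale (c \<alpha>) (I_elt QA \<alpha>)"
    by (rule bchoice[THEN exE])
  \<comment> \<open>The scalars chosen for the summands are the traces of
    \<open>tcoef c\<close>.\<close>
  have "x = tau (tcoef c)"
    unfolding tau_tcoef tcoef_sum[symmetric] z(1) using c by (intro sum.cong) auto
  then show "x \<in> tau ` coef_carrier QA QB" using tcoef_carrier by blast
next
  fix x assume "x \<in> tau ` coef_carrier QA QB"
  then show "x \<in> prod_kI QA QB"
    unfolding prod_kI_def tau_def by (auto simp: kI_eq)
qed

lemma tau_bracket:
  assumes "m \<in> coef_carrier QA QB" "n \<in> coef_carrier QA QB"
  shows "tau (coef_bracket QA m n) = 0"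
  unfolding tau_def using tr_bracket[OF assms] classes_D_sub by (intro sum.neutral) auto

lemma pair_bracket_tau: "pair_bracket (tau m) (tau n) = 0"
proof -
  have "pair_bracket (tau m) (tau n) = coef_pair QA (coef_bracket QA (tcoef (tr m)) (tcoef (tr n)))"
    unfolding tau_eq by (rule pair_bracket_coef_pair) (auto simp: tcoef_def split: if_splits)
  also have "coef_bracket QA (tcoef (tr m)) (tcoef (tr n)) = (\<lambda>a b. 0)"
    unfolding coef_bracket_def by (intro ext sum.neutral) (auto simp: tcoef_def)
  finally show ?thesis by simp
qed

text \<open>Both brackets are zero: traces of commutators vanish on one side, diagonal matrices
  commute on the other.\<close>

lemma tau_epi: "lie_epi (coef_lie QA QB) (pair_lie (prod_kI QA QB)) tau"
  unfolding lie_epi_def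
  by (intro conjI lie_homI)
    (simp_all add: pair_lie_def prod_kI_eq tau_linear tau_bracket pair_bracket_tau)

lemma im_delta0_rel_ideal:
  "lie_ideal (im_delta0_rel QA QB :: (('b \<times> ('v, 'b) path) \<Rightarrow>\<^sub>0 'k) set) (pair_lie (prod_kI QA QB))"
  unfolding im_delta0_rel_tau by (rule lie_ideal_image[OF tau_epi coef_inner_ideal])

lemma prod_kI_alg_ideal:
  "lie_alg_ideal (pair_lie (prod_kI QA QB)) (im_delta0_rel QA QB :: (('b \<times> ('v, 'b) path) \<Rightarrow>\<^sub>0 'k) set)"
  unfolding lie_alg_ideal_def lie_alg_ideal_axioms_def
  using lie_algebra_epi[OF lie_algebra_coef tau_epi] im_delta0_rel_ideal by blast

definition frak_a_map :: "('b \<Rightarrow> 'b \<Rightarrow> 'k) \<Rightarrow> (('b \<times> ('v, 'b) path) \<Rightarrow>\<^sub>0 'k) set" where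
  "frak_a_map = lie_coset (pair_lie (prod_kI QA QB)) (im_delta0_rel QA QB) \<circ> tau"

lemma frak_a_map_epi: "lie_epi (coef_lie QA QB) (frak_a QA QB) frak_a_map"
  unfolding frak_a_map_def frak_a_def
  by (rule lie_epi_comp[OF tau_epi lie_alg_ideal.coset_epi[OF prod_kI_alg_ideal]])

lemma frak_a_map_eq_iff:
  assumes "m \<in> coef_carrier QA QB" "n \<in> coef_carrier QA QB"
  shows "frak_a_map m = frak_a_map n \<longleftrightarrow> (\<exists>k\<in>coef_inner. tau m - tau n = tau k)"
  unfolding frak_a_map_def comp_def
  using assms lie_alg_ideal.coset_eq_iff[OF prod_kI_alg_ideal, of "tau m" "tau n"]
  by (auto simp: pair_lie_def prod_kI_eq im_delta0_rel_tau image_iff)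

lemma lie_abelian_frak_a: "lie_abelian (frak_a QA QB :: ('k, _) lie)"
  unfolding lie_abelian_def
proof (intro ballI)
  have im: "lcarrier (frak_a QA QB) = frak_a_map ` coef_carrier QA QB"
    and z: "lzero (frak_a QA QB) = frak_a_map (\<lambda>a b. 0)"
    and hom: "frak_a_map \<in> lie_hom (coef_lie QA QB) (frak_a QA QB)"
    using frak_a_map_epi by (auto simp: lie_epi_def)
  fix X Y :: "(('b \<times> ('v, 'b) path) \<Rightarrow>\<^sub>0 'k) set"
  assume "X \<in> lcarrier (frak_a QA QB)" "Y \<in> lcarrier (frak_a QA QB)"
  then obtain m n where mn: "m \<in> coef_carrier QA QB" "n \<in> coef_carrier QA QB"
    "X = frak_a_map m" "Y = frak_a_map n"
    unfolding im by blast
  have "lbracket (frak_a QA QB) X Y = frak_a_map (coef_bracket QA m n)"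
    using lie_homD(4)[OF hom, of m n] mn by simp
  also have "\<dots> = lzero (frak_a QA QB)"
    unfolding z frak_a_map_def by (simp add: tau_bracket mn tau_linear)
  finally show "lbracket (frak_a QA QB) X Y = lzero (frak_a QA QB)" .
qed

end

section \<open>The decomposition\<close>

context rsz_pair
begin

definition gl_part :: "('b \<Rightarrow> 'b \<Rightarrow> 'k) \<Rightarrow> 'b set \<Rightarrow> 'b \<Rightarrow> 'b \<Rightarrow> 'k" where
  "gl_part m \<alpha> a b = (if a \<in> \<alpha> \<and> b \<in> \<alpha> then m a b else 0)"

lemma class_parallel:
  "\<lbrakk>\<alpha> \<in> C_classes; a \<in> \<alpha>; b \<in> \<alpha>\<rbrakk> \<Longrightarrow> arc_to_ends QA a = arc_to_ends QA b"
  using class_mem(4) by blast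

lemma B_part_parallel:
  assumes "m \<in> coef_carrier QA QB" "B_part m \<alpha> a b \<noteq> 0"
  shows "arc_to_ends QA a = arc_to_ends QA b"
  using assms coef_carrier_0[OF assms(1), of a b] by (auto simp: B_part_def split: if_splits)

text \<open>Classes outside \<open>classes_S\<close> are singletons: their block is already scalar,
  which matches the absence of an \<open>sl\<close> factor.\<close>

lemma card_class_not_S:
  assumes "\<alpha> \<in> C_classes" "\<alpha> \<notin> classes_S QA QB" "a \<in> \<alpha>" "b \<in> \<alpha>"
  shows "a = b"
proof -
  have "card \<alpha> = 1"
    using assms card_class[OF assms(1)] by (auto simp: classes_S_def C_classes_def)
  then show ?thesis using assms(3,4) by (auto simp: card_1_singleton_iff)
qed

lemma tr_not_S:
  assumes "\<alpha> \<in> C_classes" "\<alpha> \<notin> classes_S QA QB" "a \<in> \<alpha>"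
  shows "tr m \<alpha> = m a a"
  using assms card_class_not_S[OF assms(1,2) _ assms(3)] by (intro tr_const) auto

text \<open>The full block of \<alpha> acts on the block towards \<open>QB\<close>. Its scalar part
  acts inside the factor at \<alpha>, its traceless part through \<open>sl_act\<close>; together
  they give the action of the undivided block.\<close>

lemma gl_action:
  assumes \<alpha>: "\<alpha> \<in> C_classes" and n: "n \<in> coef_carrier QA QB"
  shows "pair_bracket (pscale (tr m \<alpha>) (I_elt QA \<alpha>)) (coef_pair QA (B_part n \<alpha>)) +
      (if \<alpha> \<in> classes_S QA QB then pair_bracket (mat_elt QA \<alpha> (smat m \<alpha>)) (coef_pair QA (B_part n \<alpha>)) else 0)
    = coef_pair QA (coef_bracket QA (gl_part m \<alpha>) (B_part n \<alpha>))"
proof -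
  let ?i = "\<lambda>a b. tr m \<alpha> * id_coef \<alpha> a b"
  let ?x = "\<lambda>a b. if a \<in> \<alpha> \<and> b \<in> \<alpha> then smat m \<alpha> $$ (idx \<alpha> b, idx \<alpha> a) else 0"
  have x: "?x a b = (if a \<in> \<alpha> \<and> b \<in> \<alpha> then m a b - (if a = b then tr m \<alpha> else 0) else 0)" for a b
  proof (cases "a \<in> \<alpha> \<and> b \<in> \<alpha>")
    case True
    then have "idx \<alpha> a = idx \<alpha> b \<longleftrightarrow> a = b" using idx(2)[OF \<alpha>] by metis
    then show ?thesis using True idx[OF \<alpha>] by (simp add: smat_def)
  qed auto
  have 1: "pair_bracket (pscale (tr m \<alpha>) (I_elt QA \<alpha>)) (coef_pair QA (B_part n \<alpha>))
      = coef_pair QA (coef_bracket QA ?i (B_part n \<alpha>))"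
    unfolding I_elt_eq[OF \<alpha>] coef_pair_scale[symmetric]
    by (rule pair_bracket_coef_pair, force simp: id_coef_def split: if_splits, rule B_part_parallel[OF n])
  show ?thesis
  proof (cases "\<alpha> \<in> classes_S QA QB")
    case True
    have 2: "pair_bracket (mat_elt QA \<alpha> (smat m \<alpha>)) (coef_pair QA (B_part n \<alpha>))
        = coef_pair QA (coef_bracket QA ?x (B_part n \<alpha>))"
      unfolding mat_elt_eq[OF \<alpha>]
    proof (rule pair_bracket_coef_pair)
      fix a b assume "?x a b \<noteq> 0"
      then have "a \<in> \<alpha>" "b \<in> \<alpha>" by (auto split: if_splits)
      then show "arc_to_ends QA a = arc_to_ends QA b" by (rule class_parallel[OF \<alpha>])
    qed (rule B_part_parallel[OF n])
    have "gl_part m \<alpha> = (\<lambda>a b. ?i a b + ?x a b)"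
      unfolding x by (auto simp: fun_eq_iff gl_part_def id_coef_def)
    then show ?thesis
      using True by (simp only: 1 2 if_True coef_bracket_add_left coef_pair_add)
  next
    case False
    have "gl_part m \<alpha> = ?i"
      using card_class_not_S[OF \<alpha> False] tr_not_S[OF \<alpha> False]
      by (auto simp: fun_eq_iff gl_part_def id_coef_def)
    then show ?thesis using False by (simp only: 1 if_False add_0_right)
  qed
qed

text \<open>The off-diagonal block of a commutator of block triangular matrices: each diagonal block
  acts on the off-diagonal block of the other matrix.\<close>

lemma B_part_bracket:
  assumes m: "m \<in> coef_carrier QA QB" and n: "n \<in> coef_carrier QA QB" and \<alpha>: "\<alpha> \<in> C_classes"
  shows "B_part (coef_bracket QA m n) \<alpha> = (\<lambda>a b. coef_bracket QA (gl_part m \<alpha>) (B_part n \<alpha>) a b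
    - coef_bracket QA (gl_part n \<alpha>) (B_part m \<alpha>) a b)"
proof (intro ext)
  fix a b
  \<comment> \<open>Only one of the two products survives: \<open>B_part\<close> ends in arrows of
    \<open>QB\<close>, where \<open>gl_part\<close> has no rows.\<close>
  have *: "coef_bracket QA (gl_part x \<alpha>) (B_part y \<alpha>) a b
      = (if a \<in> \<alpha> \<and> b \<in> arcs QB then - (\<Sum>c\<in>\<alpha>. x a c * y c b) else 0)" for x y
  proof -
    have "coef_bracket QA (gl_part x \<alpha>) (B_part y \<alpha>) a b
        = (\<Sum>c\<in>arcs QA. if c \<in> \<alpha> then if a \<in> \<alpha> \<and> b \<in> arcs QB then - (x a c * y c b) else 0 else 0)"
      unfolding coef_bracket_def using class_subset[OF \<alpha>]
      by (intro sum.cong refl) (auto simp: gl_part_def B_part_def)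
    also have "\<dots> = (\<Sum>c\<in>\<alpha>. if a \<in> \<alpha> \<and> b \<in> arcs QB then - (x a c * y c b) else 0)"
      using class_subset[OF \<alpha>] by (intro sum.mono_neutral_cong_right) auto
    finally show ?thesis by (auto simp: sum_negf)
  qed
  show "B_part (coef_bracket QA m n) \<alpha> a b = coef_bracket QA (gl_part m \<alpha>) (B_part n \<alpha>) a b
    - coef_bracket QA (gl_part n \<alpha>) (B_part m \<alpha>) a b"
    unfolding * using coef_bracket_class[OF m n \<alpha>, of a b] by (simp add: B_part_def sum_subtractf)
qed

text \<open>The block leads from \<alpha> to \<open>QB\<close>, and these are disjoint, so two such
  blocks cannot be composed: the ideal \<open>frakI\<close> is abelian.\<close>

lemma pair_bracket_low:
  assumes "m \<in> coef_carrier QA QB" "n \<in> coef_carrier QA QB" "\<alpha> \<in> C_classes"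
  shows "pair_bracket (coef_pair QA (B_part m \<alpha>)) (coef_pair QA (B_part n \<alpha>)) = 0"
proof -
  have "pair_bracket (coef_pair QA (B_part m \<alpha>)) (coef_pair QA (B_part n \<alpha>))
      = coef_pair QA (coef_bracket QA (B_part m \<alpha>) (B_part n \<alpha>))"
    by (rule pair_bracket_coef_pair; rule B_part_parallel; (rule assms)?)
  also have "coef_bracket QA (B_part m \<alpha>) (B_part n \<alpha>) = (\<lambda>a b. 0)"
    unfolding coef_bracket_def using class_subset[OF assms(3)]
    by (intro ext sum.neutral) (auto simp: B_part_def)
  finally show ?thesis by simp
qed

lemma pair_bracket_I:
  assumes "\<alpha> \<in> C_classes"
  shows "pair_bracket (pscale c (I_elt QA \<alpha>)) (pscale d (I_elt QA \<alpha>)) = (0 :: _ \<Rightarrow>\<^sub>0 'k)"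
proof -
  have "pair_bracket (pscale c (I_elt QA \<alpha>)) (pscale d (I_elt QA \<alpha>))
      = coef_pair QA (coef_bracket QA (\<lambda>a b. c * id_coef \<alpha> a b) (\<lambda>a b. d * id_coef \<alpha> a b))"
    unfolding I_elt_eq[OF assms] coef_pair_scale[symmetric]
    by (rule pair_bracket_coef_pair) (auto simp: id_coef_def split: if_splits)
  also have "coef_bracket QA (\<lambda>a b. c * id_coef \<alpha> a b) (\<lambda>a b. d * id_coef \<alpha> a b) = (\<lambda>a b. 0)"
    unfolding coef_bracket_def by (intro ext sum.neutral) (auto simp: id_coef_def)
  finally show ?thesis by simp
qed

definition decomposition where
  "decomposition = lie_semidirect
        (lie_PiE (classes_S QA QB) (\<lambda>\<alpha>. sl (card \<alpha>) :: ('k, 'k mat) lie))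
        (lie_prod
          (lie_PiE (classes_E QA QB)
            (\<lambda>\<alpha>. lie_semidirect (pair_lie (kI QA \<alpha>)) (pair_lie (frakI QA QB \<alpha>)) pair_bracket))
          (frak_a QA QB))
        (sl_act QA QB)"

definition dec_map where
  "dec_map m = (\<lambda>\<alpha>\<in>classes_S QA QB. smat m \<alpha>,
     \<lambda>\<alpha>\<in>classes_E QA QB. (pscale (tr m \<alpha>) (I_elt QA \<alpha>), coef_pair QA (B_part m \<alpha>)),
     frak_a_map m)"

lemma frak_a_map_hom: "frak_a_map \<in> lie_hom (coef_lie QA QB) (frak_a QA QB)"
  using frak_a_map_epi by (simp add: lie_epi_def)

lemmas in_C_classes = subsetD[OF classes_S_sub] subsetD[OF classes_E_sub] subsetD[OF classes_D_sub]

text \<open>Only the bracket needs an argument. The factors at classes in \<open>classes_E\<close>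
  combine \<open>gl_action\<close> with \<open>B_part_bracket\<close>; the other factors see
  commutators of traceless blocks or traces.\<close>

lemma dec_map_hom: "dec_map \<in> lie_hom (coef_lie QA QB) decomposition"
proof (rule lie_homI, unfold coef_lie_simps)
  interpret F: lie_algebra "frak_a QA QB :: ('k, _) lie"
    by (rule lie_algebra_epi[OF lie_algebra_coef frak_a_map_epi])
  note fhom = lie_homD[OF frak_a_map_hom, simplified]
  fix m n :: "'b \<Rightarrow> 'b \<Rightarrow> 'k" and c
  assume m: "m \<in> coef_carrier QA QB"
  show "dec_map m \<in> lcarrier decomposition"
    unfolding decomposition_def dec_map_def lie_semidirect_simps lie_prod_simps lie_PiE_simps
      pair_lie_simps
    using m fhom(1)
    by (auto simp: kI_eq in_C_classes intro!: smat_closed B_part_frakI)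
  show "dec_map (\<lambda>a b. c * m a b) = lscale decomposition c (dec_map m)"
    unfolding decomposition_def dec_map_def lie_semidirect_simps lie_prod_simps lie_PiE_simps
      pair_lie_simps
    using m by (auto simp: fhom smat_linear tr_linear B_part_linear coef_pair_scale sl_def
        lie_semidirect_simps pair_lie_simps intro!: restrict_ext)
  assume n: "n \<in> coef_carrier QA QB"
  show "dec_map (\<lambda>a b. m a b + n a b) = lplus decomposition (dec_map m) (dec_map n)"
    unfolding decomposition_def dec_map_def lie_semidirect_simps lie_prod_simps lie_PiE_simps
      pair_lie_simps
    using m n by (auto simp: fhom smat_linear tr_linear B_part_linear coef_pair_add sl_def
        free.scale_left_distrib lie_semidirect_simps pair_lie_simps intro!: restrict_ext)
  \<comment> \<open>Three contributions meet at \<alpha>: the bracket of the factor itself and the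
    \<open>sl\<close> actions of either argument on the other.\<close>
  have E: "lplus (lie_semidirect (pair_lie (kI QA \<alpha>)) (pair_lie (frakI QA QB \<alpha>)) pair_bracket)
      (lbracket (lie_semidirect (pair_lie (kI QA \<alpha>)) (pair_lie (frakI QA QB \<alpha>)) pair_bracket)
        (pscale (tr m \<alpha>) (I_elt QA \<alpha>), coef_pair QA (B_part m \<alpha>))
        (pscale (tr n \<alpha>) (I_elt QA \<alpha>), coef_pair QA (B_part n \<alpha>)))
      (lplus (lie_semidirect (pair_lie (kI QA \<alpha>)) (pair_lie (frakI QA QB \<alpha>)) pair_bracket)
        (0, if \<alpha> \<in> classes_S QA QB then pair_bracket (mat_elt QA \<alpha> (smat m \<alpha>)) (coef_pair QA (B_part n \<alpha>)) else 0)
        (lscale (lie_semidirect (pair_lie (kI QA \<alpha>)) (pair_lie (frakI QA QB \<alpha>)) pair_bracket) (-1)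
          (0, if \<alpha> \<in> classes_S QA QB then pair_bracket (mat_elt QA \<alpha> (smat n \<alpha>)) (coef_pair QA (B_part m \<alpha>)) else 0)))
    = (pscale (tr (coef_bracket QA m n) \<alpha>) (I_elt QA \<alpha>), coef_pair QA (B_part (coef_bracket QA m n) \<alpha>))"
    (is "?lhs = ?rhs") if "\<alpha> \<in> classes_E QA QB" for \<alpha>
  proof -
    have \<alpha>: "\<alpha> \<in> C_classes" using that in_C_classes by blast
    have neg: "pscale (-1) f = - f" for f :: "('b \<times> ('v, 'b) path) \<Rightarrow>\<^sub>0 'k"
      by (rule poly_mapping_eqI) simp
    have "?lhs = (0, coef_pair QA (coef_bracket QA (gl_part m \<alpha>) (B_part n \<alpha>))
        - coef_pair QA (coef_bracket QA (gl_part n \<alpha>) (B_part m \<alpha>)))"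
      unfolding lie_semidirect_simps pair_lie_simps pair_bracket_I[OF \<alpha>] pair_bracket_low[OF m n \<alpha>]
        gl_action[OF \<alpha> n, of m, symmetric] gl_action[OF \<alpha> m, of n, symmetric] neg
      by simp
    also have "\<dots> = ?rhs"
      by (simp add: tr_bracket[OF m n \<alpha>] B_part_bracket[OF m n \<alpha>] coef_pair_diff)
    finally show ?thesis .
  qed
  \<comment> \<open>The action on \<open>frak_a\<close> is zero, so the correction terms of the
    semidirect bracket are zero vectors.\<close>
  have Z: "lplus (frak_a QA QB) (lbracket (frak_a QA QB) (frak_a_map m) (frak_a_map n))
      (lplus (frak_a QA QB) (lzero (frak_a QA QB)) (lscale (frak_a QA QB) (-1) (lzero (frak_a QA QB))))
      = frak_a_map (coef_bracket QA m n)"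
    using F.bracket_closed[OF fhom(1)[OF m] fhom(1)[OF n]]
    by (simp add: fhom(4)[OF m n] F.plus_inverse F.zero_closed F.plus_zero)
  show "dec_map (coef_bracket QA m n) = lbracket decomposition (dec_map m) (dec_map n)"
    unfolding decomposition_def dec_map_def lie_semidirect_simps lie_prod_simps lie_PiE_simps
      sl_act_def prod.case
  proof (intro arg_cong2[where f = Pair] restrict_ext)
    fix \<alpha> assume "\<alpha> \<in> classes_S QA QB"
    then show "smat (coef_bracket QA m n) \<alpha> = lbracket (sl (card \<alpha>))
        ((\<lambda>\<alpha>\<in>classes_S QA QB. smat m \<alpha>) \<alpha>) ((\<lambda>\<alpha>\<in>classes_S QA QB. smat n \<alpha>) \<alpha>)"
      using smat_bracket[OF m n in_C_classes(1)] by (simp add: sl_def)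
  qed (simp_all only: Z restrict_apply' snd_conv E cong: if_cong)
qed

lemma dec_map_zero: "dec_map (\<lambda>a b. 0) = lzero decomposition"
proof -
  have "frak_a_map (\<lambda>a b. 0) = lzero (frak_a QA QB)"
    using frak_a_map_epi by (simp add: lie_epi_def)
  then show ?thesis
    unfolding decomposition_def dec_map_def lie_semidirect_simps lie_prod_simps lie_PiE_simps
      pair_lie_simps
    by (auto simp: smat_linear tr_linear B_part_linear sl_def)
qed

lemma frak_a_map_cong:
  assumes "\<And>\<alpha>. \<alpha> \<in> classes_D QA QB \<Longrightarrow> tr m \<alpha> = tr n \<alpha>"
  shows "frak_a_map m = frak_a_map n"
proof -
  have "tau m = tau n" unfolding tau_def using assms by (intro sum.cong) auto
  then show ?thesis by (simp add: frak_a_map_def)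
qed

text \<open>A preimage can be assembled block by block, because traceless part, scalar and block
  towards \<open>QB\<close> may be prescribed independently on each class.\<close>

lemma dec_map_surj:
  assumes "z \<in> lcarrier decomposition"
  shows "\<exists>m\<in>coef_carrier QA QB. dec_map m = z"
proof -
  have car: "lcarrier (frak_a QA QB) = frak_a_map ` coef_carrier QA QB"
    using frak_a_map_epi by (simp add: lie_epi_def)
  obtain X f k where z: "z = (X, f, frak_a_map k)" and
    X: "X \<in> (\<Pi>\<^sub>E \<alpha>\<in>classes_S QA QB. lcarrier (sl (card \<alpha>)))" and
    f: "f \<in> (\<Pi>\<^sub>E \<alpha>\<in>classes_E QA QB. kI QA \<alpha> \<times> frakI QA QB \<alpha>)" and
    k: "k \<in> coef_carrier QA QB"
    using assms unfolding decomposition_def lie_semidirect_simps lie_prod_simps lie_PiE_simps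
      pair_lie_simps car by blast
  have "\<forall>\<alpha>\<in>classes_E QA QB. \<exists>p. f \<alpha> = (pscale (fst p) (I_elt QA \<alpha>), coef_pair QA (snd p)) \<and>
    (\<forall>a b. snd p a b \<noteq> 0 \<longrightarrow> a \<in> \<alpha> \<and> b \<in> arcs QB \<and> arc_to_ends QA a = arc_to_ends QA b)"
  proof
    fix \<alpha> assume \<alpha>: "\<alpha> \<in> classes_E QA QB"
    have "f \<alpha> \<in> kI QA \<alpha> \<times> frakI QA QB \<alpha>" using f \<alpha> by (rule PiE_mem)
    then obtain c n where "f \<alpha> = (pscale c (I_elt QA \<alpha>), coef_pair QA n)"
      "\<forall>a b. n a b \<noteq> 0 \<longrightarrow> a \<in> \<alpha> \<and> b \<in> arcs QB \<and> arc_to_ends QA a = arc_to_ends QA b"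
      unfolding kI_eq frakI_eq[OF in_C_classes(2)[OF \<alpha>]] by (auto simp: mem_Times_iff prod_eq_iff)
    then show "\<exists>p. f \<alpha> = (pscale (fst p) (I_elt QA \<alpha>), coef_pair QA (snd p)) \<and>
      (\<forall>a b. snd p a b \<noteq> 0 \<longrightarrow> a \<in> \<alpha> \<and> b \<in> arcs QB \<and> arc_to_ends QA a = arc_to_ends QA b)"
      by (intro exI[of _ "(c, n)"]) simp
  qed
  then obtain p where p: "\<And>\<alpha>. \<alpha> \<in> classes_E QA QB \<Longrightarrow>
      f \<alpha> = (pscale (fst (p \<alpha>)) (I_elt QA \<alpha>), coef_pair QA (snd (p \<alpha>)))"
    and psupp: "\<And>\<alpha> a b. \<lbrakk>\<alpha> \<in> classes_E QA QB; snd (p \<alpha>) a b \<noteq> 0\<rbrakk> \<Longrightarrow>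
      a \<in> \<alpha> \<and> b \<in> arcs QB \<and> arc_to_ends QA a = arc_to_ends QA b"
    by (metis (no_types, lifting) bchoice)
  \<comment> \<open>The scalar comes from the \<open>kI\<close> component on
    \<open>classes_E\<close>; on the remaining classes it is copied from the representative
    \<open>k\<close> of the coset.\<close>
  define s where "s \<alpha> = (if \<alpha> \<in> classes_E QA QB then fst (p \<alpha>) else tr k \<alpha>)" for \<alpha>
  \<comment> \<open>Columns in \<open>QB\<close> come from \<open>frakI\<close>, columns in the
    class from the traceless matrix plus the scalar; the indices of \<open>X\<close> are swapped as
    in \<open>smat\<close>.\<close>
  define m where "m a b = (if a \<in> arcs QA - arcs QB \<and> b \<in> arcs QA \<and> arc_to_ends QA a = arc_to_ends QA b
      then if b \<in> arcs QB then if arrow_class a \<in> classes_E QA QB then snd (p (arrow_class a)) a b else 0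
        else (if arrow_class a \<in> classes_S QA QB then X (arrow_class a) $$ (idx (arrow_class a) b, idx (arrow_class a) a) else 0)
          + (if a = b then s (arrow_class a) else 0)
      else 0)" for a b
  have m: "m \<in> coef_carrier QA QB" by (auto simp: coef_carrier_def m_def)
  have mC: "m a b = (if \<alpha> \<in> classes_S QA QB then X \<alpha> $$ (idx \<alpha> b, idx \<alpha> a) else 0)
      + (if a = b then s \<alpha> else 0)" if "\<alpha> \<in> C_classes" "a \<in> \<alpha>" "b \<in> \<alpha>" for \<alpha> a b
    using class_mem[OF that(1,2)] class_mem(1-3)[OF that(1,3)] class_parallel[OF that]
    by (simp add: m_def)
  \<comment> \<open>The diagonal sum of \<open>X\<close> vanishes, so the prescribed scalar is the
    trace; hence \<open>smat m\<close> returns \<open>X\<close>.\<close>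
  have tr_m: "tr m \<alpha> = s \<alpha>" if \<alpha>: "\<alpha> \<in> C_classes" for \<alpha>
  proof -
    have "(\<Sum>a\<in>\<alpha>. if \<alpha> \<in> classes_S QA QB then X \<alpha> $$ (idx \<alpha> a, idx \<alpha> a) else 0) = 0"
    proof (cases "\<alpha> \<in> classes_S QA QB")
      case True
      have "(\<Sum>a\<in>\<alpha>. X \<alpha> $$ (idx \<alpha> a, idx \<alpha> a)) = (\<Sum>i<card \<alpha>. X \<alpha> $$ (i, i))"
        unfolding sum_class_enum[OF \<alpha>, of "\<lambda>a. X \<alpha> $$ (idx \<alpha> a, idx \<alpha> a)", symmetric]
        by (intro sum.cong) (simp_all add: idx[OF \<alpha>])
      then show ?thesis using True PiE_mem[OF X True] by (simp add: sl_def)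
    qed simp
    moreover have "(\<Sum>a\<in>\<alpha>. m a a) = (\<Sum>a\<in>\<alpha>. (if \<alpha> \<in> classes_S QA QB then X \<alpha> $$ (idx \<alpha> a, idx \<alpha> a) else 0) + s \<alpha>)"
      by (intro sum.cong refl) (simp add: mC[OF \<alpha>])
    ultimately show ?thesis
      using card_class[OF \<alpha>] by (simp add: tr_def sum.distrib)
  qed
  have "smat m \<alpha> = X \<alpha>" if S: "\<alpha> \<in> classes_S QA QB" for \<alpha>
  proof -
    have \<alpha>: "\<alpha> \<in> C_classes" by (rule in_C_classes(1)[OF S])
    have "X \<alpha> \<in> carrier_mat (card \<alpha>) (card \<alpha>)"
      using PiE_mem[OF X S] by (simp add: sl_def)
    then show ?thesis
      by (intro eq_matI)
        (auto simp: smat_def mC[OF \<alpha>] class_enum_mem[OF \<alpha>] S idx[OF \<alpha>] class_enum_inject[OF \<alpha>] tr_m[OF \<alpha>])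
  qed
  then have 1: "(\<lambda>\<alpha>\<in>classes_S QA QB. smat m \<alpha>) = X"
    using X by (intro extensionalityI[of _ "classes_S QA QB"]) (auto simp: PiE_def)
  have "coef_pair QA (B_part m \<alpha>) = coef_pair QA (snd (p \<alpha>))" if E: "\<alpha> \<in> classes_E QA QB" for \<alpha>
  proof (rule coef_pair_cong)
    fix a b assume "a \<in> arcs QA" "b \<in> arcs QA"
    have \<alpha>: "\<alpha> \<in> C_classes" by (rule in_C_classes(2)[OF E])
    show "B_part m \<alpha> a b = snd (p \<alpha>) a b"
    proof (cases "a \<in> \<alpha> \<and> b \<in> arcs QB \<and> arc_to_ends QA a = arc_to_ends QA b")
      case True
      then show ?thesis
        using class_mem(1-3)[OF \<alpha>, of a] E \<open>b \<in> arcs QA\<close> by (simp add: B_part_def m_def)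
    next
      case False
      then show ?thesis using psupp[OF E, of a b] by (auto simp: B_part_def m_def)
    qed
  qed
  then have 2: "(\<lambda>\<alpha>\<in>classes_E QA QB. (pscale (tr m \<alpha>) (I_elt QA \<alpha>), coef_pair QA (B_part m \<alpha>))) = f"
    using f in_C_classes(2)
    by (intro extensionalityI[of _ "classes_E QA QB"]) (auto simp: PiE_def p tr_m s_def)
  have 3: "frak_a_map m = frak_a_map k"
    using in_C_classes(3) by (intro frak_a_map_cong) (simp add: tr_m s_def classes_E_def)
  show ?thesis
    by (intro bexI[OF _ m]) (simp add: dec_map_def 1 2 3 z)
qed

lemma dec_map_epi: "lie_epi (coef_lie QA QB) decomposition dec_map"
  unfolding lie_epi_def
proof (intro conjI equalityI subsetI)
  fix z assume "z \<in> dec_map ` lcarrier (coef_lie QA QB)"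
  then show "z \<in> lcarrier decomposition"
    by (elim imageE) (simp only: lie_homD(1)[OF dec_map_hom])
next
  fix z assume "z \<in> lcarrier decomposition"
  then obtain m where "m \<in> coef_carrier QA QB" "dec_map m = z" using dec_map_surj by blast
  then show "z \<in> dec_map ` lcarrier (coef_lie QA QB)" by auto
qed (simp_all add: dec_map_hom dec_map_zero)

text \<open>The difference of a potential depends only on the ends of an arrow, so an inner matrix
  is scalar on each class and invisible in the \<open>sl\<close> factors.\<close>

lemma inner_smat:
  assumes d: "d \<in> coef_inner" and \<alpha>: "\<alpha> \<in> C_classes" and "a \<in> \<alpha>" "b \<in> \<alpha>"
  shows "d a b = (if a = b then tr d \<alpha> else 0)"
proof -
  obtain l where l: "\<And>a b. a \<in> arcs QA \<Longrightarrow> d a b = diag (grad l) a b"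
    using d by (auto simp: coef_inner_iff)
  have "d c c = d a a" if "c \<in> \<alpha>" for c
    using that assms class_mem(1)[OF \<alpha>] class_parallel[OF \<alpha>, of a c]
    by (simp add: l diag_def grad_def arc_to_ends_def)
  then have "tr d \<alpha> = d a a" by (rule tr_const[OF \<alpha>])
  then show ?thesis
    using l[of a b] class_mem(1)[OF \<alpha>] assms by (auto simp: diag_def)
qed

lemma inner_B_part:
  assumes "d \<in> coef_inner" "\<alpha> \<in> C_classes" "b \<in> arcs QB" "a \<in> \<alpha>"
  shows "d a b = 0"
  using assms class_mem(1,2)[OF assms(2,4)] by (auto simp: coef_inner_def)

text \<open>Inner matrices coincide with block scalar matrices supported on
  \<open>classes_D\<close>, so their scalars on the other classes vanish.\<close>

lemma inner_tr_E:
  assumes "d \<in> coef_inner" "\<alpha> \<in> classes_E QA QB"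
  shows "tr d \<alpha> = 0"
proof -
  have \<alpha>: "\<alpha> \<in> C_classes" using assms(2) by (rule in_C_classes(2))
  obtain a where a: "a \<in> \<alpha>" using card_class[OF \<alpha>] by fastforce
  have "tr d \<alpha> = d a a" using inner_smat[OF assms(1) \<alpha> a a] by simp
  also have "\<dots> = tcoef (tr d) a a" using inner_tcoef[OF assms(1)] class_mem(1)[OF \<alpha> a] by simp
  also have "\<dots> = 0" using class_mem(3)[OF \<alpha> a] assms(2) by (simp add: tcoef_def classes_E_def)
  finally show ?thesis .
qed

text \<open>If the images agree, all blocks of the difference are forced up to its scalars on
  \<open>classes_D\<close>, and those agree with the scalars of an inner matrix.\<close>

lemma dec_map_eq_iff:
  assumes m: "m \<in> coef_carrier QA QB" and n: "n \<in> coef_carrier QA QB"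
  shows "dec_map m = dec_map n \<longleftrightarrow> (\<lambda>a b. m a b - n a b) \<in> coef_inner"
proof -
  define d where "d = (\<lambda>a b. m a b - n a b)"
  have d: "d \<in> coef_carrier QA QB"
    unfolding coef_carrier_def
  proof (intro CollectI allI impI)
    fix a b assume "d a b \<noteq> 0"
    then have "m a b \<noteq> 0 \<or> n a b \<noteq> 0" by (auto simp: d_def)
    then show "a \<in> arcs QA - arcs QB \<and> b \<in> arcs QA \<and> arc_to_ends QA a = arc_to_ends QA b"
      using m n by (auto simp: coef_carrier_def)
  qed
  have trd: "tr d \<alpha> = tr m \<alpha> - tr n \<alpha>" for \<alpha> by (simp add: d_def tr_linear)
  have taud: "tau d = tau m - tau n" by (simp add: d_def tau_linear)
  have "d \<in> coef_inner" if eq: "dec_map m = dec_map n"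
  proof -
    have smat: "smat m \<alpha> = smat n \<alpha>" if "\<alpha> \<in> classes_S QA QB" for \<alpha>
      using eq that by (auto simp: dec_map_def dest!: fun_cong[where x = \<alpha>])
    have E: "pscale (tr m \<alpha>) (I_elt QA \<alpha>) = pscale (tr n \<alpha>) (I_elt QA \<alpha>)"
      "coef_pair QA (B_part m \<alpha>) = coef_pair QA (B_part n \<alpha>)" if "\<alpha> \<in> classes_E QA QB" for \<alpha>
      using eq that by (auto simp: dec_map_def dest!: fun_cong[where x = \<alpha>])
    \<comment> \<open>Equality in \<open>frak_a\<close> determines \<open>tau d\<close> only modulo
      inner matrices; the inner matrix \<open>k\<close> found here turns out to be \<open>d\<close>
      itself.\<close>
    obtain k where k: "k \<in> coef_inner" "tau d = tau k"
      using eq frak_a_map_eq_iff[OF m n] by (auto simp: dec_map_def taud)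
    have kc: "k \<in> coef_carrier QA QB" using k(1) by (simp add: coef_inner_def)
    have dC: "d a b = (if a = b then tr d \<alpha> else 0)" if \<alpha>: "\<alpha> \<in> C_classes" and ab: "a \<in> \<alpha>" "b \<in> \<alpha>" for \<alpha> a b
    proof (cases "\<alpha> \<in> classes_S QA QB")
      case True
      have i: "idx \<alpha> a < card \<alpha>" "idx \<alpha> b < card \<alpha>" "idx \<alpha> a = idx \<alpha> b \<longleftrightarrow> a = b"
        using idx[OF \<alpha>] ab by (simp_all, metis)
      have "smat m \<alpha> $$ (idx \<alpha> b, idx \<alpha> a) = smat n \<alpha> $$ (idx \<alpha> b, idx \<alpha> a)"
        using smat[OF True] by simp
      then show ?thesis
        using i ab by (auto simp: smat_def idx[OF \<alpha>] d_def tr_linear algebra_simps split: if_splits)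
    next
      case False
      then show ?thesis
        using card_class_not_S[OF \<alpha> False ab] tr_not_S[OF \<alpha> False ab(1)] by simp
    qed
    have dE: "tr d \<alpha> = 0" if \<alpha>E: "\<alpha> \<in> classes_E QA QB" for \<alpha>
    proof -
      have \<alpha>: "\<alpha> \<in> C_classes" using \<alpha>E by (rule in_C_classes(2))
      \<comment> \<open>Classes are nonempty, and the coefficient of a//a in \<open>I_elt\<close> is
        1, so equal multiples have equal scalars.\<close>
      obtain a where a: "a \<in> \<alpha>" using card_class[OF \<alpha>] by fastforce
      have "Poly_Mapping.lookup (I_elt QA \<alpha>) (a, arrow_path QA a) = (1 :: 'k)"
        using a class_mem(1)[OF \<alpha> a] by (simp add: I_elt_eq[OF \<alpha>] id_coef_def)
      then show ?thesis
        using arg_cong[OF E(1)[OF \<alpha>E], where f = "\<lambda>x. Poly_Mapping.lookup x (a, arrow_path QA a)"]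
        by (simp add: trd)
    qed
    have dB: "d a b = 0" if "b \<in> arcs QB" for a b
    proof (rule ccontr)
      assume nz: "d a b \<noteq> 0"
      note a = coef_carrierD(1-3)[OF d nz]
      have "arc_to_ends QA a = arc_to_ends QA b" using d nz by (auto simp: coef_carrier_def)
      \<comment> \<open>A nonzero entry in a column of \<open>QB\<close> exhibits a parallel arrow
        of \<open>QB\<close>, so equality of the \<open>frakI\<close> components applies.\<close>
      then have "arrow_class a \<in> classes_E QA QB"
        using that arrow_class_mem[OF a(1,2)] classes_E_iff by blast
      then have "B_part m (arrow_class a) a b = B_part n (arrow_class a) a b"
        using coef_pair_eqD[OF E(2) a(1,3)] by blast
      then show False
        using nz that arrow_class_mem[OF a(1,2)] by (simp add: B_part_def d_def)
    qed
    have "d a b = k a b" for a b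
    proof (cases "a \<in> arcs QA - arcs QB \<and> b \<in> arcs QA \<and> arc_to_ends QA a = arc_to_ends QA b")
      case True
      then have cl: "arrow_class a \<in> C_classes" "a \<in> arrow_class a" using arrow_class_mem by auto
      show ?thesis
      proof (cases "b \<in> arcs QB")
        case True
        then show ?thesis using dB inner_B_part[OF k(1) cl(1) _ cl(2)] by simp
      next
        case False
        then have b: "b \<in> arrow_class a" using True by (simp add: arrow_class_def)
        have "tr d (arrow_class a) = tr k (arrow_class a)"
        proof (cases "arrow_class a \<in> classes_D QA QB")
          case D: True
          have "tcoef (tr d) a a = tcoef (tr k) a a"
            using k(2) True unfolding tau_eq by (intro coef_pair_eqD) auto
          then show ?thesis using D True by (simp add: tcoef_def)
        next
          case False
          then have "arrow_class a \<in> classes_E QA QB" using cl by (simp add: classes_E_def C_classes_def)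
          then show ?thesis using dE inner_tr_E[OF k(1)] by simp
        qed
        then show ?thesis by (simp only: dC[OF cl b] inner_smat[OF k(1) cl b])
      qed
    next
      case False
      then show ?thesis using coef_carrier_0[OF d, of a b] coef_carrier_0[OF kc, of a b] by auto
    qed
    then have "d = k" by (intro ext)
    then show ?thesis using k by simp
  qed
  moreover have "dec_map m = dec_map n" if di: "d \<in> coef_inner"
  proof -
    have mn: "m a b = n a b + d a b" for a b by (simp add: d_def)
    have "smat m \<alpha> = smat n \<alpha>" if "\<alpha> \<in> classes_S QA QB" for \<alpha>
    proof (rule eq_matI)
      have \<alpha>: "\<alpha> \<in> C_classes" using that by (rule in_C_classes(1))
      fix j i assume "j < dim_row (smat n \<alpha>)" "i < dim_col (smat n \<alpha>)"
      then have ji: "j < card \<alpha>" "i < card \<alpha>" by (simp_all add: smat_def)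
      show "smat m \<alpha> $$ (j, i) = smat n \<alpha> $$ (j, i)"
        using ji inner_smat[OF di \<alpha> class_enum_mem[OF \<alpha> ji(2)] class_enum_mem[OF \<alpha> ji(1)]]
          class_enum_inject[OF \<alpha> ji(2,1)] trd[of \<alpha>]
        by (auto simp: smat_def mn)
    qed (simp_all add: smat_def)
    moreover have "tr m \<alpha> = tr n \<alpha>" if "\<alpha> \<in> classes_E QA QB" for \<alpha>
      using inner_tr_E[OF di that] trd[of \<alpha>] by simp
    moreover have "B_part m \<alpha> = B_part n \<alpha>" if "\<alpha> \<in> classes_E QA QB" for \<alpha>
      using inner_B_part[OF di in_C_classes(2)[OF that]] by (auto simp: fun_eq_iff B_part_def mn)
    moreover have "frak_a_map m = frak_a_map n"
      unfolding frak_a_map_eq_iff[OF m n] using taud[symmetric] di by (rule bexI)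
    ultimately show ?thesis by (auto simp: dec_map_def intro!: restrict_ext)
  qed
  ultimately show ?thesis by (auto simp: d_def)
qed

lemma HH1_isomorphic: "HH1 A B \<cong>\<^sub>L decomposition"
  by (rule lie_isomorphic_if_same_kernel[OF lie_algebra_coef hh_map_epi dec_map_epi])
    (simp add: hh_map_eq_iff dec_map_eq_iff)

text \<open>Being diagonal, these matrices commute; they form the abelian subalgebra that lifts
  \<open>frak_a\<close> to matrices.\<close>

lemma tcoef_subalgebra: "lie_subalgebra (range tcoef) (coef_lie QA QB)"
proof -
  have "(\<lambda>a b. 0) = tcoef (\<lambda>\<alpha>. 0)" by (simp add: tcoef_def fun_eq_iff)
  moreover have "(\<lambda>a b. tcoef x a b + tcoef y a b) = tcoef (\<lambda>\<alpha>. x \<alpha> + y \<alpha>)" for x y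
    by (auto simp: tcoef_def fun_eq_iff)
  moreover have "(\<lambda>a b. c * tcoef x a b) = tcoef (\<lambda>\<alpha>. c * x \<alpha>)" for x c
    by (auto simp: tcoef_def fun_eq_iff)
  moreover have "coef_bracket QA (tcoef x) (tcoef y) = tcoef (\<lambda>\<alpha>. 0)" for x y
    unfolding coef_bracket_def by (intro ext trans[OF sum.neutral]) (auto simp: tcoef_def)
  ultimately show ?thesis
    using tcoef_carrier by (auto simp: lie_subalgebra_def lie_subspace_def)
qed

text \<open>The matrices \<open>tcoef c\<close> reach every element of \<open>frak_a\<close>, and
  \<open>tau\<close> acts on them as the injective translation \<open>coef_pair\<close>. Both
  quotients therefore identify two of them exactly when their difference is inner.\<close>

lemma frak_a_in_HH1:
  "\<exists>N. lie_subalgebra N (HH1 A B) \<and> (HH1 A B)\<lparr>lcarrier := N\<rparr> \<cong>\<^sub>L (frak_a QA QB :: ('k, _) lie)"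
proof (intro exI conjI)
  let ?T = "(coef_lie QA QB)\<lparr>lcarrier := range tcoef :: ('b \<Rightarrow> 'b \<Rightarrow> 'k) set\<rparr>"
  note sub = lie_subalgebra_image[OF lie_algebra_coef hh_map_epi tcoef_subalgebra]
  show "lie_subalgebra (hh_map ` range tcoef) (HH1 A B)" by (rule sub(1))
  have img: "frak_a_map ` range tcoef = lcarrier (frak_a QA QB)"
  proof -
    have "frak_a_map m = frak_a_map (tcoef (tr m))" for m
      by (rule frak_a_map_cong) (simp add: tr_tcoef)
    then have "frak_a_map ` coef_carrier QA QB = frak_a_map ` range tcoef"
      using tcoef_carrier by (auto simp: image_iff)
    then show ?thesis using frak_a_map_epi by (simp add: lie_epi_def)
  qed
  have epi: "lie_epi ?T (frak_a QA QB) frak_a_map"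
    using lie_subalgebra_image(2)[OF lie_algebra_coef frak_a_map_epi tcoef_subalgebra]
    unfolding img by simp
  show "(HH1 A B)\<lparr>lcarrier := hh_map ` range tcoef\<rparr> \<cong>\<^sub>L (frak_a QA QB :: ('k, _) lie)"
  proof (rule lie_isomorphic_if_same_kernel[OF lie_algebra_subalgebra[OF lie_algebra_coef tcoef_subalgebra] sub(2) epi])
    fix x y assume "x \<in> lcarrier ?T" "y \<in> lcarrier ?T"
    then obtain c c' where xy: "x = tcoef c" "y = tcoef c'" by auto
    have diff: "(\<lambda>a b. x a b - y a b) = tcoef (\<lambda>\<alpha>. c \<alpha> - c' \<alpha>)"
      by (auto simp: xy tcoef_def fun_eq_iff)
    have "tau x - tau y = tau (\<lambda>a b. x a b - y a b)" by (simp add: tau_linear)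
    also have "\<dots> = coef_pair QA (\<lambda>a b. x a b - y a b)" unfolding diff by (rule tau_tcoef)
    finally have *: "tau x - tau y = coef_pair QA (\<lambda>a b. x a b - y a b)" .
    \<comment> \<open>On block scalar and on inner matrices \<open>tau\<close> determines all
      entries, so a \<open>k\<close> with the same image is the difference itself.\<close>
    have "(\<lambda>a b. x a b - y a b) = k" if k: "k \<in> coef_inner" "tau x - tau y = tau k" for k
    proof (intro ext)
      fix a b
      have "coef_pair QA (\<lambda>a b. x a b - y a b) = coef_pair QA k"
        using k * tau_inner by simp
      then show "x a b - y a b = k a b"
        using coef_pair_eqD[of "\<lambda>a b. x a b - y a b" k a b] k(1)
          coef_carrier_0[of k QA QB a b] tcoef_carrier coef_carrier_0[of x QA QB a b]
          coef_carrier_0[of y QA QB a b]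
        by (cases "a \<in> arcs QA \<and> b \<in> arcs QA") (auto simp: coef_inner_def xy)
    qed
    then have "(\<exists>k\<in>coef_inner. tau x - tau y = tau k) \<longleftrightarrow> (\<lambda>a b. x a b - y a b) \<in> coef_inner"
      using tau_linear(3) by metis
    then show "hh_map x = hh_map y \<longleftrightarrow> frak_a_map x = frak_a_map y"
      using tcoef_carrier by (simp add: hh_map_eq_iff frak_a_map_eq_iff xy)
  qed
qed

end

text \<open>The conjuncts after the isomorphism make the description of the abelian factor precise:
  the subspace divided out is an ideal, the quotient is abelian, and it is realised by a Lie
  subalgebra of the cohomology. That both sides of the isomorphism are Lie algebras is part of
  \<open>lie_isomorphic\<close>.\<close>

theorem theorem3p14:
  fixes QA QB :: "('v, 'b) pre_digraph"
    and A :: "('k::{alg_closed_field, field_char_0}, (('v, 'b) path \<Rightarrow>\<^sub>0 'k) set) module"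
    and B :: "(('v, 'b) path \<Rightarrow>\<^sub>0 'k) set set"
    and \<aa> :: "('k, (('b \<times> ('v, 'b) path) \<Rightarrow>\<^sub>0 'k) set) lie"
  assumes "fin_digraph QA"
    and "A = rsz_algebra QA"
    and "connected_algebra A"
    and "spanning QB QA"
    and "B = rsz_subalgebra QA QB"
    and "\<aa> = frak_a QA QB"
  shows "HH1 A B \<cong>\<^sub>L
      lie_semidirect
        (lie_PiE (classes_S QA QB) (\<lambda>\<alpha>. sl (card \<alpha>)))
        (lie_prod
          (lie_PiE (classes_E QA QB)
            (\<lambda>\<alpha>. lie_semidirect (pair_lie (kI QA \<alpha>)) (pair_lie (frakI QA QB \<alpha>)) pair_bracket))
          \<aa>)
        (sl_act QA QB)
    \<and> lie_ideal (im_delta0_rel QA QB :: (('b \<times> ('v, 'b) path) \<Rightarrow>\<^sub>0 'k) set)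
         (pair_lie (prod_kI QA QB))
    \<and> lie_abelian \<aa>
    \<and> (\<exists>N. lie_subalgebra N (HH1 A B) \<and> (HH1 A B)\<lparr>lcarrier := N\<rparr> \<cong>\<^sub>L \<aa>)"
proof -
  interpret rsz_pair QA QB "TYPE('k)"
    using assms(1,4) by (simp add: rsz_pair_def rsz_pair_axioms_def)
  show ?thesis
    unfolding assms(2,5,6)
    using HH1_isomorphic im_delta0_rel_ideal lie_abelian_frak_a frak_a_in_HH1
    by (simp add: decomposition_def)
qed

end
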